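(* Assume that there is a constant $\alpha>2$ with $\mathbb E(|a|^{\alpha})<1$ and $\mathbb E(|b|^{\alpha})<+\infty$, and that $\mathbb P(b\neq 0)>0$ and $\mathbb E(b)=0$. Assume moreover that at least one of the following holds: (i) $\mathbb E(a)\geq 0$ and, for all $x\in\mathbb R$ and $y>0$, $\mathbb P_x(\tau_y>1)=\mathbb P(ax+b>-y)>0$; (ii) for any $x\in\mathbb R$ and $y>0$ there exists $p_0\in(2,\alpha)$ such that for any constant $c>0$ there exists $n_0\geq 1$ with $\mathbb P_x\big((X_{n_0},y+S_{n_0})\in K_{p_0,c},\ \tau_y>n_0\big)>0$, where $K_{p_0,c}=\{(x',y')\in\mathbb R\times(0,+\infty):\ y'\geq c(1+|x'|^{p_0})\}$. Then: 1. For any $x\in\mathbb R$ and $y>0$, the random variable $M_{\tau_y}$ is integrable, $\mathbb E_x(|M_{\tau_y}|)<+\infty$, and the function $V(x,y)=-\mathbb E_x(M_{\tau_y})$, $x\in\mathbb R$, $y>0$, is well defined on $\mathbb R\times(0,+\infty)$. 2. The function $V$ is positive and $\mathbf Q_+$-harmonic on $\mathbb R\times(0,+\infty)$: for any $x\in\mathbb R$ and $y>0$, $\mathbf Q_+V(x,y)=V(x,y)$. 3. Moreover, $V$ has the following properties: (a) For any $x\in\mathbb R$, the function $V(x,\cdot)$ is non-decreasing. (b) For any $\delta>0$ and $p\in(2,\alpha)$ there is a constant $c_{p,\delta}>0$ such that for all $x\in\mathbb R$ and $y>0$, $$V(x,y)\geq\max\left(0,(1-\delta)y-c_{p,\delta}(1+|x|^{p})\right),$$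 $$V(x,y)\leq\left(1+\delta(1+|x|^{p-1})\right)y+c_{p,\delta}(1+|x|^{p}).$$ (c) For any $x\in\mathbb R$, $\lim_{y\to+\infty}\frac{V(x,y)}{y}=1$.
   Context: Let $(a_i,b_i)_{i\geq1}$ be i.i.d. real random pairs on a probability space with probability $\mathbb P$ and expectation $\mathbb E$, with the same law as a generic pair $(a,b)$. For $x\in\mathbb R$, define $X_0=x$ and $X_{n+1}=a_{n+1}X_n+b_{n+1}$, $n\geq0$; $\mathbb P_x$ and $\mathbb E_x$ denote probability and expectation for the chain started at $X_0=x$. Set $S_0=0$, $S_n=\sum_{i=1}^nX_i$. For $y\in\mathbb R$, $\tau_y=\min\{k\geq1:\ y+S_k\leq0\}$ (this is $\mathbb P_x$-a.s. finite under the moment assumptions made). The martingale $(M_n)_{n\geq0}$ is $$M_n=S_n+\frac{\mathbb E(a)}{1-\mathbb E(a)}(X_n-x),\quad n\geq0.$$ For a function $\varphi$ defined on $\mathbb R\times(0,+\infty)$, $\mathbf Q_+\varphi(x,y)=\mathbb E_x\big(\varphi(X_1,y+S_1)\mathbf 1_{\{y+S_1>0\}}\big)=\mathbb E_x\big(\varphi(X_1,y+S_1)\mathbf 1_{\{\tau_y>1\}}\big)$. Constants $c_{p,\delta}$ depend only on their indices (and on the law of $(a,b)$ and $\alpha$). *)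

theory Defs
  imports "HOL-Probability.Probability"
begin

text \<open>
  The sequences \<open>A\<close>, \<open>B\<close> carry the pairs \<open>(a\<^sub>i, b\<^sub>i)\<close>, \<open>i \<ge> 1\<close>; their values at index \<open>0\<close> are
  never used. The starting point \<open>x\<close> is an explicit argument of every process, so that the
  probability \<open>P\<^sub>x\<close> and expectation \<open>E\<^sub>x\<close> are those of the fixed probability space.
\<close>

fun chain :: "(nat \<Rightarrow> 'w \<Rightarrow> real) \<Rightarrow> (nat \<Rightarrow> 'w \<Rightarrow> real) \<Rightarrow> real \<Rightarrow> nat \<Rightarrow> 'w \<Rightarrow> real" where
  "chain A B x 0 \<omega> = x"
| "chain A B x (Suc n) \<omega> = A (Suc n) \<omega> * chain A B x n \<omega> + B (Suc n) \<omega>"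

definition walk :: "(nat \<Rightarrow> 'w \<Rightarrow> real) \<Rightarrow> (nat \<Rightarrow> 'w \<Rightarrow> real) \<Rightarrow> real \<Rightarrow> nat \<Rightarrow> 'w \<Rightarrow> real" where
  "walk A B x n \<omega> = (\<Sum>i=1..n. chain A B x i \<omega>)"

text \<open>The infimum is a minimum when the set is nonempty, and \<open>\<infinity>\<close> otherwise.\<close>

definition exit_time :: "(nat \<Rightarrow> 'w \<Rightarrow> real) \<Rightarrow> (nat \<Rightarrow> 'w \<Rightarrow> real) \<Rightarrow> real \<Rightarrow> real \<Rightarrow> 'w \<Rightarrow> enat" where
  "exit_time A B x y \<omega> = (INF k\<in>{k. 1 \<le> k \<and> y + walk A B x k \<omega> \<le> 0}. enat k)"

text \<open>Here \<open>a\<close> is the first component of the generic pair; only its expectation enters.\<close>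

definition mart :: "'w measure \<Rightarrow> ('w \<Rightarrow> real) \<Rightarrow> (nat \<Rightarrow> 'w \<Rightarrow> real) \<Rightarrow> (nat \<Rightarrow> 'w \<Rightarrow> real)
    \<Rightarrow> real \<Rightarrow> nat \<Rightarrow> 'w \<Rightarrow> real" where
  "mart M a A B x n \<omega> =
     walk A B x n \<omega>
       + integral\<^sup>L M a / (1 - integral\<^sup>L M a) * (chain A B x n \<omega> - x)"

text \<open>The value \<open>0\<close> on the event that the exit time is infinite is a convention on a null event.\<close>

definition mart_exit :: "'w measure \<Rightarrow> ('w \<Rightarrow> real) \<Rightarrow> (nat \<Rightarrow> 'w \<Rightarrow> real) \<Rightarrow> (nat \<Rightarrow> 'w \<Rightarrow> real)
    \<Rightarrow> real \<Rightarrow> real \<Rightarrow> 'w \<Rightarrow> real" where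
  "mart_exit M a A B x y \<omega> =
     (case exit_time A B x y \<omega> of enat n \<Rightarrow> mart M a A B x n \<omega> | \<infinity> \<Rightarrow> 0)"

definition V :: "'w measure \<Rightarrow> ('w \<Rightarrow> real) \<Rightarrow> (nat \<Rightarrow> 'w \<Rightarrow> real) \<Rightarrow> (nat \<Rightarrow> 'w \<Rightarrow> real)
    \<Rightarrow> real \<Rightarrow> real \<Rightarrow> real" where
  "V M a A B x y = - (\<integral>\<omega>. mart_exit M a A B x y \<omega> \<partial>M)"

text \<open>The indicator makes values of \<open>\<phi>\<close> at nonpositive second arguments irrelevant.\<close>

definition Q_plus :: "'w measure \<Rightarrow> (nat \<Rightarrow> 'w \<Rightarrow> real) \<Rightarrow> (nat \<Rightarrow> 'w \<Rightarrow> real)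
    \<Rightarrow> (real \<Rightarrow> real \<Rightarrow> real) \<Rightarrow> real \<Rightarrow> real \<Rightarrow> real" where
  "Q_plus M A B \<phi> x y =
     (\<integral>\<omega>. \<phi> (chain A B x 1 \<omega>) (y + walk A B x 1 \<omega>) * indicator {0<..} (y + walk A B x 1 \<omega>) \<partial>M)"

definition K :: "real \<Rightarrow> real \<Rightarrow> (real \<times> real) set" where
  "K p c = {(x', y'). 0 < y' \<and> y' \<ge> c * (1 + \<bar>x'\<bar> powr p)}"

end

theory Submission
  imports Defs
begin

text \<open>
  With \<open>m = E a\<close> and \<open>\<rho> = m / (1 - m)\<close> the process \<open>y + S\<^sub>n + \<rho> X\<^sub>n\<close> is a martingale, and at the exit
  time \<open>\<tau>\<close> one has \<open>\<bar>y + S\<^sub>\<tau>\<bar> \<le> \<bar>X\<^sub>\<tau>\<bar>\<close>. Hence everything reduces to the bound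
  \<open>E \<bar>X\<^sub>\<tau>\<bar> \<le> \<delta> y + C (1 + \<bar>x\<bar>)\<close>, where \<open>\<delta> > 0\<close> is arbitrary and \<open>C\<close> depends on \<open>\<delta>\<close>. It comes from a
  superharmonic function for the killed chain. Let \<open>2 < q < 3\<close>, \<open>q \<le> \<alpha>\<close> and let \<open>R\<close> be large. A concave
  function of the martingale that behaves like \<open>(R + y) powr (3 - q)\<close> loses in each step about
  \<open>(R + y) powr (1 - q)\<close> times the variance of the step. This pays for the possible increase of the minimum
  of \<open>L (1 + \<bar>x\<bar>)\<close> and \<open>(1 + \<bar>x\<bar> powr q + B x\<^sup>2) (R + y + \<bar>x\<bar>) powr (1 - q)\<close>, and this minimum
  dominates \<open>\<bar>X\<^sub>\<tau>\<bar>\<close> up to constants. The same function shows that \<open>\<tau>\<close> is finite. Finally \<open>V\<close> is the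
  limit of the iterates of the killed kernel, applied to \<open>y + \<rho> x\<close> or to \<open>y\<close>; the first form gives
  harmonicity, the second one nonnegativity and monotonicity.
\<close>

subsection \<open>Real powers\<close>

text \<open>The exponents are tied together by a second derivative: that of t^(3-q) at height N has
  order N^(1-q), the very factor that multiplies \<open>lyap\<close> in \<open>phi\<close>. As 0 <
  3-q < 1, the power is concave and sublinear, which makes \<delta> arbitrary. As q > 2, the Taylor
  error, measured by the q-th moment of the step, carries an extra factor N^(2-q), negligible for
  large R. Neither term of the minimum works alone. The linear one may rise by a constant near x = 0
  at every height, which a gain of order N^(1-q) cannot pay. In the other one a step can lower the
  argument from N + |x| to N, and this ruins the contraction unless |x| is small against N. A
  further obstacle is that the martingale can be negative at a positive height, when \<rho> x is
  very negative. Hence \<open>theta\<close> lives on the whole line, and R is so large that its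
  slope is small against L; in that region the minimum is the linear term and outweighs the negative
  part.\<close>

lemma powr_le_weighted:
  fixes t s \<alpha> :: real
  assumes "0 \<le> t" "0 < s" "s \<le> \<alpha>"
  shows "t powr s \<le> s / \<alpha> * t powr \<alpha> + (1 - s / \<alpha>)"
proof (cases "t = 0")
  case False
  with assms have t: "0 < t" and \<alpha>: "0 < \<alpha>" and c: "0 \<le> s / \<alpha>" "s / \<alpha> \<le> 1" by auto
  have "exp ((1 - s / \<alpha>) *\<^sub>R 0 + (s / \<alpha>) *\<^sub>R (\<alpha> * ln t)) \<le> (1 - s / \<alpha>) * exp 0 + s / \<alpha> * exp (\<alpha> * ln t)"
    by (rule convex_onD[OF exp_convex]) (use c in auto)
  then show ?thesis
    using t \<alpha> by (simp add: powr_def)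
qed (use assms in auto)

text \<open>Either t \<le> \<eta> s or s < t/\<eta>, and one summand dominates. For small \<eta> the
  factor of s^q is close to 1, so a contraction of |a x|^q survives the addition of b.\<close>

lemma powr_add_le:
  fixes s t \<eta> q :: real
  assumes "0 \<le> s" "0 \<le> t" "0 < \<eta>" "0 \<le> q"
  shows "(s + t) powr q \<le> (1 + \<eta>) powr q * s powr q + (1 + 1 / \<eta>) powr q * t powr q"
proof (cases "t \<le> \<eta> * s")
  case True
  then have "(s + t) powr q \<le> ((1 + \<eta>) * s) powr q"
    using assms by (intro powr_mono2) (auto simp: algebra_simps)
  also have "\<dots> = (1 + \<eta>) powr q * s powr q"
    using assms by (simp add: powr_mult)
  finally show ?thesis by (smt (verit) mult_nonneg_nonneg powr_ge_zero)
next
  case False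
  then have "(s + t) powr q \<le> ((1 + 1 / \<eta>) * t) powr q"
    using assms by (intro powr_mono2) (auto simp: field_simps)
  also have "\<dots> = (1 + 1 / \<eta>) powr q * t powr q"
    using assms by (simp add: powr_mult)
  finally show ?thesis by (smt (verit) mult_nonneg_nonneg powr_ge_zero)
qed

text \<open>On (0, T] the second derivative of - (u^e) is smallest at T, and \<open>k\<close> is
  half of that value. So - (u^e) - k u^2 is still convex, and its tangent inequality is the
  claim.\<close>

lemma powr_below_tangent:
  fixes s t T e :: real
  assumes "0 < s" "s \<le> T" "0 < t" "t \<le> T" "0 < e" "e < 1"
  shows "s powr e \<le> t powr e + e * t powr (e - 1) * (s - t)
           - e * (1 - e) / 2 * T powr (e - 2) * (s - t)\<^sup>2"
proof -
  define k where "k = e * (1 - e) / 2 * T powr (e - 2)"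
  have "(- (e * t powr (e - 1)) - 2 * k * t) * (s - t)
          \<le> (- (s powr e) - k * s\<^sup>2) - (- (t powr e) - k * t\<^sup>2)"
  proof (rule f''_imp_f'[where C = "{0<..T}" and f'' = "\<lambda>u. e * (1 - e) * u powr (e - 2) - 2 * k"])
    fix u assume u: "u \<in> {0<..T}"
    show "((\<lambda>u. - (u powr e) - k * u\<^sup>2) has_real_derivative - (e * u powr (e - 1)) - 2 * k * u) (at u)"
      using u by (auto intro!: derivative_eq_intros)
    have "((\<lambda>u. - (e * u powr (e - 1)) - 2 * k * u) has_real_derivative
            - (e * ((e - 1) * u powr (e - 1 - 1))) - 2 * k) (at u)"
      using u by (auto intro!: derivative_eq_intros)
    then show "((\<lambda>u. - (e * u powr (e - 1)) - 2 * k * u) has_real_derivative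
            e * (1 - e) * u powr (e - 2) - 2 * k) (at u)"
      by (simp add: algebra_simps)
    have "T powr (e - 2) \<le> u powr (e - 2)"
      using u assms by (intro powr_mono2') auto
    then have "e * (1 - e) * T powr (e - 2) \<le> e * (1 - e) * u powr (e - 2)"
      using assms by (intro mult_left_mono) auto
    then show "0 \<le> e * (1 - e) * u powr (e - 2) - 2 * k"
      by (simp add: k_def)
  qed (use assms in auto)
  then show ?thesis
    unfolding k_def[symmetric] by (simp add: power2_eq_square algebra_simps)
qed

text \<open>Below \<open>r\<close> the power is continued by its tangent, which makes the function concave on
  the whole line and its slope at most \<open>r powr (2 - q)\<close>.\<close>

definition theta :: "real \<Rightarrow> real \<Rightarrow> real \<Rightarrow> real" where
  "theta q r t = (if r \<le> t then t powr (3 - q) else r powr (3 - q) + (3 - q) * r powr (2 - q) * (t - r))"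

definition theta' :: "real \<Rightarrow> real \<Rightarrow> real \<Rightarrow> real" where
  "theta' q r t = (3 - q) * max r t powr (2 - q)"

lemma theta_measurable [measurable]: "theta q r \<in> borel_measurable borel"
  unfolding theta_def by measurable

lemma theta'_nonneg: "q < 3 \<Longrightarrow> 0 \<le> theta' q r t"
  by (simp add: theta'_def)

text \<open>Concavity on the whole line. With both points on one side of r it is the tangent
  inequality of the power or an identity; across r the two branches are compared through their
  common value and slope at r.\<close>

lemma theta_tangent:
  assumes "2 < q" "q < 3" "0 < r"
  shows "theta q r s \<le> theta q r t + theta' q r t * (s - t)"
proof -
  have tan: "s powr (3 - q) \<le> t powr (3 - q) + (3 - q) * t powr (2 - q) * (s - t)"
    if "0 < s" "0 < t" for s t :: real
  proof -
    have "0 \<le> (3 - q) * (1 - (3 - q)) / 2 * max s t powr (3 - q - 2) * (s - t)\<^sup>2"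
      using assms by (intro mult_nonneg_nonneg) auto
    moreover have "s powr (3 - q) \<le> t powr (3 - q) + (3 - q) * t powr (3 - q - 1) * (s - t)
        - (3 - q) * (1 - (3 - q)) / 2 * max s t powr (3 - q - 2) * (s - t)\<^sup>2"
      using that assms by (intro powr_below_tangent) auto
    moreover have "3 - q - 1 = 2 - q" by simp
    ultimately show ?thesis by simp
  qed
  have mono: "t powr (2 - q) \<le> r powr (2 - q)" if "r \<le> t" for t
    using that assms by (intro powr_mono2') auto
  consider "r \<le> s" "r \<le> t" | "s < r" "r \<le> t" | "r \<le> s" "t < r" | "s < r" "t < r" by linarith
  then show ?thesis
  proof cases
    case 1 then show ?thesis using tan[of s t] assms by (simp add: theta_def theta'_def)
  next
    case 2
    have "(3 - q) * r powr (2 - q) * (s - r) \<le> (3 - q) * t powr (2 - q) * (s - r)"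
      using 2 assms mono[of t] by (intro mult_right_mono_neg mult_left_mono) auto
    then show ?thesis
      using 2 tan[of r t] assms by (simp add: theta_def theta'_def max_def algebra_simps)
  next
    case 3 then show ?thesis
      using tan[of s r] assms by (simp add: theta_def theta'_def max_def algebra_simps)
  next
    case 4 then show ?thesis
      by (simp add: theta_def theta'_def max_def algebra_simps)
  qed
qed

text \<open>Only the linear branch can be negative, and its slope is at most r^(2-q). This is small
  for large r, so an undershoot w costs only a small multiple of w.\<close>

lemma theta_lower:
  assumes "2 < q" "q < 3" "0 < r" "r - w \<le> t" "0 \<le> w"
  shows "- (r powr (2 - q) * w) \<le> theta q r t"
proof (cases "r \<le> t")
  case True
  have "0 \<le> r powr (2 - q) * w" using assms by (intro mult_nonneg_nonneg) auto
  moreover have "0 \<le> t powr (3 - q)" by simp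
  ultimately have "- (r powr (2 - q) * w) \<le> t powr (3 - q)" by linarith
  then show ?thesis using True by (simp add: theta_def)
next
  case False
  have "(3 - q) * r powr (2 - q) * w \<le> r powr (2 - q) * w"
    using assms by (intro mult_right_mono) (auto intro: mult_left_le_one_le)
  moreover have "(3 - q) * r powr (2 - q) * (- w) \<le> (3 - q) * r powr (2 - q) * (t - r)"
    using assms by (intro mult_left_mono) auto
  moreover have "0 \<le> r powr (3 - q)" by simp
  ultimately show ?thesis
    using False unfolding theta_def by (smt (verit) minus_mult_right)
qed

text \<open>The slope t^(2-q) tends to 0, so the tangent at a far point s has slope at most \<delta>
  and lies above the function. The arbitrary \<delta> of the growth bounds originates here.\<close>

lemma theta_sublinear:
  assumes "2 < q" "q < 3" "0 < r" "0 < \<delta>"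
  shows "\<exists>C\<ge>0. \<forall>t T. t \<le> T \<longrightarrow> 0 \<le> T \<longrightarrow> theta q r t \<le> \<delta> * T + C"
proof -
  define s where "s = max r (\<delta> powr (1 / (2 - q)))"
  have s: "r \<le> s" "0 < s" using assms by (auto simp: s_def)
  have "s powr (2 - q) \<le> (\<delta> powr (1 / (2 - q))) powr (2 - q)"
    using assms by (intro powr_mono2') (auto simp: s_def)
  also have "\<dots> = \<delta>" using assms by (simp add: powr_powr)
  finally have "theta' q r s \<le> (3 - q) * \<delta>"
    using s assms by (simp add: theta'_def max_def mult_left_mono)
  also have "\<dots> \<le> \<delta>" using assms by (auto intro: mult_left_le_one_le)
  finally have d: "theta' q r s \<le> \<delta>" .
  show ?thesis
  proof (intro exI[of _ "theta q r s"] conjI allI impI)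
    show "0 \<le> theta q r s" using s by (simp add: theta_def)
    fix t T :: real assume *: "t \<le> T" "0 \<le> T"
    have "theta q r t \<le> theta q r s + theta' q r s * (t - s)"
      using assms by (intro theta_tangent) auto
    also have "theta' q r s * (t - s) \<le> theta' q r s * T"
      using * s theta'_nonneg[of q r s] assms by (intro mult_left_mono) auto
    also have "\<dots> \<le> \<delta> * T" using * d by (intro mult_right_mono) auto
    finally show "theta q r t \<le> \<delta> * T + theta q r s" by simp
  qed
qed

text \<open>A step with |\<xi>| \<le> N/4 stays in [N/2, 3N/2], hence above r, and
  \<open>powr_below_tangent\<close> applies with T = 3N/2. For a larger step \<xi>^2 is at most
  (N/4)^(2-q) |\<xi>|^q, so the claimed gain is not positive and concavity suffices.\<close>

lemma theta_gain:
  assumes "2 < q" "q < 3" "0 < r" "2 * r \<le> N" "3 * N / 4 \<le> t" "t \<le> 5 * N / 4"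
  shows "theta q r (t + \<xi>) \<le> theta q r t + theta' q r t * \<xi>
     - (3 - q) * (q - 2) / 2 * (3 / 2) powr (1 - q) * N powr (1 - q) * (\<xi>\<^sup>2 - (N / 4) powr (2 - q) * \<bar>\<xi>\<bar> powr q)"
proof -
  define c where "c = (3 - q) * (q - 2) / 2 * (3 / 2) powr (1 - q) * N powr (1 - q)"
  define d where "d = (N / 4) powr (2 - q) * \<bar>\<xi>\<bar> powr q"
  have N: "0 < N" using assms by linarith
  have c: "0 \<le> c" and d: "0 \<le> c * d" using assms by (auto simp: c_def d_def)
  have "theta q r (t + \<xi>) \<le> theta q r t + theta' q r t * \<xi> - c * (\<xi>\<^sup>2 - d)"
  proof (cases "\<bar>\<xi>\<bar> \<le> N / 4")
    case True
    have "(t + \<xi>) powr (3 - q) \<le> t powr (3 - q) + (3 - q) * t powr (3 - q - 1) * (t + \<xi> - t)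
           - (3 - q) * (1 - (3 - q)) / 2 * (3 / 2 * N) powr (3 - q - 2) * (t + \<xi> - t)\<^sup>2"
      using True N assms by (intro powr_below_tangent) (auto simp: abs_le_iff)
    moreover have "(3 - q) * (1 - (3 - q)) / 2 * (3 / 2 * N) powr (3 - q - 2) = c"
      unfolding c_def powr_mult by simp
    ultimately have "(t + \<xi>) powr (3 - q) \<le> t powr (3 - q) + (3 - q) * t powr (2 - q) * \<xi> - c * \<xi>\<^sup>2"
      by simp
    moreover have "theta q r (t + \<xi>) = (t + \<xi>) powr (3 - q)" "theta q r t = t powr (3 - q)"
      "theta' q r t = (3 - q) * t powr (2 - q)"
      using True N assms by (auto simp: theta_def theta'_def max_def abs_le_iff)
    ultimately show ?thesis using d by (simp add: right_diff_distrib)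
  next
    case False
    have "\<xi>\<^sup>2 = \<bar>\<xi>\<bar> powr (2 - q) * \<bar>\<xi>\<bar> powr q"
      using False N by (simp add: powr_add[symmetric])
    also have "\<dots> \<le> d"
      unfolding d_def using False N assms by (intro mult_right_mono powr_mono2') auto
    finally have "c * (\<xi>\<^sup>2 - d) \<le> 0"
      using c by (intro mult_nonneg_nonpos) auto
    with theta_tangent[of q r "t + \<xi>" t] assms show ?thesis by simp
  qed
  then show ?thesis by (simp add: c_def d_def)
qed

subsection \<open>Moments of one step\<close>

lemma integrable_real_bound:
  fixes f g :: "'w \<Rightarrow> real"
  assumes "integrable M g" "f \<in> borel_measurable M" "\<And>\<omega>. \<bar>f \<omega>\<bar> \<le> g \<omega>"
  shows "integrable M f"
  using assms(1,2)
proof (rule Bochner_Integration.integrable_bound)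
  show "AE \<omega> in M. norm (f \<omega>) \<le> norm (g \<omega>)"
    using order_trans[OF assms(3) abs_ge_self] by simp
qed

locale affine_step = prob_space M for M :: "'w measure" +
  fixes a b :: "'w \<Rightarrow> real" and \<alpha> :: real
  assumes a_meas [measurable]: "a \<in> borel_measurable M"
    and b_meas [measurable]: "b \<in> borel_measurable M"
    and alpha: "2 < \<alpha>"
    and a_int: "integrable M (\<lambda>\<omega>. \<bar>a \<omega>\<bar> powr \<alpha>)"
    and a_contr: "(\<integral>\<omega>. \<bar>a \<omega>\<bar> powr \<alpha> \<partial>M) < 1"
    and b_int: "integrable M (\<lambda>\<omega>. \<bar>b \<omega>\<bar> powr \<alpha>)"
    and b_nonzero: "\<P>(\<omega> in M. b \<omega> \<noteq> 0) > 0"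
    and b_mean: "integral\<^sup>L M b = 0"
begin

definition m :: real where "m = integral\<^sup>L M a"

text \<open>The solution of m (1 + \<rho>) = \<rho>, which is the condition for y + S + \<rho> X to
  be a martingale.\<close>

definition \<rho> :: real where "\<rho> = m / (1 - m)"

text \<open>The bound \<open>powr_le_weighted\<close> is affine in t^\<alpha> and equals 1 at t = 1.
  A mean of |a|^\<alpha> below 1 therefore passes to every lower power.\<close>

lemma a_moment:
  assumes "0 < s" "s \<le> \<alpha>"
  shows "integrable M (\<lambda>\<omega>. \<bar>a \<omega>\<bar> powr s)" and "(\<integral>\<omega>. \<bar>a \<omega>\<bar> powr s \<partial>M) < 1"
proof -
  have i: "integrable M (\<lambda>\<omega>. s / \<alpha> * \<bar>a \<omega>\<bar> powr \<alpha> + (1 - s / \<alpha>))"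
    using a_int by auto
  have le: "\<bar>a \<omega>\<bar> powr s \<le> s / \<alpha> * \<bar>a \<omega>\<bar> powr \<alpha> + (1 - s / \<alpha>)" for \<omega>
    using assms by (intro powr_le_weighted) auto
  show *: "integrable M (\<lambda>\<omega>. \<bar>a \<omega>\<bar> powr s)"
    by (rule integrable_real_bound[OF i]) (use le in auto)
  have "(\<integral>\<omega>. \<bar>a \<omega>\<bar> powr s \<partial>M) \<le> (\<integral>\<omega>. s / \<alpha> * \<bar>a \<omega>\<bar> powr \<alpha> + (1 - s / \<alpha>) \<partial>M)"
    using le by (intro integral_mono * i)
  also have "\<dots> = s / \<alpha> * (\<integral>\<omega>. \<bar>a \<omega>\<bar> powr \<alpha> \<partial>M) + (1 - s / \<alpha>)"
    using a_int by (simp add: prob_space)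
  also have "\<dots> < s / \<alpha> * 1 + (1 - s / \<alpha>)"
    using a_contr assms alpha by (intro add_strict_right_mono mult_strict_left_mono) auto
  finally show "(\<integral>\<omega>. \<bar>a \<omega>\<bar> powr s \<partial>M) < 1" by simp
qed

lemma b_moment:
  assumes "0 < s" "s \<le> \<alpha>"
  shows "integrable M (\<lambda>\<omega>. \<bar>b \<omega>\<bar> powr s)"
proof -
  have i: "integrable M (\<lambda>\<omega>. s / \<alpha> * \<bar>b \<omega>\<bar> powr \<alpha> + (1 - s / \<alpha>))"
    using b_int by auto
  have le: "\<bar>b \<omega>\<bar> powr s \<le> s / \<alpha> * \<bar>b \<omega>\<bar> powr \<alpha> + (1 - s / \<alpha>)" for \<omega>
    using assms by (intro powr_le_weighted) auto
  show ?thesis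
    by (rule integrable_real_bound[OF i]) (use le in auto)
qed

lemma integrable_a [simp, intro]: "integrable M a"
  using a_moment(1)[of 1] alpha by (simp add: integrable_abs_iff)

lemma integrable_b [simp, intro]: "integrable M b"
  using b_moment[of 1] alpha by (simp add: integrable_abs_iff)

lemma integrable_a2 [simp, intro]: "integrable M (\<lambda>\<omega>. (a \<omega>)\<^sup>2)"
  using a_moment(1)[of 2] alpha by simp

lemma integrable_b2 [simp, intro]: "integrable M (\<lambda>\<omega>. (b \<omega>)\<^sup>2)"
  using b_moment[of 2] alpha by simp

lemma integrable_ab [simp, intro]: "integrable M (\<lambda>\<omega>. a \<omega> * b \<omega>)"
proof (rule integrable_real_bound)
  show "integrable M (\<lambda>\<omega>. (a \<omega>)\<^sup>2 + (b \<omega>)\<^sup>2)" by simp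
  have "\<bar>u * v\<bar> \<le> u\<^sup>2 + v\<^sup>2" for u v :: real
    using sum_squares_bound[of "\<bar>u\<bar>" "\<bar>v\<bar>"] abs_ge_zero[of "u * v"]
    unfolding abs_mult power2_abs by linarith
  then show "\<bar>a \<omega> * b \<omega>\<bar> \<le> (a \<omega>)\<^sup>2 + (b \<omega>)\<^sup>2" for \<omega> .
qed simp

lemma abs_a_mean_less_1: "(\<integral>\<omega>. \<bar>a \<omega>\<bar> \<partial>M) < 1"
  using a_moment(2)[of 1] alpha by simp

lemma abs_m_less_1: "\<bar>m\<bar> < 1"
  using integral_abs_bound[of M a] abs_a_mean_less_1 unfolding m_def by linarith

lemma b2_pos: "0 < (\<integral>\<omega>. (b \<omega>)\<^sup>2 \<partial>M)"
proof -
  have "\<not> (AE \<omega> in M. (b \<omega>)\<^sup>2 = 0)"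
  proof
    assume "AE \<omega> in M. (b \<omega>)\<^sup>2 = 0"
    then have "AE \<omega> in M. \<not> b \<omega> \<noteq> 0" by auto
    then have "\<P>(\<omega> in M. b \<omega> \<noteq> 0) = 0" by (intro prob_eq_0_AE) auto
    with b_nonzero show False by simp
  qed
  then have "(\<integral>\<omega>. (b \<omega>)\<^sup>2 \<partial>M) \<noteq> 0"
    by (subst integral_nonneg_eq_0_iff_AE) auto
  moreover have "0 \<le> (\<integral>\<omega>. (b \<omega>)\<^sup>2 \<partial>M)" by simp
  ultimately show ?thesis by linarith
qed

lemma mean_affine: "(\<integral>\<omega>. a \<omega> * x + b \<omega> \<partial>M) = m * x"
  by (simp add: b_mean m_def)

lemma integrable_affine2 [simp, intro]: "integrable M (\<lambda>\<omega>. ((a \<omega> - c) * x + b \<omega>)\<^sup>2)"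
proof -
  have "(\<lambda>\<omega>. ((a \<omega> - c) * x + b \<omega>)\<^sup>2) =
      (\<lambda>\<omega>. x\<^sup>2 * (a \<omega>)\<^sup>2 - 2 * c * x\<^sup>2 * a \<omega> + c\<^sup>2 * x\<^sup>2 + 2 * x * (a \<omega> * b \<omega>) - 2 * c * x * b \<omega> + (b \<omega>)\<^sup>2)"
    by (auto simp: power2_eq_square algebra_simps)
  then show ?thesis by simp
qed

definition step_var :: "real \<Rightarrow> real" where
  "step_var x = (\<integral>\<omega>. ((a \<omega> - m) * x + b \<omega>)\<^sup>2 \<partial>M)"

lemma step_var_nonneg: "0 \<le> step_var x"
  by (simp add: step_var_def)

lemma second_moment_affine: "(\<integral>\<omega>. (a \<omega> * x + b \<omega>)\<^sup>2 \<partial>M) = step_var x + m\<^sup>2 * x\<^sup>2"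
proof -
  have "(\<integral>\<omega>. (a \<omega> * x + b \<omega>)\<^sup>2 \<partial>M) =
      (\<integral>\<omega>. ((a \<omega> - m) * x + b \<omega>)\<^sup>2 + (2 * m * x * (a \<omega> * x + b \<omega>) - m\<^sup>2 * x\<^sup>2) \<partial>M)"
    by (intro Bochner_Integration.integral_cong) (auto simp: power2_eq_square algebra_simps)
  also have "\<dots> = step_var x + (\<integral>\<omega>. 2 * m * x * (a \<omega> * x + b \<omega>) - m\<^sup>2 * x\<^sup>2 \<partial>M)"
    unfolding step_var_def by (rule Bochner_Integration.integral_add) auto
  also have "(\<integral>\<omega>. 2 * m * x * (a \<omega> * x + b \<omega>) - m\<^sup>2 * x\<^sup>2 \<partial>M) = 2 * m * x * (m * x) - m\<^sup>2 * x\<^sup>2"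
    by (subst Bochner_Integration.integral_diff) (auto simp: prob_space b_mean m_def)
  finally show ?thesis by (simp add: power2_eq_square)
qed

text \<open>The variance of a step may vanish at one point \<open>x \<noteq> 0\<close>, whence the term in \<open>x\<^sup>2\<close>.\<close>

lemma step_var_lower:
  "(\<integral>\<omega>. (b \<omega>)\<^sup>2 \<partial>M) / 2 \<le> step_var x + (\<integral>\<omega>. (a \<omega> - m)\<^sup>2 \<partial>M) * x\<^sup>2"
proof -
  have i: "integrable M (\<lambda>\<omega>. (a \<omega> - m)\<^sup>2)"
    by (auto simp: power2_diff)
  have "(\<integral>\<omega>. (b \<omega>)\<^sup>2 / 2 \<partial>M) \<le> (\<integral>\<omega>. ((a \<omega> - m) * x + b \<omega>)\<^sup>2 + (a \<omega> - m)\<^sup>2 * x\<^sup>2 \<partial>M)"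
  proof (intro integral_mono)
    have "v\<^sup>2 / 2 \<le> (u + v)\<^sup>2 + u\<^sup>2" for u v :: real
      using zero_le_power2[of "2 * u + v"] by (simp add: power2_eq_square algebra_simps)
    from this[of "b \<omega>" "(a \<omega> - m) * x" for \<omega>]
    show "(b \<omega>)\<^sup>2 / 2 \<le> ((a \<omega> - m) * x + b \<omega>)\<^sup>2 + (a \<omega> - m)\<^sup>2 * x\<^sup>2" for \<omega>
      by (simp add: power_mult_distrib)
  qed (use i in auto)
  also have "\<dots> = step_var x + (\<integral>\<omega>. (a \<omega> - m)\<^sup>2 * x\<^sup>2 \<partial>M)"
    unfolding step_var_def using i by (intro Bochner_Integration.integral_add) auto
  finally show ?thesis by simp
qed

lemma integrable_affine_powr:
  assumes "0 < q" "q \<le> \<alpha>"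
  shows "integrable M (\<lambda>\<omega>. \<bar>a \<omega> * x + b \<omega>\<bar> powr q)"
proof (rule integrable_real_bound)
  show "integrable M (\<lambda>\<omega>. 2 powr q * (\<bar>a \<omega>\<bar> powr q * \<bar>x\<bar> powr q) + 2 powr q * \<bar>b \<omega>\<bar> powr q)"
    using a_moment(1)[of q] b_moment[of q] assms by auto
  have "\<bar>a \<omega> * x + b \<omega>\<bar> powr q \<le> 2 powr q * (\<bar>a \<omega>\<bar> powr q * \<bar>x\<bar> powr q) + 2 powr q * \<bar>b \<omega>\<bar> powr q" for \<omega>
  proof -
    have "\<bar>a \<omega> * x + b \<omega>\<bar> powr q \<le> (\<bar>a \<omega>\<bar> * \<bar>x\<bar> + \<bar>b \<omega>\<bar>) powr q"
      using assms abs_triangle_ineq[of "a \<omega> * x" "b \<omega>"] by (intro powr_mono2) (auto simp: abs_mult)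
    also have "\<dots> \<le> 2 powr q * (\<bar>a \<omega>\<bar> * \<bar>x\<bar>) powr q + 2 powr q * \<bar>b \<omega>\<bar> powr q"
      using powr_add_le[of "\<bar>a \<omega>\<bar> * \<bar>x\<bar>" "\<bar>b \<omega>\<bar>" 1 q] assms by simp
    finally show ?thesis by (simp add: powr_mult)
  qed
  then show "\<bar>\<bar>a \<omega> * x + b \<omega>\<bar> powr q\<bar>
      \<le> 2 powr q * (\<bar>a \<omega>\<bar> powr q * \<bar>x\<bar> powr q) + 2 powr q * \<bar>b \<omega>\<bar> powr q" for \<omega>
    by simp
qed measurable

lemma affine_powr_contraction:
  assumes "0 < q" "q \<le> \<alpha>"
  shows "\<exists>\<kappa> C. 0 < \<kappa> \<and> \<kappa> < 1 \<and> 0 \<le> C \<and> (\<forall>x. (\<integral>\<omega>. \<bar>a \<omega> * x + b \<omega>\<bar> powr q \<partial>M) \<le> \<kappa> * \<bar>x\<bar> powr q + C)"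
proof -
  define k where "k = max (1/2) (\<integral>\<omega>. \<bar>a \<omega>\<bar> powr q \<partial>M)"
  have k: "0 < k" "k < 1" using a_moment(2)[of q] assms by (auto simp: k_def)
  \<comment> \<open>Chosen so that (1 + \<eta>)^q = k^(-1/2), whence \<kappa> = k^(1/2). The maximum
    with 1/2 keeps \<open>k\<close> positive for this negative power.\<close>
  define \<eta> where "\<eta> = k powr (- 1 / (2 * q)) - 1"
  have "1 powr (- 1 / (2 * q)) < k powr (- 1 / (2 * q))"
    using k assms by (intro powr_less_mono2_neg) auto
  then have \<eta>: "0 < \<eta>" by (simp add: \<eta>_def)
  define \<kappa> where "\<kappa> = (1 + \<eta>) powr q * k"
  have "(1 + \<eta>) powr q = k powr (- 1 / 2)"
    using assms by (simp add: \<eta>_def powr_powr)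
  then have "\<kappa> = k powr (- 1 / 2) * k powr 1" using k by (simp add: \<kappa>_def)
  also have "\<dots> = k powr (1 / 2)" by (subst powr_add[symmetric]) simp
  finally have \<kappa>: "0 < \<kappa>" "\<kappa> < 1"
    using k powr_less_mono2[of "1/2" k 1] by auto
  define c where "c = (1 + 1 / \<eta>) powr q"
  define C where "C = c * (\<integral>\<omega>. \<bar>b \<omega>\<bar> powr q \<partial>M)"
  have "(\<integral>\<omega>. \<bar>a \<omega> * x + b \<omega>\<bar> powr q \<partial>M) \<le> \<kappa> * \<bar>x\<bar> powr q + C" for x
  proof -
    have "(\<integral>\<omega>. \<bar>a \<omega> * x + b \<omega>\<bar> powr q \<partial>M)
        \<le> (\<integral>\<omega>. (1 + \<eta>) powr q * (\<bar>a \<omega>\<bar> powr q * \<bar>x\<bar> powr q) + c * \<bar>b \<omega>\<bar> powr q \<partial>M)"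
    proof (intro integral_mono integrable_affine_powr assms)
      show "integrable M (\<lambda>\<omega>. (1 + \<eta>) powr q * (\<bar>a \<omega>\<bar> powr q * \<bar>x\<bar> powr q) + c * \<bar>b \<omega>\<bar> powr q)"
        using a_moment(1)[of q] b_moment[of q] assms by auto
      fix \<omega>
      have "\<bar>a \<omega> * x + b \<omega>\<bar> powr q \<le> (\<bar>a \<omega>\<bar> * \<bar>x\<bar> + \<bar>b \<omega>\<bar>) powr q"
        using assms abs_triangle_ineq[of "a \<omega> * x" "b \<omega>"] by (intro powr_mono2) (auto simp: abs_mult)
      also have "\<dots> \<le> (1 + \<eta>) powr q * (\<bar>a \<omega>\<bar> * \<bar>x\<bar>) powr q + c * \<bar>b \<omega>\<bar> powr q"
        using powr_add_le[of "\<bar>a \<omega>\<bar> * \<bar>x\<bar>" "\<bar>b \<omega>\<bar>" \<eta> q] assms \<eta> by (simp add: c_def)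
      finally show "\<bar>a \<omega> * x + b \<omega>\<bar> powr q \<le> (1 + \<eta>) powr q * (\<bar>a \<omega>\<bar> powr q * \<bar>x\<bar> powr q) + c * \<bar>b \<omega>\<bar> powr q"
        by (simp add: powr_mult)
    qed
    also have "\<dots> = (1 + \<eta>) powr q * ((\<integral>\<omega>. \<bar>a \<omega>\<bar> powr q \<partial>M) * \<bar>x\<bar> powr q) + C"
      unfolding C_def using a_moment(1)[of q] b_moment[of q] assms by simp
    also have "\<dots> \<le> (1 + \<eta>) powr q * (k * \<bar>x\<bar> powr q) + C"
      by (intro add_right_mono mult_left_mono mult_right_mono) (auto simp: k_def)
    finally show ?thesis by (simp add: \<kappa>_def mult.assoc)
  qed
  moreover have "0 \<le> C" by (simp add: C_def c_def)
  ultimately show ?thesis using \<kappa> by blast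
qed

text \<open>The constant 1 + D cannot be contracted near x = 0. It is bounded by h times the
  variance through \<open>step_var_lower\<close>, at the price of h s x^2. The quadratic term pays
  this price: the square of the mean contracts by m^2 < \<kappa>, and B is sized so that B (\<kappa>
  - m^2) = h s.\<close>

lemma quadratic_lyapunov:
  assumes q: "2 < q" "q \<le> \<alpha>"
  shows "\<exists>B \<kappa> C. 0 \<le> B \<and> 0 < \<kappa> \<and> \<kappa> < 1 \<and> 0 \<le> C \<and>
    (\<forall>x. integrable M (\<lambda>\<omega>. 1 + \<bar>a \<omega> * x + b \<omega>\<bar> powr q + B * (a \<omega> * x + b \<omega>)\<^sup>2) \<and>
      (\<integral>\<omega>. 1 + \<bar>a \<omega> * x + b \<omega>\<bar> powr q + B * (a \<omega> * x + b \<omega>)\<^sup>2 \<partial>M)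
        \<le> \<kappa> * (1 + \<bar>x\<bar> powr q + B * x\<^sup>2) + C * step_var x)"
proof -
  from affine_powr_contraction[of q] q obtain k D where k: "0 < k" "k < 1" and D: "0 \<le> D"
    and kD: "\<And>x. (\<integral>\<omega>. \<bar>a \<omega> * x + b \<omega>\<bar> powr q \<partial>M) \<le> k * \<bar>x\<bar> powr q + D" by auto
  have m2: "m\<^sup>2 < 1" using abs_m_less_1 by (simp add: abs_square_less_1)
  define \<kappa> where "\<kappa> = max k ((1 + m\<^sup>2) / 2)"
  have \<kappa>: "0 < \<kappa>" "\<kappa> < 1" "m\<^sup>2 < \<kappa>" "k \<le> \<kappa>"
    using k m2 by (auto simp: \<kappa>_def less_max_iff_disj)
  define s where "s = (\<integral>\<omega>. (a \<omega> - m)\<^sup>2 \<partial>M)"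
  define h where "h = (1 + D) * 2 / (\<integral>\<omega>. (b \<omega>)\<^sup>2 \<partial>M)"
  have s: "0 \<le> s" and h: "0 \<le> h" using b2_pos D by (auto simp: s_def h_def)
  define B where "B = h * s / (\<kappa> - m\<^sup>2)"
  have B: "0 \<le> B" "B * (\<kappa> - m\<^sup>2) = h * s" using s h \<kappa> by (auto simp: B_def)
  have i: "integrable M (\<lambda>\<omega>. \<bar>a \<omega> * x + b \<omega>\<bar> powr q)" "integrable M (\<lambda>\<omega>. B * (a \<omega> * x + b \<omega>)\<^sup>2)" for x
    using integrable_affine_powr[of q] integrable_affine2[of 0] q by auto
  have "(\<integral>\<omega>. 1 + \<bar>a \<omega> * x + b \<omega>\<bar> powr q + B * (a \<omega> * x + b \<omega>)\<^sup>2 \<partial>M)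
        \<le> \<kappa> * (1 + \<bar>x\<bar> powr q + B * x\<^sup>2) + (B + h) * step_var x" for x
  proof -
    have "(\<integral>\<omega>. 1 + \<bar>a \<omega> * x + b \<omega>\<bar> powr q + B * (a \<omega> * x + b \<omega>)\<^sup>2 \<partial>M)
       = 1 + (\<integral>\<omega>. \<bar>a \<omega> * x + b \<omega>\<bar> powr q \<partial>M) + B * (step_var x + m\<^sup>2 * x\<^sup>2)"
      using i[of x] by (simp add: prob_space second_moment_affine[symmetric])
    also have "\<dots> \<le> 1 + (\<kappa> * \<bar>x\<bar> powr q + D) + B * (step_var x + m\<^sup>2 * x\<^sup>2)"
      using kD[of x] mult_right_mono[OF \<kappa>(4), of "\<bar>x\<bar> powr q"] by auto
    also have "\<dots> \<le> \<kappa> * \<bar>x\<bar> powr q + h * (step_var x + s * x\<^sup>2) + B * (step_var x + m\<^sup>2 * x\<^sup>2)"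
    proof -
      have "1 + D = h * ((\<integral>\<omega>. (b \<omega>)\<^sup>2 \<partial>M) / 2)"
        using b2_pos by (simp add: h_def)
      also have "\<dots> \<le> h * (step_var x + s * x\<^sup>2)"
        unfolding s_def by (intro mult_left_mono step_var_lower h)
      finally show ?thesis by linarith
    qed
    also have "\<dots> = \<kappa> * \<bar>x\<bar> powr q + B * (\<kappa> - m\<^sup>2) * x\<^sup>2 + B * m\<^sup>2 * x\<^sup>2 + (B + h) * step_var x"
      unfolding B(2) by (simp add: algebra_simps)
    also have "\<dots> \<le> \<kappa> * (1 + \<bar>x\<bar> powr q + B * x\<^sup>2) + (B + h) * step_var x"
      using \<kappa> by (simp add: algebra_simps)
    finally show ?thesis .
  qed
  then show ?thesis using B h \<kappa> i
    by (intro exI[of _ B] exI[of _ \<kappa>] exI[of _ "B + h"]) auto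
qed

lemma step_powr_bound:
  assumes "0 < q" "q \<le> \<alpha>"
  shows "\<exists>C\<ge>0. \<forall>x. integrable M (\<lambda>\<omega>. \<bar>a \<omega> * x + b \<omega> - m * x\<bar> powr q) \<and>
    (\<integral>\<omega>. \<bar>a \<omega> * x + b \<omega> - m * x\<bar> powr q \<partial>M) \<le> C * (1 + \<bar>x\<bar> powr q)"
proof -
  from affine_powr_contraction[of q] assms obtain k D where k: "0 < k" "k < 1" and D: "0 \<le> D"
    and kD: "\<And>x. (\<integral>\<omega>. \<bar>a \<omega> * x + b \<omega>\<bar> powr q \<partial>M) \<le> k * \<bar>x\<bar> powr q + D" by auto
  have i: "integrable M (\<lambda>\<omega>. 2 powr q * \<bar>a \<omega> * x + b \<omega>\<bar> powr q + 2 powr q * \<bar>x\<bar> powr q)" for x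
    using integrable_affine_powr[of q] assms by auto
  have le: "\<bar>a \<omega> * x + b \<omega> - m * x\<bar> powr q \<le> 2 powr q * \<bar>a \<omega> * x + b \<omega>\<bar> powr q + 2 powr q * \<bar>x\<bar> powr q" for x \<omega>
  proof -
    have "\<bar>m * x\<bar> \<le> \<bar>x\<bar>" using abs_m_less_1 by (simp add: abs_mult mult_left_le_one_le)
    then have "\<bar>a \<omega> * x + b \<omega> - m * x\<bar> powr q \<le> (\<bar>a \<omega> * x + b \<omega>\<bar> + \<bar>x\<bar>) powr q"
      using assms by (intro powr_mono2) auto
    also have "\<dots> \<le> 2 powr q * \<bar>a \<omega> * x + b \<omega>\<bar> powr q + 2 powr q * \<bar>x\<bar> powr q"
      using powr_add_le[of "\<bar>a \<omega> * x + b \<omega>\<bar>" "\<bar>x\<bar>" 1 q] assms by simp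
    finally show ?thesis .
  qed
  have j: "integrable M (\<lambda>\<omega>. \<bar>a \<omega> * x + b \<omega> - m * x\<bar> powr q)" for x
    by (rule integrable_real_bound[OF i[of x]]) (use le in auto)
  show ?thesis
  proof (intro exI[of _ "2 powr q * (D + 2)"] conjI allI j)
    fix x
    have "(\<integral>\<omega>. \<bar>a \<omega> * x + b \<omega> - m * x\<bar> powr q \<partial>M)
        \<le> (\<integral>\<omega>. 2 powr q * \<bar>a \<omega> * x + b \<omega>\<bar> powr q + 2 powr q * \<bar>x\<bar> powr q \<partial>M)"
      by (intro integral_mono i j le)
    also have "\<dots> = 2 powr q * (\<integral>\<omega>. \<bar>a \<omega> * x + b \<omega>\<bar> powr q \<partial>M) + 2 powr q * \<bar>x\<bar> powr q"
      using integrable_affine_powr[of q] assms by (simp add: prob_space)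
    also have "\<dots> \<le> 2 powr q * (k * \<bar>x\<bar> powr q + D) + 2 powr q * \<bar>x\<bar> powr q"
      by (intro add_right_mono mult_left_mono kD) auto
    also have "\<dots> = 2 powr q * (k * \<bar>x\<bar> powr q + D + \<bar>x\<bar> powr q)" by (simp add: algebra_simps)
    also have "\<dots> \<le> 2 powr q * ((D + 2) * (1 + \<bar>x\<bar> powr q))"
    proof (rule mult_left_mono)
      have "k * \<bar>x\<bar> powr q \<le> 1 * \<bar>x\<bar> powr q" "0 \<le> D * \<bar>x\<bar> powr q" "0 \<le> \<bar>x\<bar> powr q"
        using k D by (auto intro: mult_left_le_one_le)
      then show "k * \<bar>x\<bar> powr q + D + \<bar>x\<bar> powr q \<le> (D + 2) * (1 + \<bar>x\<bar> powr q)"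
        using D unfolding distrib_left distrib_right by linarith
    qed simp
    finally show "(\<integral>\<omega>. \<bar>a \<omega> * x + b \<omega> - m * x\<bar> powr q \<partial>M) \<le> 2 powr q * (D + 2) * (1 + \<bar>x\<bar> powr q)"
      by (simp add: mult.assoc)
  qed (use D in auto)
qed

end

lemma theta_linear_bound:
  assumes "2 < q" "q < 3" "0 < r"
  shows "\<exists>C\<ge>0. \<forall>t. \<bar>theta q r t\<bar> \<le> C * (1 + \<bar>t\<bar>)"
proof -
  obtain C where C: "0 \<le> C" "\<And>t T. t \<le> T \<Longrightarrow> 0 \<le> T \<Longrightarrow> theta q r t \<le> 1 * T + C"
    using theta_sublinear[of q r 1] assms by auto
  define p where "p = r powr (2 - q)"
  have p: "0 \<le> p" by (simp add: p_def)
  have "\<bar>theta q r t\<bar> \<le> (1 + C + p + p * r) * (1 + \<bar>t\<bar>)" for t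
  proof -
    have "theta q r t \<le> \<bar>t\<bar> + C" using C(2)[of t "\<bar>t\<bar>"] by simp
    moreover have "- (p * (\<bar>t\<bar> + r)) \<le> theta q r t"
      unfolding p_def using assms by (intro theta_lower) auto
    moreover have "0 \<le> C * \<bar>t\<bar>" "0 \<le> p * \<bar>t\<bar>" "0 \<le> p * r" "0 \<le> p * r * \<bar>t\<bar>"
      using C p assms by auto
    ultimately show ?thesis
      using C(1) p abs_ge_zero[of t] unfolding abs_le_iff distrib_left distrib_right by linarith
  qed
  then show ?thesis using C p assms by (intro exI[of _ "1 + C + p + p * r"]) auto
qed

subsection \<open>The drift inequality\<close>

definition lyap :: "real \<Rightarrow> real \<Rightarrow> real \<Rightarrow> real" where
  "lyap B q x = 1 + \<bar>x\<bar> powr q + B * x\<^sup>2"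

text \<open>In use N is \<open>R + y + |x|\<close> before a step and \<open>R + y\<close> after it:
  the new position X satisfies y + X + |X| \<ge> y, so \<open>R + y\<close> bounds the next argument
  from below and does not depend on the step.\<close>

definition phi :: "real \<Rightarrow> real \<Rightarrow> real \<Rightarrow> real \<Rightarrow> real \<Rightarrow> real" where
  "phi L B q x N = min (L * (1 + \<bar>x\<bar>)) (lyap B q x * N powr (1 - q))"

lemma lyap_measurable [measurable]: "lyap B q \<in> borel_measurable borel"
  unfolding lyap_def by measurable

lemma lyap_ge: "0 \<le> B \<Longrightarrow> 1 + \<bar>x\<bar> powr q \<le> lyap B q x"
  by (simp add: lyap_def)

lemma lyap_ge_1: "0 \<le> B \<Longrightarrow> 1 \<le> lyap B q x"
  by (simp add: lyap_def)

lemma phi_nonneg: "0 \<le> B \<Longrightarrow> 0 \<le> L \<Longrightarrow> 0 \<le> phi L B q x N"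
  using lyap_ge_1[of B q x] by (simp add: phi_def)

lemma phi_antimono:
  assumes "0 \<le> B" "1 < q" "0 < N" "N \<le> N'"
  shows "phi L B q x N' \<le> phi L B q x N"
proof -
  have "N' powr (1 - q) \<le> N powr (1 - q)" using assms by (intro powr_mono2') auto
  then have "lyap B q x * N' powr (1 - q) \<le> lyap B q x * N powr (1 - q)"
    using lyap_ge_1[OF assms(1), of q x] by (intro mult_left_mono) auto
  then show ?thesis by (auto simp: phi_def)
qed

text \<open>For |x| > \<epsilon> N the sum N + |x| is at most (1 + 1/\<epsilon>) |x|, so the second
  term is at least a fixed multiple of |x|. L is below half of that multiple, and 1 + |x| < 2
  |x|.\<close>

lemma phi_eq_first:
  assumes "0 \<le> B" "1 < q" "0 < \<epsilon>" "1 \<le> \<epsilon> * N" "\<epsilon> * N < \<bar>x\<bar>"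
    and L: "0 < L" "L \<le> (1 + 1 / \<epsilon>) powr (1 - q) / 2"
  shows "phi L B q x (N + \<bar>x\<bar>) = L * (1 + \<bar>x\<bar>)"
proof -
  have N: "0 < N" using assms(3,4) by (smt (verit) mult_nonneg_nonpos)
  have x: "1 < \<bar>x\<bar>" using assms by linarith
  have "N + \<bar>x\<bar> \<le> (1 + 1 / \<epsilon>) * \<bar>x\<bar>"
    using assms(3,5) by (simp add: field_simps)
  then have "((1 + 1 / \<epsilon>) * \<bar>x\<bar>) powr (1 - q) \<le> (N + \<bar>x\<bar>) powr (1 - q)"
    using N x assms by (intro powr_mono2') auto
  then have *: "(1 + 1 / \<epsilon>) powr (1 - q) * \<bar>x\<bar> powr (1 - q) \<le> (N + \<bar>x\<bar>) powr (1 - q)"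
    by (simp add: powr_mult)
  have "L * (1 + \<bar>x\<bar>) \<le> (2 * L) * \<bar>x\<bar>"
    using x L mult_left_mono[of 1 "\<bar>x\<bar>" L] by (simp add: algebra_simps)
  also have "\<dots> \<le> (1 + 1 / \<epsilon>) powr (1 - q) * \<bar>x\<bar>"
    using L x by (intro mult_right_mono) auto
  also have "\<dots> = (1 + 1 / \<epsilon>) powr (1 - q) * (\<bar>x\<bar> powr q * \<bar>x\<bar> powr (1 - q))"
    using x by (simp add: powr_add[symmetric])
  also have "\<dots> \<le> \<bar>x\<bar> powr q * (N + \<bar>x\<bar>) powr (1 - q)"
    using mult_left_mono[OF *, of "\<bar>x\<bar> powr q"] by (simp add: mult_ac)
  also have "\<dots> \<le> lyap B q x * (N + \<bar>x\<bar>) powr (1 - q)"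
    using lyap_ge[OF assms(1), of x q] by (intro mult_right_mono) auto
  finally show ?thesis by (simp add: phi_def)
qed

text \<open>With u = 1 + |x| one has \<open>lyap\<close> \<le> (2 + B) u^q, so the linear term can
  be the smaller one only if L \<le> (2 + B) u^(q-1) R^(1-q). A large R thus forces |x| beyond any
  prescribed threshold, where |x| contracts in mean.\<close>

lemma phi_first_imp_large:
  assumes "0 \<le> B" "2 < q" "0 < R" "R \<le> N" "0 < L"
    and R: "(2 + B) * W powr (q - 1) * R powr (1 - q) < L"
    and first: "L * (1 + \<bar>x\<bar>) \<le> lyap B q x * (N + \<bar>x\<bar>) powr (1 - q)"
  shows "W \<le> 1 + \<bar>x\<bar>"
proof (rule ccontr)
  assume "\<not> W \<le> 1 + \<bar>x\<bar>"
  then have W: "1 + \<bar>x\<bar> < W" by simp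
  define u where "u = 1 + \<bar>x\<bar>"
  have u: "1 \<le> u" "0 < u" by (auto simp: u_def)
  have 1: "1 \<le> u powr q" using u assms by (intro ge_one_powr_ge_zero) auto
  have 2: "\<bar>x\<bar> powr q \<le> u powr q" using assms by (intro powr_mono2) (auto simp: u_def)
  have "x\<^sup>2 \<le> u\<^sup>2" by (subst abs_le_square_iff[symmetric]) (auto simp: u_def)
  also have "\<dots> = u powr 2" using u by simp
  also have "\<dots> \<le> u powr q" using u assms by (intro powr_mono) auto
  finally have 3: "B * x\<^sup>2 \<le> B * u powr q" using assms by (intro mult_left_mono) auto
  have lu: "lyap B q x \<le> (2 + B) * u powr q"
    using 1 2 3 unfolding lyap_def by (simp add: algebra_simps)
  have "L * u \<le> lyap B q x * (N + \<bar>x\<bar>) powr (1 - q)" using first by (simp add: u_def)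
  also have "\<dots> \<le> ((2 + B) * u powr q) * R powr (1 - q)"
    using lu assms lyap_ge_1[OF assms(1), of q x] by (intro mult_mono powr_mono2') auto
  also have "u powr q = u * u powr (q - 1)" using u by (simp add: powr_mult_base)
  also have "(2 + B) * (u * u powr (q - 1)) * R powr (1 - q) = ((2 + B) * u powr (q - 1) * R powr (1 - q)) * u"
    by simp
  also have "\<dots> \<le> ((2 + B) * W powr (q - 1) * R powr (1 - q)) * u"
    using W u assms by (intro mult_right_mono mult_left_mono powr_mono2) (auto simp: u_def)
  also have "\<dots> < L * u" using R u by (intro mult_strict_right_mono) auto
  finally show False by simp
qed

section \<open>Increments of the martingale and the mean change of its concave function\<close>

context affine_step
begin

text \<open>The increment of y + S + \<rho> X in one step from x; the factor 1/(1 - m) is 1 +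
  \<rho>.\<close>

definition \<xi> :: "real \<Rightarrow> 'w \<Rightarrow> real" where
  "\<xi> x \<omega> = (a \<omega> * x + b \<omega> - m * x) / (1 - m)"

lemma \<xi>_measurable [measurable]: "\<xi> x \<in> borel_measurable M"
  unfolding \<xi>_def by measurable

lemma shift_\<xi>: "y + (a \<omega> * x + b \<omega>) + \<rho> * (a \<omega> * x + b \<omega>) = y + \<rho> * x + \<xi> x \<omega>"
proof -
  have "X + m / (1 - m) * X = X / (1 - m)" for X
    using abs_m_less_1 by (simp add: field_simps)
  from this[of "a \<omega> * x + b \<omega>"] show ?thesis
    by (simp add: \<xi>_def \<rho>_def diff_divide_distrib)
qed

lemma integrable_\<xi> [simp]: "integrable M (\<xi> x)"
  unfolding \<xi>_def by auto

lemma mean_\<xi>: "(\<integral>\<omega>. \<xi> x \<omega> \<partial>M) = 0"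
  unfolding \<xi>_def using mean_affine[of x] by (simp add: prob_space)

lemma mean_\<xi>2: "integrable M (\<lambda>\<omega>. (\<xi> x \<omega>)\<^sup>2)" "(\<integral>\<omega>. (\<xi> x \<omega>)\<^sup>2 \<partial>M) = step_var x / (1 - m)\<^sup>2"
proof -
  have *: "(\<lambda>\<omega>. (\<xi> x \<omega>)\<^sup>2) = (\<lambda>\<omega>. ((a \<omega> - m) * x + b \<omega>)\<^sup>2 / (1 - m)\<^sup>2)"
    by (auto simp: \<xi>_def power_divide algebra_simps)
  show "integrable M (\<lambda>\<omega>. (\<xi> x \<omega>)\<^sup>2)" "(\<integral>\<omega>. (\<xi> x \<omega>)\<^sup>2 \<partial>M) = step_var x / (1 - m)\<^sup>2"
    unfolding * step_var_def using integrable_affine2 by auto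
qed

lemma mean_\<xi>_powr:
  assumes "0 < q" "q \<le> \<alpha>"
  shows "\<exists>C\<ge>0. \<forall>x. integrable M (\<lambda>\<omega>. \<bar>\<xi> x \<omega>\<bar> powr q) \<and> (\<integral>\<omega>. \<bar>\<xi> x \<omega>\<bar> powr q \<partial>M) \<le> C * (1 + \<bar>x\<bar> powr q)"
proof -
  from step_powr_bound[OF assms] obtain C where C: "0 \<le> C"
    "\<And>x. integrable M (\<lambda>\<omega>. \<bar>a \<omega> * x + b \<omega> - m * x\<bar> powr q)"
    "\<And>x. (\<integral>\<omega>. \<bar>a \<omega> * x + b \<omega> - m * x\<bar> powr q \<partial>M) \<le> C * (1 + \<bar>x\<bar> powr q)" by auto
  have *: "(\<lambda>\<omega>. \<bar>\<xi> x \<omega>\<bar> powr q) = (\<lambda>\<omega>. \<bar>a \<omega> * x + b \<omega> - m * x\<bar> powr q / (1 - m) powr q)" for x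
    using abs_m_less_1 by (auto simp: \<xi>_def powr_divide abs_divide)
  show ?thesis
    using C unfolding * by (intro exI[of _ "C / (1 - m) powr q"]) (auto simp: divide_right_mono)
qed

lemma integrable_theta_\<xi>:
  assumes "2 < q" "q < 3" "0 < r"
  shows "integrable M (\<lambda>\<omega>. theta q r (t + \<xi> x \<omega>))"
proof -
  obtain C where C: "0 \<le> C" "\<And>t. \<bar>theta q r t\<bar> \<le> C * (1 + \<bar>t\<bar>)"
    using theta_linear_bound assms by blast
  show ?thesis
  proof (rule integrable_real_bound[where g = "\<lambda>\<omega>. C * (1 + \<bar>t + \<xi> x \<omega>\<bar>)"])
    show "integrable M (\<lambda>\<omega>. C * (1 + \<bar>t + \<xi> x \<omega>\<bar>))" by auto
  qed (use C in auto)
qed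

lemma mean_theta_le:
  assumes "2 < q" "q < 3" "0 < r"
  shows "(\<integral>\<omega>. theta q r (t + \<xi> x \<omega>) \<partial>M) \<le> theta q r t"
proof -
  have "(\<integral>\<omega>. theta q r (t + \<xi> x \<omega>) \<partial>M) \<le> (\<integral>\<omega>. theta q r t + theta' q r t * \<xi> x \<omega> \<partial>M)"
    using theta_tangent[OF assms, of "t + \<xi> x \<omega>" t for \<omega>]
    by (intro integral_mono integrable_theta_\<xi> assms) auto
  also have "\<dots> = theta q r t"
    by (simp add: mean_\<xi> prob_space)
  finally show ?thesis .
qed

text \<open>The linear term of \<open>theta_gain\<close> has mean zero. The constants c and C do not
  depend on r, N, t and x, which allows R to be chosen after them.\<close>

lemma mean_theta_gain:
  assumes q: "2 < q" "q < 3" "q \<le> \<alpha>"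
  shows "\<exists>c>0. \<exists>C\<ge>0. \<forall>r N t x. 0 < r \<longrightarrow> 2 * r \<le> N \<longrightarrow> 3 * N / 4 \<le> t \<longrightarrow> t \<le> 5 * N / 4 \<longrightarrow>
    (\<integral>\<omega>. theta q r (t + \<xi> x \<omega>) \<partial>M)
      \<le> theta q r t - N powr (1 - q) * (c * step_var x - C * (N / 4) powr (2 - q) * (1 + \<bar>x\<bar> powr q))"
proof -
  from mean_\<xi>_powr[of q] q obtain C where C: "0 \<le> C"
    "\<And>x. integrable M (\<lambda>\<omega>. \<bar>\<xi> x \<omega>\<bar> powr q)"
    "\<And>x. (\<integral>\<omega>. \<bar>\<xi> x \<omega>\<bar> powr q \<partial>M) \<le> C * (1 + \<bar>x\<bar> powr q)" by auto
  define c where "c = (3 - q) * (q - 2) / 2 * (3 / 2) powr (1 - q)"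
  have c: "0 < c" using q by (simp add: c_def)
  have m1: "0 < 1 - m" using abs_m_less_1 by auto
  show ?thesis
  proof (rule exI[of _ "c / (1 - m)\<^sup>2"], rule conjI, use c m1 in simp,
      rule exI[of _ "c * C"], intro conjI allI impI)
    fix r N t x :: real
    assume *: "0 < r" "2 * r \<le> N" "3 * N / 4 \<le> t" "t \<le> 5 * N / 4"
    let ?d = "(N / 4) powr (2 - q)"
    have "(\<integral>\<omega>. theta q r (t + \<xi> x \<omega>) \<partial>M) \<le> (\<integral>\<omega>. theta q r t + theta' q r t * \<xi> x \<omega>
        - c * N powr (1 - q) * ((\<xi> x \<omega>)\<^sup>2 - ?d * \<bar>\<xi> x \<omega>\<bar> powr q) \<partial>M)"
      unfolding c_def using q * C(2) mean_\<xi>2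
      by (intro integral_mono integrable_theta_\<xi> theta_gain) auto
    also have "\<dots> = theta q r t
        - c * N powr (1 - q) * (step_var x / (1 - m)\<^sup>2 - ?d * (\<integral>\<omega>. \<bar>\<xi> x \<omega>\<bar> powr q \<partial>M))"
      using C(2) mean_\<xi>2 by (simp add: mean_\<xi> prob_space)
    also have "\<dots> \<le> theta q r t
        - c * N powr (1 - q) * (step_var x / (1 - m)\<^sup>2 - ?d * (C * (1 + \<bar>x\<bar> powr q)))"
      using c C(3)[of x] by (intro diff_left_mono mult_left_mono) auto
    also have "\<dots> = theta q r t - N powr (1 - q) * (c / (1 - m)\<^sup>2 * step_var x - c * C * ?d * (1 + \<bar>x\<bar> powr q))"
      by (simp add: algebra_simps)
    finally show "(\<integral>\<omega>. theta q r (t + \<xi> x \<omega>) \<partial>M)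
      \<le> theta q r t - N powr (1 - q) * (c / (1 - m)\<^sup>2 * step_var x - c * C * ?d * (1 + \<bar>x\<bar> powr q))" .
  qed (use c C m1 in auto)
qed

end

definition killed :: "(real \<Rightarrow> real \<Rightarrow> real) \<Rightarrow> real \<Rightarrow> real \<Rightarrow> real" where
  "killed F x y = F x y * indicator {0<..} y"

definition exited :: "(real \<Rightarrow> real \<Rightarrow> real) \<Rightarrow> real \<Rightarrow> real \<Rightarrow> real" where
  "exited F x y = F x y * indicator {..0} y"

lemma powr_neg_eventually_less:
  fixes s c :: real
  assumes "s < 0" "0 < c"
  shows "eventually (\<lambda>R. R powr s < c) at_top"
  using order_tendstoD(2)[OF tendsto_neg_powr[OF assms(1) filterlim_ident] assms(2)] .

context affine_step
begin

text \<open>One step without killing, written with the generic pair: the analysis of the kernel then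
  needs no sequence of independent copies.\<close>

definition trans_op :: "(real \<Rightarrow> real \<Rightarrow> real) \<Rightarrow> real \<Rightarrow> real \<Rightarrow> real" where
  "trans_op G x y = (\<integral>\<omega>. G (a \<omega> * x + b \<omega>) (y + (a \<omega> * x + b \<omega>)) \<partial>M)"

text \<open>The term \<open>L (1 + \<bar>x\<bar>)\<close> of \<open>phi\<close> contracts when \<open>\<bar>x\<bar>\<close> is comparable to the height; the other term
  contracts otherwise, up to a multiple of the step variance, which \<open>theta\<close> of the martingale pays for.\<close>

lemma drift_inequality:
  assumes q: "2 < q" "q < 3" "q \<le> \<alpha>"
  shows "\<exists>A B L R c. 0 < A \<and> 0 \<le> B \<and> 0 < L \<and> 0 < R \<and> 0 < c \<and>
    L \<le> 2 powr (1 - q) \<and> A * (R / 2) powr (2 - q) * (1 + \<bar>\<rho>\<bar>) \<le> L / 2 \<and>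
    (\<forall>x y. 0 < y \<longrightarrow> R / 2 + y \<le> \<bar>\<rho>\<bar> * \<bar>x\<bar> \<longrightarrow> phi L B q x (R + y + \<bar>x\<bar>) = L * (1 + \<bar>x\<bar>)) \<and>
    (\<forall>x y. 0 < y \<longrightarrow>
      (\<integral>\<omega>. A * theta q (R / 2) (R + y + \<rho> * x + \<xi> x \<omega>) + phi L B q (a \<omega> * x + b \<omega>) (R + y) \<partial>M)
      \<le> A * theta q (R / 2) (R + y + \<rho> * x) + (1 - c) * phi L B q x (R + y + \<bar>x\<bar>))"
proof -
  from quadratic_lyapunov[of q] q obtain B k C where B: "0 \<le> B" and k: "0 < k" "k < 1" and C: "0 \<le> C"
    and lyap_int: "\<And>x. integrable M (\<lambda>\<omega>. lyap B q (a \<omega> * x + b \<omega>))"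
    and lyap_drift: "\<And>x. (\<integral>\<omega>. lyap B q (a \<omega> * x + b \<omega>) \<partial>M) \<le> k * lyap B q x + C * step_var x"
    unfolding lyap_def by auto
  define k1 where "k1 = (\<integral>\<omega>. \<bar>a \<omega>\<bar> \<partial>M)"
  define C1 where "C1 = (\<integral>\<omega>. \<bar>b \<omega>\<bar> \<partial>M)"
  define \<kappa> where "\<kappa> = max k k1"
  define \<kappa>' where "\<kappa>' = (1 + \<kappa>) / 2"
  have C1: "0 \<le> C1" by (simp add: C1_def)
  have \<kappa>: "0 < \<kappa>" "\<kappa> < \<kappa>'" "\<kappa>' < 1" "k \<le> \<kappa>" "k1 \<le> \<kappa>"
    using k abs_a_mean_less_1 by (auto simp: \<kappa>_def \<kappa>'_def k1_def max_def)
  from mean_theta_gain[of q] q obtain d D where d: "0 < d" and D: "0 \<le> D"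
    and gain: "\<And>r N t x. 0 < r \<Longrightarrow> 2 * r \<le> N \<Longrightarrow> 3 * N / 4 \<le> t \<Longrightarrow> t \<le> 5 * N / 4 \<Longrightarrow>
      (\<integral>\<omega>. theta q r (t + \<xi> x \<omega>) \<partial>M)
      \<le> theta q r t - N powr (1 - q) * (d * step_var x - D * (N / 4) powr (2 - q) * (1 + \<bar>x\<bar> powr q))"
    by blast

  \<comment> \<open>Two demands on \<epsilon>. If |x| \<le> \<epsilon> N, replacing N + |x| by N
    costs the factor (1 + \<epsilon>)^(q-1), which must fit between \<kappa> and \<kappa>'. The
    martingale value N + \<rho> x must also stay within N/4 of N, as \<open>gain\<close>
    requires.\<close>
  have "((\<lambda>e. (1 + e) powr (q - 1) * \<kappa>) \<longlongrightarrow> (1 + 0) powr (q - 1) * \<kappa>) (at_right 0)"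
    by (intro tendsto_intros) auto
  then have "eventually (\<lambda>e. (1 + e) powr (q - 1) * \<kappa> < \<kappa>') (at_right 0)"
    using \<kappa> by (intro order_tendstoD(2)) auto
  moreover have "eventually (\<lambda>e::real. 0 < e) (at_right 0)" by (simp add: eventually_at_right_less)
  moreover have "eventually (\<lambda>e::real. e < min 1 (1 / (4 * (1 + \<bar>\<rho>\<bar>)))) (at_right 0)"
    by (rule order_tendstoD(2)[OF tendsto_ident_at]) auto
  ultimately have "eventually (\<lambda>e. (1 + e) powr (q - 1) * \<kappa> < \<kappa>' \<and> 0 < e \<and> e < 1 \<and> e < 1 / (4 * (1 + \<bar>\<rho>\<bar>))) (at_right 0)"
    by eventually_elim (simp only: min_less_iff_conj)
  then obtain \<epsilon> where e: "(1 + \<epsilon>) powr (q - 1) * \<kappa> < \<kappa>'" "0 < \<epsilon>" "\<epsilon> < 1" "\<epsilon> < 1 / (4 * (1 + \<bar>\<rho>\<bar>))"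
    using eventually_happens'[OF trivial_limit_at_right_real] by blast
  have e\<rho>: "(1 + \<bar>\<rho>\<bar>) * \<epsilon> < 1 / 4" using e(4) by (simp add: field_simps)

  \<comment> \<open>The bound 2^(1-q) serves the exit from the half-line; the other one makes the
    linear term the minimum for |x| > \<epsilon> N.\<close>
  define L where "L = min (2 powr (1 - q)) ((1 + 1 / \<epsilon>) powr (1 - q) / 2)"
  have "0 < 1 + 1 / \<epsilon>" using e by (intro add_pos_pos) auto
  then have L: "0 < L" "L \<le> 2 powr (1 - q)" "L \<le> (1 + 1 / \<epsilon>) powr (1 - q) / 2"
    by (auto simp: L_def)
  \<comment> \<open>A d \<ge> C lets the concave gain cover the variance term of
    \<open>lyap_drift\<close>.\<close>
  define A where "A = C / d + 1"
  have A: "0 < A" "C \<le> A * d" using C d by (auto simp: A_def field_simps add_nonneg_pos)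
  \<comment> \<open>For 1 + |x| \<ge> W the linear term contracts: 1 + \<kappa> |x| + C1 \<le>
    \<kappa>' (1 + |x|).\<close>
  define W where "W = (1 + C1) / (\<kappa>' - \<kappa>)"
  have W: "0 < W" "(1 + C1) = (\<kappa>' - \<kappa>) * W" using C1 \<kappa> by (auto simp: W_def)

  \<comment> \<open>S makes three quantities small: the bound that forces |x| past the threshold W,
    the slope of \<open>theta\<close> below R/2 against L, and the Taylor error against 1 -
    \<kappa>'. With R = 4 S, both R/2 and N/4 for N \<ge> R are at least S.\<close>
  have "eventually (\<lambda>S. S powr (1 - q) < L / ((2 + B) * W powr (q - 1))) at_top"
    using q B W L by (intro powr_neg_eventually_less) auto
  moreover have "eventually (\<lambda>S. S powr (2 - q) < L / (2 * A * (1 + \<bar>\<rho>\<bar>))) at_top"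
    using q A L by (intro powr_neg_eventually_less) auto
  moreover have "eventually (\<lambda>S. S powr (2 - q) < (1 - \<kappa>') / (8 * A * (D + 1))) at_top"
    using q A D \<kappa> by (intro powr_neg_eventually_less divide_pos_pos mult_pos_pos) auto
  moreover have "eventually (\<lambda>S. 1 / \<epsilon> \<le> S) at_top" by (rule eventually_ge_at_top)
  ultimately have "eventually (\<lambda>S. S powr (1 - q) < L / ((2 + B) * W powr (q - 1)) \<and>
      S powr (2 - q) < L / (2 * A * (1 + \<bar>\<rho>\<bar>)) \<and> S powr (2 - q) < (1 - \<kappa>') / (8 * A * (D + 1)) \<and> 1 / \<epsilon> \<le> S) at_top"
    by eventually_elim auto
  then obtain S where S: "S powr (1 - q) < L / ((2 + B) * W powr (q - 1))"
      "S powr (2 - q) < L / (2 * A * (1 + \<bar>\<rho>\<bar>))" "S powr (2 - q) < (1 - \<kappa>') / (8 * A * (D + 1))" "1 / \<epsilon> \<le> S"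
    using eventually_happens'[OF trivial_limit_at_top_linorder] by blast
  define R where "R = 4 * S"
  have "0 < 1 / \<epsilon>" using e by simp
  with S have S0: "0 < S" by linarith
  have R: "0 < R" "1 \<le> \<epsilon> * R" using S(4) S0 e by (auto simp: R_def field_simps)
  have R1: "(2 + B) * W powr (q - 1) * R powr (1 - q) < L"
  proof -
    have "R powr (1 - q) \<le> S powr (1 - q)"
      using S0 q by (intro powr_mono2') (auto simp: R_def)
    also note S(1)
    finally have "R powr (1 - q) * ((2 + B) * W powr (q - 1)) < L" using B W
      by (subst (asm) pos_less_divide_eq) (auto intro!: mult_pos_pos)
    then show ?thesis by (simp add: mult_ac)
  qed
  have R2: "A * (R / 2) powr (2 - q) * (1 + \<bar>\<rho>\<bar>) \<le> L / 2"
  proof -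
    have "(R / 2) powr (2 - q) \<le> S powr (2 - q)"
      using S0 q by (intro powr_mono2') (auto simp: R_def)
    also note S(2)
    finally have "(R / 2) powr (2 - q) * (2 * A * (1 + \<bar>\<rho>\<bar>)) < L" using A
      by (subst (asm) pos_less_divide_eq) (auto intro!: mult_pos_pos add_pos_nonneg)
    then show ?thesis by (simp add: algebra_simps)
  qed
  have R3: "A * (D * (N / 4) powr (2 - q)) \<le> (1 - \<kappa>') / 8" if "R \<le> N" for N
  proof -
    have "(N / 4) powr (2 - q) \<le> S powr (2 - q)"
      using S0 q that by (intro powr_mono2') (auto simp: R_def)
    also note S(3)
    finally have "(N / 4) powr (2 - q) * (8 * A * (D + 1)) < 1 - \<kappa>'" using A D
      by (subst (asm) pos_less_divide_eq) (auto intro!: mult_pos_pos)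
    moreover have "(N / 4) powr (2 - q) * (8 * A * D) \<le> (N / 4) powr (2 - q) * (8 * A * (D + 1))"
      using A by (intro mult_left_mono) auto
    ultimately show ?thesis by (simp add: mult_ac)
  qed

  define c where "c = (1 - \<kappa>') / 2"
  have c: "0 < c" "\<kappa>' + c = 1 - c" using \<kappa> by (auto simp: c_def field_simps)

  have large: "phi L B q x (R + y + \<bar>x\<bar>) = L * (1 + \<bar>x\<bar>)" if "0 < y" "\<epsilon> * (R + y) < \<bar>x\<bar>" for x y
  proof (rule phi_eq_first[OF B _ e(2) _ _ L(1,3)])
    have "\<epsilon> * R \<le> \<epsilon> * (R + y)" using that e by simp
    then show "1 \<le> \<epsilon> * (R + y)" using R by linarith
  qed (use q that in auto)
  \<comment> \<open>This is where the martingale may fall below R/2; by the choice of \<epsilon>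
    such an x also exceeds \<epsilon> (R + y).\<close>
  have far: "phi L B q x (R + y + \<bar>x\<bar>) = L * (1 + \<bar>x\<bar>)"
    if "0 < y" "R / 2 + y \<le> \<bar>\<rho>\<bar> * \<bar>x\<bar>" for x y
  proof (rule large)
    have "R + y \<le> 2 * (\<bar>\<rho>\<bar> * \<bar>x\<bar>)" using that by linarith
    then have "\<epsilon> * (R + y) \<le> \<epsilon> * (2 * (\<bar>\<rho>\<bar> * \<bar>x\<bar>))" using e by (intro mult_left_mono) auto
    also have "\<dots> = 2 * (\<bar>\<rho>\<bar> * \<epsilon>) * \<bar>x\<bar>" by simp
    also have "\<dots> < 1 * \<bar>x\<bar>"
    proof (rule mult_strict_right_mono)
      show "2 * (\<bar>\<rho>\<bar> * \<epsilon>) < 1" using e\<rho> e(2) by (simp add: distrib_right)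
      show "0 < \<bar>x\<bar>" using that R by (cases "x = 0") auto
    qed
    finally show "\<epsilon> * (R + y) < \<bar>x\<bar>" by simp
  qed fact

  have phi_int: "integrable M (\<lambda>\<omega>. phi L B q (a \<omega> * x + b \<omega>) N)" for x N
  proof (rule integrable_real_bound[where g = "\<lambda>\<omega>. L * (1 + \<bar>a \<omega> * x + b \<omega>\<bar>)"])
    show "(\<lambda>\<omega>. phi L B q (a \<omega> * x + b \<omega>) N) \<in> borel_measurable M"
      unfolding phi_def by measurable
    show "\<bar>phi L B q (a \<omega> * x + b \<omega>) N\<bar> \<le> L * (1 + \<bar>a \<omega> * x + b \<omega>\<bar>)" for \<omega>
      using phi_nonneg[OF B, of L q "a \<omega> * x + b \<omega>" N] L by (simp add: phi_def)
  qed auto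
  \<comment> \<open>The mean of a minimum is at most the mean of either term. It is enough to bound
    the term that attains the minimum before the step.\<close>
  have first: "(\<integral>\<omega>. phi L B q (a \<omega> * x + b \<omega>) N \<partial>M) \<le> L * (1 + \<kappa> * \<bar>x\<bar> + C1)" for x N
  proof -
    have "(\<integral>\<omega>. phi L B q (a \<omega> * x + b \<omega>) N \<partial>M) \<le> (\<integral>\<omega>. L * (1 + (\<bar>a \<omega>\<bar> * \<bar>x\<bar> + \<bar>b \<omega>\<bar>)) \<partial>M)"
    proof (intro integral_mono phi_int)
      fix \<omega>
      have "L * (1 + \<bar>a \<omega> * x + b \<omega>\<bar>) \<le> L * (1 + (\<bar>a \<omega>\<bar> * \<bar>x\<bar> + \<bar>b \<omega>\<bar>))"
        using L abs_triangle_ineq[of "a \<omega> * x" "b \<omega>"] by (intro mult_left_mono) (auto simp: abs_mult)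
      then show "phi L B q (a \<omega> * x + b \<omega>) N \<le> L * (1 + (\<bar>a \<omega>\<bar> * \<bar>x\<bar> + \<bar>b \<omega>\<bar>))"
        by (simp add: phi_def)
    qed auto
    also have "\<dots> = L * (1 + k1 * \<bar>x\<bar> + C1)"
      by (simp add: prob_space k1_def C1_def)
    also have "\<dots> \<le> L * (1 + \<kappa> * \<bar>x\<bar> + C1)"
      using L \<kappa> by (auto intro!: mult_left_mono mult_right_mono)
    finally show ?thesis .
  qed
  have second: "(\<integral>\<omega>. phi L B q (a \<omega> * x + b \<omega>) N \<partial>M) \<le> N powr (1 - q) * (\<kappa> * lyap B q x + C * step_var x)" for x N
  proof -
    have "(\<integral>\<omega>. phi L B q (a \<omega> * x + b \<omega>) N \<partial>M) \<le> (\<integral>\<omega>. N powr (1 - q) * lyap B q (a \<omega> * x + b \<omega>) \<partial>M)"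
      using lyap_int[of x]
      by (intro integral_mono phi_int) (auto simp: phi_def mult.commute[of "N powr (1 - q)"])
    also have "\<dots> = N powr (1 - q) * (\<integral>\<omega>. lyap B q (a \<omega> * x + b \<omega>) \<partial>M)"
      by simp
    also have "\<dots> \<le> N powr (1 - q) * (k * lyap B q x + C * step_var x)"
      by (intro mult_left_mono lyap_drift) auto
    also have "\<dots> \<le> N powr (1 - q) * (\<kappa> * lyap B q x + C * step_var x)"
      using \<kappa> lyap_ge_1[OF B, of q x] by (intro mult_left_mono add_right_mono mult_right_mono) auto
    finally show ?thesis .
  qed

  have main: "(\<integral>\<omega>. A * theta q (R / 2) (R + y + \<rho> * x + \<xi> x \<omega>) + phi L B q (a \<omega> * x + b \<omega>) (R + y) \<partial>M)
      \<le> A * theta q (R / 2) (R + y + \<rho> * x) + (1 - c) * phi L B q x (R + y + \<bar>x\<bar>)"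
    if y: "0 < y" for x y
  proof -
    define N where "N = R + y"
    define t where "t = N + \<rho> * x"
    have N: "R \<le> N" "0 < N" using R y by (auto simp: N_def)
    have p0: "0 \<le> phi L B q x (N + \<bar>x\<bar>)" using phi_nonneg[OF B] L by simp
    have split: "(\<integral>\<omega>. A * theta q (R / 2) (t + \<xi> x \<omega>) + phi L B q (a \<omega> * x + b \<omega>) N \<partial>M)
        = A * (\<integral>\<omega>. theta q (R / 2) (t + \<xi> x \<omega>) \<partial>M) + (\<integral>\<omega>. phi L B q (a \<omega> * x + b \<omega>) N \<partial>M)"
      using phi_int q R integrable_theta_\<xi>[of q "R / 2"] by simp
    have "(\<integral>\<omega>. A * theta q (R / 2) (t + \<xi> x \<omega>) + phi L B q (a \<omega> * x + b \<omega>) N \<partial>M)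
        \<le> A * theta q (R / 2) t + (1 - c) * phi L B q x (N + \<bar>x\<bar>)"
    proof (cases "L * (1 + \<bar>x\<bar>) \<le> lyap B q x * (N + \<bar>x\<bar>) powr (1 - q)")
      case True
      then have phi: "phi L B q x (N + \<bar>x\<bar>) = L * (1 + \<bar>x\<bar>)" by (simp add: phi_def)
      have "W \<le> 1 + \<bar>x\<bar>"
        using phi_first_imp_large[OF B q(1) R(1) N(1) L(1) R1 True] .
      then have "(\<kappa>' - \<kappa>) * W \<le> (\<kappa>' - \<kappa>) * (1 + \<bar>x\<bar>)"
        using \<kappa> by (intro mult_left_mono) auto
      then have "1 + \<kappa> * \<bar>x\<bar> + C1 \<le> \<kappa>' * (1 + \<bar>x\<bar>)"
        using W(2) \<kappa> by (simp add: algebra_simps)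
      then have "L * (1 + \<kappa> * \<bar>x\<bar> + C1) \<le> \<kappa>' * (L * (1 + \<bar>x\<bar>))"
        using mult_left_mono[of _ _ L] L by (simp add: mult.left_commute)
      with first[of x N] have "(\<integral>\<omega>. phi L B q (a \<omega> * x + b \<omega>) N \<partial>M) \<le> \<kappa>' * phi L B q x (N + \<bar>x\<bar>)"
        unfolding phi by linarith
      also have "\<dots> \<le> (1 - c) * phi L B q x (N + \<bar>x\<bar>)"
        using c p0 by (intro mult_right_mono) auto
      finally show ?thesis
        \<comment> \<open>The linear term contracts by itself, so \<open>theta\<close> need only not
          increase in mean.\<close>
        unfolding split using mean_theta_le[of q "R / 2" t x] q R A by (intro add_mono mult_left_mono) auto
    next
      case False
      then have phi: "phi L B q x (N + \<bar>x\<bar>) = lyap B q x * (N + \<bar>x\<bar>) powr (1 - q)" by (simp add: phi_def)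
      \<comment> \<open>Contraposition of \<open>large\<close>: the second term is strictly smaller,
        so x lies in the region where heights are nearly unaffected by |x|.\<close>
      have x: "\<bar>x\<bar> \<le> \<epsilon> * N"
        using large[OF y, of x] False unfolding N_def[symmetric] phi by force
      have "\<bar>\<rho> * x\<bar> \<le> (1 + \<bar>\<rho>\<bar>) * \<bar>x\<bar>" by (simp add: abs_mult algebra_simps)
      also have "\<dots> \<le> (1 + \<bar>\<rho>\<bar>) * (\<epsilon> * N)" using x by (intro mult_left_mono) auto
      also have "\<dots> = ((1 + \<bar>\<rho>\<bar>) * \<epsilon>) * N" by simp
      also have "\<dots> \<le> 1 / 4 * N" using e\<rho> N by (intro mult_right_mono) auto
      finally have "\<bar>\<rho> * x\<bar> \<le> N / 4" by simp
      then have t: "3 * N / 4 \<le> t" "t \<le> 5 * N / 4" by (auto simp: t_def abs_le_iff)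
      define v where "v = step_var x"
      have v: "0 \<le> v" by (simp add: v_def step_var_nonneg)
      define g where "g = lyap B q x"
      have g: "1 + \<bar>x\<bar> powr q \<le> g" "0 \<le> g" using lyap_ge[OF B, of x q] lyap_ge_1[OF B, of q x] by (auto simp: g_def)
      define n where "n = N powr (1 - q)"
      have n: "0 \<le> n" by (simp add: n_def)
      define p where "p = phi L B q x (N + \<bar>x\<bar>)"
      have ng: "n * g \<le> (1 + \<epsilon>) powr (q - 1) * p"
      proof -
        have "((1 + \<epsilon>) * N) powr (1 - q) \<le> (N + \<bar>x\<bar>) powr (1 - q)"
          using x N q by (intro powr_mono2') (auto simp: algebra_simps)
        then have "(1 + \<epsilon>) powr (1 - q) * n \<le> (N + \<bar>x\<bar>) powr (1 - q)"
          by (simp add: powr_mult n_def)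
        then have "(1 + \<epsilon>) powr (q - 1) * ((1 + \<epsilon>) powr (1 - q) * n) \<le> (1 + \<epsilon>) powr (q - 1) * (N + \<bar>x\<bar>) powr (1 - q)"
          by (intro mult_left_mono) auto
        then have "n \<le> (1 + \<epsilon>) powr (q - 1) * (N + \<bar>x\<bar>) powr (1 - q)"
          using e(2) by (simp add: mult.assoc[symmetric] powr_add[symmetric])
        then have "n * g \<le> (1 + \<epsilon>) powr (q - 1) * (N + \<bar>x\<bar>) powr (1 - q) * g"
          using g by (intro mult_right_mono) auto
        then show ?thesis by (simp add: p_def phi g_def mult_ac)
      qed
      have "\<kappa> * (n * g) \<le> \<kappa> * ((1 + \<epsilon>) powr (q - 1) * p)" using ng \<kappa> by (intro mult_left_mono) auto
      also have "\<dots> = ((1 + \<epsilon>) powr (q - 1) * \<kappa>) * p" by simp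
      also have "\<dots> \<le> \<kappa>' * p" using e(1) p0 by (intro mult_right_mono) (auto simp: p_def)
      finally have 1: "\<kappa> * (n * g) \<le> \<kappa>' * p" .
      have "(1 + \<epsilon>) powr (q - 1) \<le> 2 powr 2"
        using e q by (intro order_trans[OF powr_mono2[of "q - 1" "1 + \<epsilon>" 2] powr_mono]) auto
      then have "(1 + \<epsilon>) powr (q - 1) * p \<le> 4 * p" using p0 by (intro mult_right_mono) (auto simp: p_def)
      with ng have 2: "n * g \<le> 4 * p" by linarith
      have 3: "A * (D * (N / 4) powr (2 - q) * (1 + \<bar>x\<bar> powr q)) * n \<le> c * p"
      proof -
        have "A * (D * (N / 4) powr (2 - q) * (1 + \<bar>x\<bar> powr q)) * n
            = A * (D * (N / 4) powr (2 - q)) * (n * (1 + \<bar>x\<bar> powr q))" by simp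
        also have "\<dots> \<le> (1 - \<kappa>') / 8 * (n * g)"
          using R3[OF N(1)] g n \<kappa> by (intro mult_mono) auto
        also have "\<dots> \<le> (1 - \<kappa>') / 8 * (4 * p)"
          using 2 \<kappa> by (intro mult_left_mono) auto
        finally show ?thesis by (simp add: c_def mult.commute[of p])
      qed
      have th: "(\<integral>\<omega>. theta q (R / 2) (t + \<xi> x \<omega>) \<partial>M)
          \<le> theta q (R / 2) t - n * (d * v - D * (N / 4) powr (2 - q) * (1 + \<bar>x\<bar> powr q))"
        unfolding n_def v_def using R N t by (intro gain) auto
      have "A * (\<integral>\<omega>. theta q (R / 2) (t + \<xi> x \<omega>) \<partial>M)
          \<le> A * (theta q (R / 2) t - n * (d * v - D * (N / 4) powr (2 - q) * (1 + \<bar>x\<bar> powr q)))"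
        using A th by (intro mult_left_mono) auto
      also have "\<dots> = A * theta q (R / 2) t - (A * d) * (n * v)
          + A * (D * (N / 4) powr (2 - q) * (1 + \<bar>x\<bar> powr q)) * n"
        by (simp add: algebra_simps)
      finally have 4: "A * (\<integral>\<omega>. theta q (R / 2) (t + \<xi> x \<omega>) \<partial>M) \<le> A * theta q (R / 2) t - (A * d) * (n * v) + c * p"
        using 3 by linarith
      \<comment> \<open>The variance growth of \<open>phi\<close> cancels against the gain of
        \<open>theta\<close>; the Taylor error c p raises the contraction factor from \<kappa>' to
        \<kappa>' + c = 1 - c.\<close>
      have "C * (n * v) \<le> (A * d) * (n * v)" using A n v by (intro mult_right_mono) auto
      moreover have "(\<integral>\<omega>. phi L B q (a \<omega> * x + b \<omega>) N \<partial>M) \<le> \<kappa> * (n * g) + C * (n * v)"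
        using second[of x N] by (simp add: n_def g_def v_def algebra_simps)
      moreover have "(\<kappa>' + c) * p = \<kappa>' * p + c * p" by (simp add: distrib_right)
      ultimately show ?thesis
        unfolding split p_def[symmetric] c(2)[symmetric] using 1 4 by linarith
    qed
    then show ?thesis by (simp add: t_def N_def)
  qed
  show ?thesis
    by (rule exI[of _ A], rule exI[of _ B], rule exI[of _ L], rule exI[of _ R], rule exI[of _ c],
        intro conjI allI impI)
      (fact A(1) B L(1,2) R(1) c(1) R2 | erule (1) far | erule main)+
qed

end

subsection \<open>The killed kernel on functions of linear growth\<close>

lemma borel_measurable_fst_snd [measurable]:
  "fst \<in> borel_measurable (borel :: (real \<times> real) measure)"
  "snd \<in> borel_measurable (borel :: (real \<times> real) measure)"
  unfolding borel_prod[symmetric] by measurable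

text \<open>A class on which all integrals below exist. It contains x and y and is preserved by
  sums, killing, restriction to exits and the kernel, because a and b are integrable.\<close>

definition lin_growth :: "(real \<Rightarrow> real \<Rightarrow> real) \<Rightarrow> bool" where
  "lin_growth F \<longleftrightarrow> (\<lambda>p. F (fst p) (snd p)) \<in> borel_measurable (borel :: (real \<times> real) measure) \<and>
     (\<exists>C\<ge>0. \<forall>x y. \<bar>F x y\<bar> \<le> C * (1 + \<bar>x\<bar> + \<bar>y\<bar>))"

lemma lin_growthI:
  assumes "(\<lambda>p. F (fst p) (snd p)) \<in> borel_measurable (borel :: (real \<times> real) measure)"
    and "\<And>x y. \<bar>F x y\<bar> \<le> C * (1 + \<bar>x\<bar> + \<bar>y\<bar>)"
  shows "lin_growth F"
proof -
  have "0 \<le> \<bar>F 0 0\<bar>" by simp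
  also have "\<dots> \<le> C" using assms(2)[of 0 0] by simp
  finally show ?thesis using assms unfolding lin_growth_def by blast
qed

lemma lin_growth_measurable:
  assumes F: "lin_growth F" and [measurable]: "f \<in> borel_measurable N" "g \<in> borel_measurable N"
  shows "(\<lambda>z. F (f z) (g z)) \<in> borel_measurable N"
proof -
  have "(\<lambda>p. F (fst p) (snd p)) \<in> borel_measurable (borel :: (real \<times> real) measure)"
    using F by (simp add: lin_growth_def)
  from measurable_compose[OF borel_measurable_Pair[OF assms(2,3)] this] show ?thesis by simp
qed

lemma lin_growth_add: "lin_growth F \<Longrightarrow> lin_growth G \<Longrightarrow> lin_growth (\<lambda>x y. F x y + G x y)"
proof -
  assume F: "lin_growth F" and G: "lin_growth G"
  then obtain C D where "\<And>x y. \<bar>F x y\<bar> \<le> C * (1 + \<bar>x\<bar> + \<bar>y\<bar>)" "\<And>x y. \<bar>G x y\<bar> \<le> D * (1 + \<bar>x\<bar> + \<bar>y\<bar>)"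
    unfolding lin_growth_def by blast
  then have "\<bar>F x y + G x y\<bar> \<le> (C + D) * (1 + \<bar>x\<bar> + \<bar>y\<bar>)" for x y
    unfolding distrib_right[of C D] by (meson abs_triangle_ineq add_mono order_trans)
  then show ?thesis
    using F G by (intro lin_growthI[where C = "C + D"]) (auto simp: lin_growth_def)
qed

lemma lin_growth_dominated:
  assumes G: "lin_growth G" and F: "(\<lambda>p. F (fst p) (snd p)) \<in> borel_measurable (borel :: (real \<times> real) measure)"
    and le: "\<And>x y. \<bar>F x y\<bar> \<le> D * \<bar>G x y\<bar>" and D: "0 \<le> D"
  shows "lin_growth F"
proof -
  obtain C where C: "\<And>x y. \<bar>G x y\<bar> \<le> C * (1 + \<bar>x\<bar> + \<bar>y\<bar>)"
    using G unfolding lin_growth_def by blast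
  show ?thesis
  proof (rule lin_growthI[OF F])
    show "\<bar>F x y\<bar> \<le> (D * C) * (1 + \<bar>x\<bar> + \<bar>y\<bar>)" for x y
      using order_trans[OF le mult_left_mono[OF C D]] by (simp add: mult.assoc)
  qed
qed

lemma lin_growth_mult: "lin_growth F \<Longrightarrow> lin_growth (\<lambda>x y. c * F x y)"
  by (rule lin_growth_dominated[where G = F and D = "\<bar>c\<bar>"]) (auto simp: lin_growth_def abs_mult)

lemma lin_growth_diff: "lin_growth F \<Longrightarrow> lin_growth G \<Longrightarrow> lin_growth (\<lambda>x y. F x y - G x y)"
  using lin_growth_add[of F "\<lambda>x y. (-1) * G x y"] lin_growth_mult[of G "-1"] by simp

lemma lin_growth_killed: "lin_growth F \<Longrightarrow> lin_growth (killed F)"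
  unfolding killed_def
  by (rule lin_growth_dominated[where G = F and D = 1]) (auto simp: lin_growth_def split: split_indicator)

lemma lin_growth_exited: "lin_growth F \<Longrightarrow> lin_growth (exited F)"
  unfolding exited_def
  by (rule lin_growth_dominated[where G = F and D = 1]) (auto simp: lin_growth_def split: split_indicator)

lemma lin_growth_const [simp]: "lin_growth (\<lambda>x y. c)"
  by (rule lin_growthI[where C = "\<bar>c\<bar>"]) (auto simp: mult_le_cancel_left1)

lemma lin_growth_affine [simp]: "lin_growth (\<lambda>x y. r * x + s * y)"
proof (rule lin_growthI)
  fix x y :: real
  have "\<bar>r * x + s * y\<bar> \<le> \<bar>r\<bar> * \<bar>x\<bar> + \<bar>s\<bar> * \<bar>y\<bar>"
    using abs_triangle_ineq[of "r * x" "s * y"] by (simp add: abs_mult)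
  also have "\<dots> \<le> (\<bar>r\<bar> + \<bar>s\<bar>) * (1 + \<bar>x\<bar> + \<bar>y\<bar>)" by (simp add: algebra_simps)
  finally show "\<bar>r * x + s * y\<bar> \<le> (\<bar>r\<bar> + \<bar>s\<bar>) * (1 + \<bar>x\<bar> + \<bar>y\<bar>)" .
qed measurable

lemma lin_growth_fst [simp]: "lin_growth (\<lambda>x y. x)"
  using lin_growth_affine[of 1 0] by simp

lemma lin_growth_snd [simp]: "lin_growth (\<lambda>x y. y)"
  using lin_growth_affine[of 0 1] by simp

lemma lin_growth_abs: "lin_growth F \<Longrightarrow> lin_growth (\<lambda>x y. \<bar>F x y\<bar>)"
  by (rule lin_growth_dominated[where G = F and D = 1]) (auto simp: lin_growth_def)

lemmas lin_growth_intros = lin_growth_add lin_growth_mult lin_growth_diff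
  lin_growth_killed lin_growth_exited lin_growth_abs lin_growth_const lin_growth_affine
  lin_growth_fst lin_growth_snd

context affine_step
begin

lemma integrable_trans [intro]:
  assumes G: "lin_growth G"
  shows "integrable M (\<lambda>\<omega>. G (a \<omega> * x + b \<omega>) (y + (a \<omega> * x + b \<omega>)))"
proof -
  obtain C where C: "\<And>x y. \<bar>G x y\<bar> \<le> C * (1 + \<bar>x\<bar> + \<bar>y\<bar>)"
    using G unfolding lin_growth_def by blast
  show ?thesis
    by (rule integrable_real_bound[OF _ _ C]) (auto intro: lin_growth_measurable[OF G])
qed

lemma lin_growth_trans:
  assumes G: "lin_growth G"
  shows "lin_growth (trans_op G)"
proof -
  obtain C where C: "0 \<le> C" "\<And>x y. \<bar>G x y\<bar> \<le> C * (1 + \<bar>x\<bar> + \<bar>y\<bar>)"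
    using G unfolding lin_growth_def by blast
  define C1 where "C1 = (\<integral>\<omega>. \<bar>b \<omega>\<bar> \<partial>M)"
  have C1: "0 \<le> C1" by (simp add: C1_def)
  show ?thesis
  proof (rule lin_growthI)
    show "(\<lambda>p. trans_op G (fst p) (snd p)) \<in> borel_measurable borel"
      unfolding trans_op_def
      by (rule borel_measurable_lebesgue_integral, unfold split_beta, rule lin_growth_measurable[OF G]) measurable
    fix x y
    have "\<bar>trans_op G x y\<bar> \<le> (\<integral>\<omega>. \<bar>G (a \<omega> * x + b \<omega>) (y + (a \<omega> * x + b \<omega>))\<bar> \<partial>M)"
      unfolding trans_op_def by (rule integral_abs_bound)
    also have "\<dots> \<le> (\<integral>\<omega>. C * (1 + 2 * (\<bar>a \<omega>\<bar> * \<bar>x\<bar> + \<bar>b \<omega>\<bar>) + \<bar>y\<bar>) \<partial>M)"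
    proof (rule integral_mono)
      fix \<omega>
      note C(2)[of "a \<omega> * x + b \<omega>" "y + (a \<omega> * x + b \<omega>)"]
      also have "C * (1 + \<bar>a \<omega> * x + b \<omega>\<bar> + \<bar>y + (a \<omega> * x + b \<omega>)\<bar>) \<le> C * (1 + 2 * (\<bar>a \<omega>\<bar> * \<bar>x\<bar> + \<bar>b \<omega>\<bar>) + \<bar>y\<bar>)"
        using abs_triangle_ineq[of "a \<omega> * x" "b \<omega>"] abs_triangle_ineq[of y "a \<omega> * x + b \<omega>"]
        by (intro mult_left_mono C(1)) (simp add: abs_mult)
      finally show "\<bar>G (a \<omega> * x + b \<omega>) (y + (a \<omega> * x + b \<omega>))\<bar> \<le> C * (1 + 2 * (\<bar>a \<omega>\<bar> * \<bar>x\<bar> + \<bar>b \<omega>\<bar>) + \<bar>y\<bar>)" .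
    qed (use integrable_trans[OF G] in auto)
    also have "\<dots> = C * (1 + 2 * ((\<integral>\<omega>. \<bar>a \<omega>\<bar> \<partial>M) * \<bar>x\<bar> + C1) + \<bar>y\<bar>)"
      by (simp add: prob_space C1_def)
    also have "\<dots> \<le> C * ((2 + 2 * C1) * (1 + \<bar>x\<bar> + \<bar>y\<bar>))"
    proof (intro mult_left_mono C(1))
      have "(\<integral>\<omega>. \<bar>a \<omega>\<bar> \<partial>M) * \<bar>x\<bar> \<le> 1 * \<bar>x\<bar>"
        using abs_a_mean_less_1 by (intro mult_right_mono) auto
      moreover have "0 \<le> C1 * \<bar>x\<bar>" "0 \<le> C1 * \<bar>y\<bar>" using C1 by auto
      ultimately show "1 + 2 * ((\<integral>\<omega>. \<bar>a \<omega>\<bar> \<partial>M) * \<bar>x\<bar> + C1) + \<bar>y\<bar> \<le> (2 + 2 * C1) * (1 + \<bar>x\<bar> + \<bar>y\<bar>)"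
        by (simp add: algebra_simps)
    qed
    finally show "\<bar>trans_op G x y\<bar> \<le> (C * (2 + 2 * C1)) * (1 + \<bar>x\<bar> + \<bar>y\<bar>)" by (simp add: mult.assoc)
  qed
qed

lemma trans_add:
  "lin_growth F \<Longrightarrow> lin_growth G \<Longrightarrow> trans_op (\<lambda>x y. F x y + G x y) x y = trans_op F x y + trans_op G x y"
  unfolding trans_op_def by (intro Bochner_Integration.integral_add integrable_trans)

lemma trans_mult: "trans_op (\<lambda>x y. c * F x y) x y = c * trans_op F x y"
  unfolding trans_op_def by simp

lemma trans_mono:
  assumes "lin_growth F" "lin_growth G"
    and "\<And>\<omega>. F (a \<omega> * x + b \<omega>) (y + (a \<omega> * x + b \<omega>)) \<le> G (a \<omega> * x + b \<omega>) (y + (a \<omega> * x + b \<omega>))"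
  shows "trans_op F x y \<le> trans_op G x y"
  unfolding trans_op_def using assms by (intro integral_mono integrable_trans) auto

definition Q :: "(real \<Rightarrow> real \<Rightarrow> real) \<Rightarrow> real \<Rightarrow> real \<Rightarrow> real" where
  "Q F = trans_op (killed F)"

lemma lin_growth_Q: "lin_growth F \<Longrightarrow> lin_growth (Q F)"
  unfolding Q_def by (intro lin_growth_trans lin_growth_killed)

lemma lin_growth_Qn: "lin_growth F \<Longrightarrow> lin_growth ((Q ^^ n) F)"
  by (induction n) (auto intro: lin_growth_Q)

lemma Q_add:
  "lin_growth F \<Longrightarrow> lin_growth G \<Longrightarrow> Q (\<lambda>x y. F x y + G x y) x y = Q F x y + Q G x y"
  unfolding Q_def using trans_add[of "killed F" "killed G"]
  by (simp add: killed_def[abs_def] distrib_right lin_growth_killed[unfolded killed_def[abs_def]])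

lemma Q_mult: "Q (\<lambda>x y. c * F x y) x y = c * Q F x y"
  unfolding Q_def killed_def[abs_def] mult.assoc by (rule trans_mult)

lemma Q_mono:
  assumes "lin_growth F" "lin_growth G" "\<And>x y. 0 < y \<Longrightarrow> F x y \<le> G x y"
  shows "Q F x y \<le> Q G x y"
  unfolding Q_def
proof (rule trans_mono)
  fix \<omega>
  show "killed F (a \<omega> * x + b \<omega>) (y + (a \<omega> * x + b \<omega>)) \<le> killed G (a \<omega> * x + b \<omega>) (y + (a \<omega> * x + b \<omega>))"
    using assms(3) by (auto simp: killed_def split: split_indicator)
qed (intro lin_growth_killed assms)+

lemma Q_cong:
  assumes "\<And>x y. 0 < y \<Longrightarrow> F x y = G x y"
  shows "Q F = Q G"
proof -
  have "killed F = killed G" using assms by (auto simp: killed_def fun_eq_iff split: split_indicator)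
  then show ?thesis by (simp add: Q_def)
qed

lemma Qn_mono:
  assumes "lin_growth F" "lin_growth G" "\<And>x y. 0 < y \<Longrightarrow> F x y \<le> G x y" "0 < y"
  shows "(Q ^^ n) F x y \<le> (Q ^^ n) G x y"
  using assms(4)
proof (induction n arbitrary: x y)
  case (Suc n)
  then show ?case using assms(1,2) by (simp add: Q_mono lin_growth_Qn)
qed (use assms in auto)

lemma Qn_cong:
  assumes "\<And>x y. 0 < y \<Longrightarrow> F x y = G x y" "0 < y"
  shows "(Q ^^ n) F x y = (Q ^^ n) G x y"
proof (cases n)
  case (Suc k)
  then show ?thesis using Q_cong[of F G] assms(1) by (simp add: funpow_swap1)
qed (use assms in auto)

lemma Qn_add:
  assumes "lin_growth F" "lin_growth G"
  shows "(Q ^^ n) (\<lambda>x y. F x y + G x y) x y = (Q ^^ n) F x y + (Q ^^ n) G x y"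
proof (induction n arbitrary: x y)
  case (Suc n)
  then have "(Q ^^ n) (\<lambda>x y. F x y + G x y) = (\<lambda>x y. (Q ^^ n) F x y + (Q ^^ n) G x y)"
    by (intro ext)
  then show ?case using assms by (simp add: Q_add lin_growth_Qn)
qed simp

lemma Qn_mult: "(Q ^^ n) (\<lambda>x y. c * F x y) x y = c * (Q ^^ n) F x y"
proof (induction n arbitrary: x y)
  case (Suc n)
  then have "(Q ^^ n) (\<lambda>x y. c * F x y) = (\<lambda>x y. c * (Q ^^ n) F x y)"
    by (intro ext)
  then show ?case by (simp add: Q_mult)
qed simp

lemma Qn_diff:
  assumes "lin_growth F" "lin_growth G"
  shows "(Q ^^ n) (\<lambda>x y. F x y - G x y) x y = (Q ^^ n) F x y - (Q ^^ n) G x y"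
  using Qn_add[OF assms(1) lin_growth_mult[OF assms(2)], of n "-1"] by (simp add: Qn_mult[of n "-1", simplified])

lemma Qn_nonneg:
  assumes "lin_growth F" "\<And>x y. 0 < y \<Longrightarrow> 0 \<le> F x y" "0 < y"
  shows "0 \<le> (Q ^^ n) F x y"
proof -
  have "(Q ^^ n) (\<lambda>x y. 0 * F x y) x y \<le> (Q ^^ n) F x y"
    using assms by (intro Qn_mono lin_growth_mult) auto
  then show ?thesis unfolding Qn_mult by simp
qed

text \<open>Iterating the drift gives the partial sum plus \<open>(Q ^^ n) U\<close> on the left,
  and the latter is nonnegative.\<close>

lemma potential_bound:
  assumes U: "lin_growth U" and f: "lin_growth f" and U0: "\<And>x y. 0 < y \<Longrightarrow> 0 \<le> U x y"
    and drift: "\<And>x y. 0 < y \<Longrightarrow> Q U x y + f x y \<le> U x y" and y: "0 < y"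
  shows "(\<Sum>k<n. (Q ^^ k) f x y) \<le> U x y"
proof -
  have "(\<Sum>k<n. (Q ^^ k) f x y) + (Q ^^ n) U x y \<le> U x y"
  proof (induction n)
    case (Suc n)
    have "(Q ^^ n) f x y + (Q ^^ Suc n) U x y = (Q ^^ n) (\<lambda>x y. f x y + Q U x y) x y"
      unfolding Qn_add[OF f lin_growth_Q[OF U]] by (simp add: funpow_swap1)
    also have "\<dots> \<le> (Q ^^ n) U x y"
      using drift y by (intro Qn_mono lin_growth_intros lin_growth_Q f U) (auto simp: add.commute)
    finally show ?case using Suc by simp
  qed simp
  with Qn_nonneg[OF U U0 y, of n x] show ?thesis by simp
qed

end

text \<open>Once z is below (1 - \<kappa>) r/2, the level r/2 is preserved by the recursion and the
  excess over it decays geometrically.\<close>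

lemma contraction_tendsto_zero:
  fixes u z :: "nat \<Rightarrow> real"
  assumes u: "\<And>n. 0 \<le> u n" and \<kappa>: "0 \<le> \<kappa>" "\<kappa> < 1"
    and step: "\<And>n. u (Suc n) \<le> \<kappa> * u n + z n" and z: "z \<longlonglongrightarrow> 0"
  shows "u \<longlonglongrightarrow> 0"
proof (rule LIMSEQ_I)
  fix r :: real assume r: "0 < r"
  have "eventually (\<lambda>n. z n < (1 - \<kappa>) * (r / 2)) sequentially"
    using z r \<kappa> by (intro order_tendstoD(2)) auto
  then obtain N where N: "\<And>n. N \<le> n \<Longrightarrow> z n \<le> (1 - \<kappa>) * (r / 2)"
    unfolding eventually_sequentially by (meson less_imp_le)
  have bound: "u (N + j) \<le> \<kappa> ^ j * u N + r / 2" for j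
  proof (induction j)
    case (Suc j)
    have "u (N + Suc j) \<le> \<kappa> * u (N + j) + z (N + j)" using step[of "N + j"] by simp
    also have "\<dots> \<le> \<kappa> * (\<kappa> ^ j * u N + r / 2) + (1 - \<kappa>) * (r / 2)"
      using Suc N[of "N + j"] \<kappa> by (intro add_mono mult_left_mono) auto
    also have "\<dots> = \<kappa> ^ Suc j * u N + r / 2" by (simp add: field_simps)
    finally show ?case .
  qed (use r in simp)
  have "(\<lambda>j. \<kappa> ^ j * u N) \<longlonglongrightarrow> 0 * u N"
    using \<kappa> by (intro tendsto_mult tendsto_const LIMSEQ_power_zero) auto
  then have "eventually (\<lambda>j. \<kappa> ^ j * u N < r / 2) sequentially"
    using r by (intro order_tendstoD(2)) auto
  then obtain J where J: "\<And>j. J \<le> j \<Longrightarrow> \<kappa> ^ j * u N < r / 2"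
    unfolding eventually_sequentially by blast
  have "norm (u n - 0) < r" if "N + J \<le> n" for n
  proof -
    have "J \<le> n - N" "N + (n - N) = n" using that by auto
    then show ?thesis using bound[of "n - N"] J[of "n - N"] u[of n] by simp
  qed
  then show "\<exists>no. \<forall>n\<ge>no. norm (u n - 0) < r" by blast
qed

section \<open>A superharmonic function for the killed chain\<close>

context affine_step
begin

text \<open>The mean of |X_1| on exit at the first step; summing its iterates under \<open>Q\<close>
  yields the mean of |X_\<tau>|.\<close>

abbreviation exit_abs :: "real \<Rightarrow> real \<Rightarrow> real" where
  "exit_abs \<equiv> trans_op (exited (\<lambda>x y. \<bar>x\<bar>))"

text \<open>One integrand H dominates both outcomes of a step: the new value of U on survival and
  |X| on exit. The strict contraction leaves \<phi> over; being bounded below on bounded sets, it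
  later drives the survival probability to 0.\<close>

lemma drift_function:
  obtains U \<phi> where "lin_growth U" "lin_growth \<phi>"
    "\<And>x y. 0 < y \<Longrightarrow> 0 \<le> U x y" "\<And>x y. 0 < y \<Longrightarrow> 0 \<le> \<phi> x y"
    "\<And>T. \<exists>c>0. \<forall>x y. 0 < y \<longrightarrow> \<bar>x\<bar> + y \<le> T \<longrightarrow> c \<le> \<phi> x y"
    "\<And>\<delta>. 0 < \<delta> \<Longrightarrow> \<exists>C\<ge>0. \<forall>x y. 0 < y \<longrightarrow> U x y \<le> \<delta> * y + C * (1 + \<bar>x\<bar>)"
    "\<And>x y. 0 < y \<Longrightarrow> Q U x y + exit_abs x y \<le> U x y - \<phi> x y"
proof -
  define q where "q = (2 + min \<alpha> 3) / 2"
  have q: "2 < q" "q < 3" "q \<le> \<alpha>" using alpha by (auto simp: q_def min_def field_simps)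
  obtain A B L R c where dr: "0 < A" "0 \<le> B" "0 < L" "0 < R" "0 < c" "L \<le> 2 powr (1 - q)"
      "A * (R / 2) powr (2 - q) * (1 + \<bar>\<rho>\<bar>) \<le> L / 2"
      "\<forall>x y. 0 < y \<longrightarrow> R / 2 + y \<le> \<bar>\<rho>\<bar> * \<bar>x\<bar> \<longrightarrow> phi L B q x (R + y + \<bar>x\<bar>) = L * (1 + \<bar>x\<bar>)"
      "\<forall>x y. 0 < y \<longrightarrow>
        (\<integral>\<omega>. A * theta q (R / 2) (R + y + \<rho> * x + \<xi> x \<omega>) + phi L B q (a \<omega> * x + b \<omega>) (R + y) \<partial>M)
        \<le> A * theta q (R / 2) (R + y + \<rho> * x) + (1 - c) * phi L B q x (R + y + \<bar>x\<bar>)"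
    using drift_inequality[OF q] by (elim exE conjE) (rule that)
  note A = dr(1) and B = dr(2) and L = dr(3,6) and R = dr(4) and c = dr(5) and AR = dr(7)
    and far = dr(8)[rule_format] and main = dr(9)[rule_format]
  define U0 where "U0 x y = A * theta q (R / 2) (R + y + \<rho> * x) + phi L B q x (R + y + \<bar>x\<bar>)" for x y
  \<comment> \<open>The summand L R covers exits with |X| < R, where \<open>phi\<close> need not
    dominate |X|. The factor 2/L is needed because the negative part of \<open>theta\<close> may
    consume L/2 |X| out of L |X|.\<close>
  define U where "U = killed (\<lambda>x y. 2 / L * (U0 x y + L * R))"
  define \<phi> where "\<phi> = killed (\<lambda>x y. 2 / L * c * phi L B q x (R + y + \<bar>x\<bar>))"
  have R2: "0 < R / 2" using R by simp
  have low: "- (L / 2 * \<bar>x\<bar>) \<le> A * theta q (R / 2) t" if "R / 2 - (1 + \<bar>\<rho>\<bar>) * \<bar>x\<bar> \<le> t" for x t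
  proof -
    have "- ((R / 2) powr (2 - q) * ((1 + \<bar>\<rho>\<bar>) * \<bar>x\<bar>)) \<le> theta q (R / 2) t"
      using that q R by (intro theta_lower) auto
    then have "A * - ((R / 2) powr (2 - q) * ((1 + \<bar>\<rho>\<bar>) * \<bar>x\<bar>)) \<le> A * theta q (R / 2) t"
      using A by (intro mult_left_mono) auto
    moreover have "A * (R / 2) powr (2 - q) * (1 + \<bar>\<rho>\<bar>) * \<bar>x\<bar> \<le> L / 2 * \<bar>x\<bar>"
      using AR by (intro mult_right_mono) auto
    ultimately show ?thesis by (simp add: mult.assoc)
  qed
  have phi0: "0 \<le> phi L B q x N" for x N using phi_nonneg[OF B] L by simp
  have phi_le: "phi L B q x N \<le> L * (1 + \<bar>x\<bar>)" for x N by (simp add: phi_def)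

  have U0_nonneg: "0 \<le> U0 x y" if y: "0 < y" for x y
  proof (cases "R / 2 \<le> R + y + \<rho> * x")
    case True
    then show ?thesis using A phi0 by (simp add: U0_def theta_def)
  next
    case False
    \<comment> \<open>\<open>theta\<close> can be negative only where \<rho> x is very negative;
      there \<open>phi\<close> is its linear term, and \<open>low\<close> takes at most half of
      it.\<close>
    then have "R / 2 + y \<le> \<bar>\<rho>\<bar> * \<bar>x\<bar>" using y by (simp add: abs_mult[symmetric])
    then have "phi L B q x (R + y + \<bar>x\<bar>) = L * (1 + \<bar>x\<bar>)" using far y by blast
    moreover have "- (\<bar>\<rho>\<bar> * \<bar>x\<bar>) \<le> \<rho> * x" unfolding abs_mult[symmetric] by (simp add: abs_le_iff)
    then have "- (L / 2 * \<bar>x\<bar>) \<le> A * theta q (R / 2) (R + y + \<rho> * x)"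
      using y R by (intro low) (simp add: distrib_right)
    moreover have "0 \<le> L * \<bar>x\<bar>" using L by simp
    ultimately show ?thesis using L unfolding U0_def distrib_left by linarith
  qed
  have U_nonneg: "0 \<le> U x y" if "0 < y" for x y
    using U0_nonneg[OF that, of x] that L R by (auto simp: U_def killed_def intro!: add_nonneg_nonneg)
  have U_upper: "\<exists>C\<ge>0. \<forall>x y. 0 < y \<longrightarrow> U x y \<le> \<delta> * y + C * (1 + \<bar>x\<bar>)" if \<delta>: "0 < \<delta>" for \<delta>
  proof -
    \<comment> \<open>Undoes the factors A and 2/L, so that y ends with the coefficient
      \<delta>.\<close>
    define \<delta>' where "\<delta>' = L * \<delta> / (2 * A)"
    have \<delta>': "0 < \<delta>'" using \<delta> L A by (simp add: \<delta>'_def)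
    obtain D where D: "0 \<le> D" "\<And>t T. t \<le> T \<Longrightarrow> 0 \<le> T \<Longrightarrow> theta q (R / 2) t \<le> \<delta>' * T + D"
      using theta_sublinear[OF q(1,2) R2 \<delta>'] by blast
    define E where "E = A * (\<delta>' * (R + \<bar>\<rho>\<bar>) + D) + L + L * R"
    have E: "0 \<le> E" using A \<delta>' R D L by (simp add: E_def)
    have "U x y \<le> \<delta> * y + (2 / L * E) * (1 + \<bar>x\<bar>)" if y: "0 < y" for x y
    proof -
      have "\<rho> * x \<le> \<bar>\<rho>\<bar> * \<bar>x\<bar>" unfolding abs_mult[symmetric] by simp
      then have "theta q (R / 2) (R + y + \<rho> * x) \<le> \<delta>' * (R + y + \<bar>\<rho>\<bar> * \<bar>x\<bar>) + D"
        using y R by (intro D) auto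
      also have "\<dots> \<le> \<delta>' * y + (\<delta>' * (R + \<bar>\<rho>\<bar>) + D) * (1 + \<bar>x\<bar>)"
        using \<delta>' R D by (simp add: algebra_simps)
      finally have "A * theta q (R / 2) (R + y + \<rho> * x) \<le> A * (\<delta>' * y + (\<delta>' * (R + \<bar>\<rho>\<bar>) + D) * (1 + \<bar>x\<bar>))"
        using A by (intro mult_left_mono) auto
      moreover have "L * R \<le> L * R * (1 + \<bar>x\<bar>)" using L R by (simp add: distrib_left)
      ultimately have "U0 x y + L * R \<le> A * (\<delta>' * y + (\<delta>' * (R + \<bar>\<rho>\<bar>) + D) * (1 + \<bar>x\<bar>)) + L * (1 + \<bar>x\<bar>) + L * R * (1 + \<bar>x\<bar>)"
        unfolding U0_def using phi_le[of x "R + y + \<bar>x\<bar>"] by linarith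
      also have "\<dots> = A * \<delta>' * y + E * (1 + \<bar>x\<bar>)"
        by (simp add: E_def algebra_simps)
      finally have "2 / L * (U0 x y + L * R) \<le> 2 / L * (A * \<delta>' * y + E * (1 + \<bar>x\<bar>))"
        using L by (intro mult_left_mono) auto
      also have "\<dots> = \<delta> * y + (2 / L * E) * (1 + \<bar>x\<bar>)"
        using L A by (simp add: \<delta>'_def field_simps)
      finally show ?thesis using y by (simp add: U_def killed_def)
    qed
    moreover have "0 \<le> 2 / L * E" using E L by simp
    ultimately show ?thesis by blast
  qed

  have "lin_growth U"
  proof -
    obtain C where C: "0 \<le> C" "\<And>x y. 0 < y \<Longrightarrow> U x y \<le> 1 * y + C * (1 + \<bar>x\<bar>)"
      using U_upper[of 1] by auto
    show ?thesis
    proof (rule lin_growthI)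
      show "(\<lambda>p. U (fst p) (snd p)) \<in> borel_measurable borel"
        unfolding U_def killed_def U0_def phi_def by measurable
      fix x y
      show "\<bar>U x y\<bar> \<le> (1 + C) * (1 + \<bar>x\<bar> + \<bar>y\<bar>)"
      proof (cases "0 < y")
        case True
        then show ?thesis
          using U_nonneg[of y x] C(2)[of y x] C(1) mult_nonneg_nonneg[of C y]
          unfolding distrib_left distrib_right by linarith
      next
        case False
        then show ?thesis using C(1) by (simp add: U_def killed_def)
      qed
    qed
  qed
  moreover have "lin_growth \<phi>"
    unfolding \<phi>_def
  proof (intro lin_growth_killed lin_growth_mult lin_growthI)
    show "(\<lambda>p. phi L B q (fst p) (R + snd p + \<bar>fst p\<bar>)) \<in> borel_measurable borel"
      unfolding phi_def by measurable
    show "\<bar>phi L B q x (R + y + \<bar>x\<bar>)\<bar> \<le> L * (1 + \<bar>x\<bar> + \<bar>y\<bar>)" for x y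
    proof -
      have "\<bar>phi L B q x (R + y + \<bar>x\<bar>)\<bar> \<le> L * (1 + \<bar>x\<bar>)"
        using phi0 phi_le by simp
      also have "\<dots> \<le> L * (1 + \<bar>x\<bar> + \<bar>y\<bar>)" using L by (intro mult_left_mono) auto
      finally show ?thesis .
    qed
  qed
  moreover have "0 \<le> \<phi> x y" if "0 < y" for x y
    using phi0 L c that by (simp add: \<phi>_def killed_def)
  moreover have "\<exists>d>0. \<forall>x y. 0 < y \<longrightarrow> \<bar>x\<bar> + y \<le> T \<longrightarrow> d \<le> \<phi> x y" for T
  proof -
    \<comment> \<open>On |x| + y \<le> T each of the two terms of the minimum has a positive lower
      bound.\<close>
    define d where "d = 2 / L * c * min L ((R + \<bar>T\<bar>) powr (1 - q))"
    have "R + \<bar>T\<bar> \<noteq> 0" using R by linarith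
    then have d0: "0 < d" using L c by (simp add: d_def)
    have "d \<le> \<phi> x y" if "0 < y" "\<bar>x\<bar> + y \<le> T" for x y
    proof -
      have 1: "L \<le> L * (1 + \<bar>x\<bar>)" using L by simp
      have "1 * (R + \<bar>T\<bar>) powr (1 - q) \<le> lyap B q x * (R + y + \<bar>x\<bar>) powr (1 - q)"
        using lyap_ge_1[OF B, of q x] that R q by (intro mult_mono powr_mono2') auto
      then have "min L ((R + \<bar>T\<bar>) powr (1 - q)) \<le> phi L B q x (R + y + \<bar>x\<bar>)"
        using 1 unfolding phi_def by linarith
      then show ?thesis using that L c by (auto simp: \<phi>_def killed_def d_def intro!: divide_right_mono mult_left_mono)
    qed
    with d0 show ?thesis by blast
  qed
  moreover have "Q U x y + exit_abs x y \<le> U x y - \<phi> x y" if y: "0 < y" for x y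
  proof -
    define H where "H \<omega> = 2 / L * (A * theta q (R / 2) (R + y + \<rho> * x + \<xi> x \<omega>) + phi L B q (a \<omega> * x + b \<omega>) (R + y) + L * R)" for \<omega>
    have phi_int: "integrable M (\<lambda>\<omega>. phi L B q (a \<omega> * x + b \<omega>) (R + y))"
    proof (rule integrable_real_bound[where g = "\<lambda>\<omega>. L * (1 + \<bar>a \<omega> * x + b \<omega>\<bar>)"])
      show "(\<lambda>\<omega>. phi L B q (a \<omega> * x + b \<omega>) (R + y)) \<in> borel_measurable M"
        unfolding phi_def by measurable
    qed (use phi0 phi_le in auto)
    have int: "integrable M (\<lambda>\<omega>. A * theta q (R / 2) (R + y + \<rho> * x + \<xi> x \<omega>) + phi L B q (a \<omega> * x + b \<omega>) (R + y))"
      using phi_int integrable_theta_\<xi>[OF q(1,2) R2] by auto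
    have kU: "lin_growth (killed U)" "lin_growth (exited (\<lambda>x y. \<bar>x\<bar>))"
      by (intro lin_growth_intros \<open>lin_growth U\<close>)+
    have "Q U x y + exit_abs x y = trans_op (\<lambda>x y. killed U x y + exited (\<lambda>x y. \<bar>x\<bar>) x y) x y"
      using trans_add[OF kU] by (simp add: Q_def)
    also have "\<dots> \<le> (\<integral>\<omega>. H \<omega> \<partial>M)"
      unfolding trans_op_def
    proof (intro integral_mono integrable_trans lin_growth_add kU)
      show "integrable M H"
        unfolding H_def by (intro integrable_mult_right Bochner_Integration.integrable_add[OF int]) simp
      fix \<omega>
      define X where "X = a \<omega> * x + b \<omega>"
      have sh: "R + (y + X) + \<rho> * X = R + y + \<rho> * x + \<xi> x \<omega>"
        using shift_\<xi>[of y \<omega> x] by (simp add: X_def)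
      have "killed U X (y + X) + exited (\<lambda>x y. \<bar>x\<bar>) X (y + X) \<le> H \<omega>"
      proof (cases "0 < y + X")
        case True
        have "R + y \<le> R + (y + X) + \<bar>X\<bar>" by linarith
        then have "phi L B q X (R + (y + X) + \<bar>X\<bar>) \<le> phi L B q X (R + y)"
          using B q y R by (intro phi_antimono) auto
        then have "U0 X (y + X) + L * R \<le> A * theta q (R / 2) (R + y + \<rho> * x + \<xi> x \<omega>) + phi L B q X (R + y) + L * R"
          unfolding U0_def sh by simp
        then have "2 / L * (U0 X (y + X) + L * R) \<le> H \<omega>"
          unfolding H_def X_def[symmetric] using L by (intro mult_left_mono) auto
        then show ?thesis using True by (simp add: killed_def exited_def U_def)
      next
        case False
        have "- (L / 2 * \<bar>X\<bar>) \<le> A * theta q (R / 2) (R + y + \<rho> * x + \<xi> x \<omega>)"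
        proof (rule low)
          have "- (\<bar>\<rho>\<bar> * \<bar>X\<bar>) \<le> \<rho> * X" unfolding abs_mult[symmetric] by (simp add: abs_le_iff)
          then show "R / 2 - (1 + \<bar>\<rho>\<bar>) * \<bar>X\<bar> \<le> R + y + \<rho> * x + \<xi> x \<omega>"
            unfolding sh[symmetric] distrib_right using y R by linarith
        qed
        moreover have "L * \<bar>X\<bar> \<le> phi L B q X (R + y) + L * R"
        proof (cases "\<bar>X\<bar> < R")
          case True
          then have "L * \<bar>X\<bar> \<le> L * R" using L by simp
          then show ?thesis using phi0[of X "R + y"] by linarith
        next
          case far: False
          \<comment> \<open>At exit y \<le> |X|, and here R \<le> |X|. So |X|^q (R + y)^(1-q) is at
            least 2^(1-q) |X|, which explains the bound on L.\<close>
          have X: "0 < \<bar>X\<bar>" "R + y \<le> 2 * \<bar>X\<bar>" using far False y R by auto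
          have "L * \<bar>X\<bar> \<le> 2 powr (1 - q) * \<bar>X\<bar>" using L by (intro mult_right_mono) auto
          also have "\<dots> = \<bar>X\<bar> powr q * (2 * \<bar>X\<bar>) powr (1 - q)"
            using X by (simp add: powr_mult powr_add[symmetric])
          also have "\<dots> \<le> lyap B q X * (R + y) powr (1 - q)"
            using lyap_ge[OF B, of X q] lyap_ge_1[OF B, of q X] X q y R by (intro mult_mono powr_mono2') auto
          finally have "L * \<bar>X\<bar> \<le> lyap B q X * (R + y) powr (1 - q)" .
          moreover have "L * \<bar>X\<bar> \<le> L * (1 + \<bar>X\<bar>)" using L by simp
          ultimately have "L * \<bar>X\<bar> \<le> phi L B q X (R + y)" by (simp add: phi_def)
          moreover have "0 \<le> L * R" using L R by simp
          ultimately show ?thesis by linarith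
        qed
        ultimately have "L / 2 * \<bar>X\<bar> \<le> A * theta q (R / 2) (R + y + \<rho> * x + \<xi> x \<omega>) + phi L B q X (R + y) + L * R"
          by linarith
        then have "2 / L * (L / 2 * \<bar>X\<bar>) \<le> H \<omega>"
          unfolding H_def X_def[symmetric] using L by (intro mult_left_mono) auto
        then show ?thesis using False L by (simp add: killed_def exited_def)
      qed
      then show "killed U (a \<omega> * x + b \<omega>) (y + (a \<omega> * x + b \<omega>)) +
          exited (\<lambda>x y. \<bar>x\<bar>) (a \<omega> * x + b \<omega>) (y + (a \<omega> * x + b \<omega>)) \<le> H \<omega>"
        by (simp add: X_def)
    qed
    also have "\<dots> = 2 / L * ((\<integral>\<omega>. A * theta q (R / 2) (R + y + \<rho> * x + \<xi> x \<omega>) + phi L B q (a \<omega> * x + b \<omega>) (R + y) \<partial>M) + L * R)"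
      unfolding H_def
      by (subst integral_mult_right_zero, subst Bochner_Integration.integral_add[OF int]) (simp_all add: prob_space)
    also have "\<dots> \<le> 2 / L * (U0 x y - c * phi L B q x (R + y + \<bar>x\<bar>) + L * R)"
    proof (intro mult_left_mono add_right_mono)
      show "(\<integral>\<omega>. A * theta q (R / 2) (R + y + \<rho> * x + \<xi> x \<omega>) + phi L B q (a \<omega> * x + b \<omega>) (R + y) \<partial>M)
        \<le> U0 x y - c * phi L B q x (R + y + \<bar>x\<bar>)"
        using main[OF y, of x] by (simp add: U0_def left_diff_distrib)
    qed (use L in auto)
    also have "\<dots> = U x y - \<phi> x y"
      using y L by (simp add: U_def \<phi>_def killed_def field_simps)
    finally show ?thesis .
  qed
  note facts = calculation this U_nonneg U_upper
  show ?thesis by (rule that[of U \<phi>]) (fact facts)+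
qed


subsection \<open>The harmonic function as a limit\<close>

text \<open>The factor 1 makes \<open>w\<close> a literal instance of
  \<open>lin_growth_affine\<close>.\<close>

definition w :: "real \<Rightarrow> real \<Rightarrow> real" where
  "w x y = \<rho> * x + 1 * y"

definition exit_w :: "real \<Rightarrow> real \<Rightarrow> real" where
  "exit_w = trans_op (exited w)"

text \<open>The value of w at the start minus its mean at the exit: the k-th term is the
  contribution of \<tau> = k + 1. As M is w along the path minus w at the start, this is the
  candidate for - E M_\<tau>.\<close>

definition W :: "real \<Rightarrow> real \<Rightarrow> real" where
  "W x y = w x y - (\<Sum>k. (Q ^^ k) exit_w x y)"

lemma lin_growth_w: "lin_growth w"
  unfolding w_def[abs_def] by (rule lin_growth_affine)

lemma lin_growth_exit_w: "lin_growth exit_w"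
  unfolding exit_w_def by (intro lin_growth_trans lin_growth_exited lin_growth_w)

lemma lin_growth_exit_abs: "lin_growth exit_abs"
  by (intro lin_growth_trans lin_growth_intros)

lemma killed_plus_exited: "killed F x y + exited F x y = F x y"
  by (auto simp: killed_def exited_def split: split_indicator)

lemma Q_plus_exit: "lin_growth F \<Longrightarrow> Q F x y + trans_op (exited F) x y = trans_op F x y"
  using trans_add[OF lin_growth_killed lin_growth_exited, of F F] unfolding killed_plus_exited Q_def by simp

lemma trans_w: "trans_op w x y = w x y"
proof -
  have "trans_op w x y = (\<integral>\<omega>. w x y + \<xi> x \<omega> \<partial>M)"
    unfolding trans_op_def
    by (intro Bochner_Integration.integral_cong) (use shift_\<xi> in \<open>auto simp: w_def algebra_simps\<close>)
  also have "\<dots> = w x y" by (simp add: mean_\<xi> prob_space)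
  finally show ?thesis .
qed

lemma Q_w: "Q w x y + exit_w x y = w x y"
  unfolding exit_w_def using Q_plus_exit[OF lin_growth_w] trans_w by simp

lemma exit_w_nonpos:
  assumes "0 \<le> \<rho>" "0 < y"
  shows "exit_w x y \<le> 0"
proof -
  have "exit_w x y \<le> trans_op (\<lambda>x y. 0) x y"
    unfolding exit_w_def
  proof (intro trans_mono lin_growth_exited lin_growth_w lin_growth_const)
    fix \<omega>
    define X where "X = a \<omega> * x + b \<omega>"
    have "w X (y + X) \<le> 0" if "y + X \<le> 0"
      using that assms mult_nonneg_nonpos[of \<rho> X] by (simp add: w_def)
    then show "exited w (a \<omega> * x + b \<omega>) (y + (a \<omega> * x + b \<omega>)) \<le> 0"
      unfolding X_def[symmetric] by (auto simp: exited_def split: split_indicator)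
  qed
  then show ?thesis by (simp add: trans_op_def)
qed

lemma exit_w_bound:
  assumes "0 < y"
  shows "\<bar>exit_w x y\<bar> \<le> (1 + \<bar>\<rho>\<bar>) * exit_abs x y"
proof -
  have "\<bar>exit_w x y\<bar> \<le> (\<integral>\<omega>. \<bar>exited w (a \<omega> * x + b \<omega>) (y + (a \<omega> * x + b \<omega>))\<bar> \<partial>M)"
    unfolding exit_w_def trans_op_def by (rule integral_abs_bound)
  also have "\<dots> = trans_op (\<lambda>x y. \<bar>exited w x y\<bar>) x y" by (simp add: trans_op_def)
  also have "\<dots> \<le> trans_op (\<lambda>x y. (1 + \<bar>\<rho>\<bar>) * exited (\<lambda>x y. \<bar>x\<bar>) x y) x y"
  proof (intro trans_mono lin_growth_intros lin_growth_w)
    fix \<omega>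
    define X where "X = a \<omega> * x + b \<omega>"
    have "\<bar>w X (y + X)\<bar> \<le> (1 + \<bar>\<rho>\<bar>) * \<bar>X\<bar>" if "y + X \<le> 0"
    proof -
      have "\<bar>w X (y + X)\<bar> \<le> \<bar>\<rho> * X\<bar> + \<bar>y + X\<bar>" unfolding w_def by simp
      also have "\<dots> \<le> \<bar>\<rho>\<bar> * \<bar>X\<bar> + \<bar>X\<bar>" using that assms by (simp add: abs_mult)
      finally show ?thesis by (simp add: algebra_simps)
    qed
    then show "\<bar>exited w (a \<omega> * x + b \<omega>) (y + (a \<omega> * x + b \<omega>))\<bar>
        \<le> (1 + \<bar>\<rho>\<bar>) * exited (\<lambda>x y. \<bar>x\<bar>) (a \<omega> * x + b \<omega>) (y + (a \<omega> * x + b \<omega>))"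
      unfolding X_def[symmetric] by (auto simp: exited_def split: split_indicator)
  qed
  finally show ?thesis unfolding trans_mult .
qed

lemma exit_abs_nonneg: "0 \<le> exit_abs x y"
  unfolding trans_op_def by (rule Bochner_Integration.integral_nonneg) (simp add: exited_def)

lemma Qn_exit_w_bound:
  assumes "0 < y"
  shows "\<bar>(Q ^^ n) exit_w x y\<bar> \<le> (1 + \<bar>\<rho>\<bar>) * (Q ^^ n) exit_abs x y"
proof -
  have e: "exit_w x y \<le> (1 + \<bar>\<rho>\<bar>) * exit_abs x y" "(- (1 + \<bar>\<rho>\<bar>)) * exit_abs x y \<le> exit_w x y"
    if "0 < y" for x y
    using exit_w_bound[OF that, of x] by (auto simp: abs_le_iff algebra_simps)
  have "(Q ^^ n) exit_w x y \<le> (Q ^^ n) (\<lambda>x y. (1 + \<bar>\<rho>\<bar>) * exit_abs x y) x y"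
    by (intro Qn_mono lin_growth_mult lin_growth_exit_w lin_growth_exit_abs e assms)
  moreover have "(Q ^^ n) (\<lambda>x y. (- (1 + \<bar>\<rho>\<bar>)) * exit_abs x y) x y \<le> (Q ^^ n) exit_w x y"
    by (intro Qn_mono lin_growth_mult lin_growth_exit_w lin_growth_exit_abs e assms)
  ultimately show ?thesis unfolding Qn_mult unfolding mult_minus_left by (intro abs_leI) linarith+
qed

lemma Qn_exit_abs_nonneg: "0 < y \<Longrightarrow> 0 \<le> (Q ^^ n) exit_abs x y"
  by (intro Qn_nonneg lin_growth_exit_abs exit_abs_nonneg)

text \<open>The series represents the mean of |X_\<tau>|. It is bounded by U, whose growth bound
  supplies C for each \<delta>.\<close>

lemma exit_abs_potential:
  shows "0 < y \<Longrightarrow> summable (\<lambda>k. (Q ^^ k) exit_abs x y)"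
    and "0 < \<delta> \<Longrightarrow> \<exists>C\<ge>0. \<forall>x y. 0 < y \<longrightarrow> (\<Sum>k. (Q ^^ k) exit_abs x y) \<le> \<delta> * y + C * (1 + \<bar>x\<bar>)"
proof -
  obtain U \<phi> where U: "lin_growth U" "\<And>x y. 0 < y \<Longrightarrow> 0 \<le> U x y"
    and \<phi>: "\<And>x y. 0 < y \<Longrightarrow> 0 \<le> \<phi> x y"
    and Ub: "\<And>\<delta>. 0 < \<delta> \<Longrightarrow> \<exists>C\<ge>0. \<forall>x y. 0 < y \<longrightarrow> U x y \<le> \<delta> * y + C * (1 + \<bar>x\<bar>)"
    and drift: "\<And>x y. 0 < y \<Longrightarrow> Q U x y + exit_abs x y \<le> U x y - \<phi> x y"
    by (rule drift_function) (rule that)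
  have partial: "(\<Sum>k<n. (Q ^^ k) exit_abs x y) \<le> U x y" if "0 < y" for n x y
  proof (rule potential_bound[OF U(1) lin_growth_exit_abs U(2) _ that])
    show "Q U x y + exit_abs x y \<le> U x y" if "0 < y" for x y
      using drift[OF that, of x] \<phi>[OF that, of x] by linarith
  qed
  show summable: "summable (\<lambda>k. (Q ^^ k) exit_abs x y)" if "0 < y" for x y
    using partial[OF that] Qn_exit_abs_nonneg[OF that] by (intro summableI_nonneg_bounded)
  assume "0 < \<delta>"
  from Ub[OF this] obtain C where C: "0 \<le> C" "\<And>x y. 0 < y \<Longrightarrow> U x y \<le> \<delta> * y + C * (1 + \<bar>x\<bar>)" by blast
  have "(\<Sum>k. (Q ^^ k) exit_abs x y) \<le> \<delta> * y + C * (1 + \<bar>x\<bar>)" if "0 < y" for x y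
    using suminf_le_const[OF summable[OF that, of x] partial[OF that]] C(2)[OF that, of x] by linarith
  with C(1) show "\<exists>C\<ge>0. \<forall>x y. 0 < y \<longrightarrow> (\<Sum>k. (Q ^^ k) exit_abs x y) \<le> \<delta> * y + C * (1 + \<bar>x\<bar>)" by blast
qed

lemma summable_exit_w:
  assumes "0 < y"
  shows "summable (\<lambda>k. (Q ^^ k) exit_w x y)"
  by (rule summable_comparison_test'[where N = 0 and g = "\<lambda>k. (1 + \<bar>\<rho>\<bar>) * (Q ^^ k) exit_abs x y"])
     (use Qn_exit_w_bound[OF assms] exit_abs_potential(1)[OF assms] in auto)

text \<open>Telescoping of Q w = w - \<open>exit_w\<close>, the martingale identity split into
  survival and exit.\<close>

lemma Qn_w:
  assumes "0 < y"
  shows "(Q ^^ n) w x y = w x y - (\<Sum>k<n. (Q ^^ k) exit_w x y)"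
proof (induction n)
  case (Suc n)
  have "(Q ^^ Suc n) w x y = (Q ^^ n) (\<lambda>x y. w x y - exit_w x y) x y"
    unfolding funpow_Suc_right o_def
  proof (rule Qn_cong[OF _ assms])
    show "Q w x y = w x y - exit_w x y" for x y using Q_w[of x y] by linarith
  qed
  also have "\<dots> = (Q ^^ n) w x y - (Q ^^ n) exit_w x y"
    by (rule Qn_diff[OF lin_growth_w lin_growth_exit_w])
  finally show ?case using Suc by simp
qed simp

lemma Qn_w_tendsto:
  assumes "0 < y"
  shows "(\<lambda>n. (Q ^^ n) w x y) \<longlonglongrightarrow> W x y"
  unfolding Qn_w[OF assms] W_def
  by (intro tendsto_diff tendsto_const summable_LIMSEQ summable_exit_w assms)

text \<open>Both differences are bounded by 1 + |\<rho>| times the series of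
  \<open>exit_abs\<close>. Uniformity in n provides the majorant for dominated convergence.\<close>

lemma W_near_w:
  assumes "0 < \<delta>"
  obtains C where "0 \<le> C"
    "\<And>x y n. 0 < y \<Longrightarrow> \<bar>(Q ^^ n) w x y - w x y\<bar> \<le> \<delta> * y + C * (1 + \<bar>x\<bar>)"
    "\<And>x y. 0 < y \<Longrightarrow> \<bar>W x y - w x y\<bar> \<le> \<delta> * y + C * (1 + \<bar>x\<bar>)"
proof -
  have "0 < \<delta> / (1 + \<bar>\<rho>\<bar>)" using assms by (simp add: add_pos_nonneg)
  from exit_abs_potential(2)[OF this] obtain C where C: "0 \<le> C"
    "\<And>x y. 0 < y \<Longrightarrow> (\<Sum>k. (Q ^^ k) exit_abs x y) \<le> \<delta> / (1 + \<bar>\<rho>\<bar>) * y + C * (1 + \<bar>x\<bar>)" by blast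
  define D where "D = (1 + \<bar>\<rho>\<bar>) * C"
  have bound: "\<bar>(Q ^^ n) w x y - w x y\<bar> \<le> \<delta> * y + D * (1 + \<bar>x\<bar>)" if y: "0 < y" for n x y
  proof -
    have "\<bar>(Q ^^ n) w x y - w x y\<bar> = \<bar>\<Sum>k<n. (Q ^^ k) exit_w x y\<bar>"
      by (simp add: Qn_w[OF y])
    also have "\<dots> \<le> (\<Sum>k<n. \<bar>(Q ^^ k) exit_w x y\<bar>)" by (rule sum_abs)
    also have "\<dots> \<le> (\<Sum>k<n. (1 + \<bar>\<rho>\<bar>) * (Q ^^ k) exit_abs x y)"
      by (intro sum_mono Qn_exit_w_bound y)
    also have "\<dots> = (1 + \<bar>\<rho>\<bar>) * (\<Sum>k<n. (Q ^^ k) exit_abs x y)"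
      by (simp add: sum_distrib_left)
    also have "\<dots> \<le> (1 + \<bar>\<rho>\<bar>) * (\<Sum>k. (Q ^^ k) exit_abs x y)"
      by (intro mult_left_mono sum_le_suminf exit_abs_potential(1) y Qn_exit_abs_nonneg) auto
    also have "\<dots> \<le> (1 + \<bar>\<rho>\<bar>) * (\<delta> / (1 + \<bar>\<rho>\<bar>) * y + C * (1 + \<bar>x\<bar>))"
      by (intro mult_left_mono C(2) y) auto
    also have "\<dots> = (1 + \<bar>\<rho>\<bar>) * (\<delta> / (1 + \<bar>\<rho>\<bar>)) * y + D * (1 + \<bar>x\<bar>)"
      by (simp add: D_def algebra_simps)
    also have "(1 + \<bar>\<rho>\<bar>) * (\<delta> / (1 + \<bar>\<rho>\<bar>)) = \<delta>" by simp
    finally show ?thesis .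
  qed
  have "\<bar>W x y - w x y\<bar> \<le> \<delta> * y + D * (1 + \<bar>x\<bar>)" if y: "0 < y" for x y
    by (rule tendsto_upperbound[OF tendsto_rabs[OF tendsto_diff[OF Qn_w_tendsto[OF y] tendsto_const]]])
       (use bound[OF y] in auto)
  moreover have "0 \<le> D" using C by (simp add: D_def)
  ultimately show ?thesis using bound by (intro that[of D])
qed

lemma Q_abs_le: "Q (\<lambda>x y. \<bar>x\<bar>) x y \<le> (\<integral>\<omega>. \<bar>a \<omega>\<bar> \<partial>M) * \<bar>x\<bar> + (\<integral>\<omega>. \<bar>b \<omega>\<bar> \<partial>M)"
proof -
  have "Q (\<lambda>x y. \<bar>x\<bar>) x y \<le> trans_op (\<lambda>x y. \<bar>x\<bar>) x y"
    unfolding Q_def by (intro trans_mono lin_growth_intros) (auto simp: killed_def split: split_indicator)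
  also have "\<dots> \<le> (\<integral>\<omega>. \<bar>a \<omega>\<bar> * \<bar>x\<bar> + \<bar>b \<omega>\<bar> \<partial>M)"
    unfolding trans_op_def
    by (intro integral_mono) (auto simp: abs_mult[symmetric])
  also have "\<dots> = (\<integral>\<omega>. \<bar>a \<omega>\<bar> \<partial>M) * \<bar>x\<bar> + (\<integral>\<omega>. \<bar>b \<omega>\<bar> \<partial>M)" by simp
  finally show ?thesis .
qed

text \<open>Keeping the survival probability as the factor of E|b|, instead of bounding it by 1, is
  what later sends the mean of |X_n| before exit to 0.\<close>

lemma Qn_abs_step:
  assumes "0 < y"
  shows "(Q ^^ Suc n) (\<lambda>x y. \<bar>x\<bar>) x y
    \<le> (\<integral>\<omega>. \<bar>a \<omega>\<bar> \<partial>M) * (Q ^^ n) (\<lambda>x y. \<bar>x\<bar>) x y + (\<integral>\<omega>. \<bar>b \<omega>\<bar> \<partial>M) * (Q ^^ n) (\<lambda>x y. 1) x y"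
proof -
  have "(Q ^^ Suc n) (\<lambda>x y. \<bar>x\<bar>) x y = (Q ^^ n) (Q (\<lambda>x y. \<bar>x\<bar>)) x y"
    unfolding funpow_Suc_right by simp
  also have "\<dots> \<le> (Q ^^ n) (\<lambda>x y. (\<integral>\<omega>. \<bar>a \<omega>\<bar> \<partial>M) * \<bar>x\<bar> + (\<integral>\<omega>. \<bar>b \<omega>\<bar> \<partial>M) * 1) x y"
    using Q_abs_le by (intro Qn_mono lin_growth_Q lin_growth_intros assms) simp
  also have "\<dots> = (\<integral>\<omega>. \<bar>a \<omega>\<bar> \<partial>M) * (Q ^^ n) (\<lambda>x y. \<bar>x\<bar>) x y + (\<integral>\<omega>. \<bar>b \<omega>\<bar> \<partial>M) * (Q ^^ n) (\<lambda>x y. 1) x y"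
    by (subst Qn_add) (intro lin_growth_intros, intro lin_growth_intros, simp only: Qn_mult)
  finally show ?thesis .
qed

lemma Q_one_le: "Q (\<lambda>x y. 1) x y \<le> 1"
proof -
  have "Q (\<lambda>x y. 1) x y \<le> trans_op (\<lambda>x y. 1) x y"
    unfolding Q_def by (intro trans_mono lin_growth_intros) (auto simp: killed_def)
  then show ?thesis by (simp add: trans_op_def prob_space)
qed

lemma Qn_one_le:
  assumes "0 < y"
  shows "(Q ^^ n) (\<lambda>x y. 1) x y \<le> 1"
proof (induction n)
  case (Suc n)
  have "(Q ^^ n) (Q (\<lambda>x y. 1)) x y \<le> (Q ^^ n) (\<lambda>x y. 1) x y"
    using Q_one_le by (intro Qn_mono lin_growth_Q lin_growth_intros assms)
  then show ?case using Suc unfolding funpow_Suc_right by simp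
qed simp

lemma Qn_abs_bound:
  assumes "0 < y"
  shows "(Q ^^ n) (\<lambda>x y. \<bar>x\<bar>) x y \<le> \<bar>x\<bar> + (\<integral>\<omega>. \<bar>b \<omega>\<bar> \<partial>M) / (1 - (\<integral>\<omega>. \<bar>a \<omega>\<bar> \<partial>M))"
proof (induction n)
  case 0
  then show ?case using abs_a_mean_less_1 by simp
next
  case (Suc n)
  define k where "k = (\<integral>\<omega>. \<bar>a \<omega>\<bar> \<partial>M)"
  define C where "C = (\<integral>\<omega>. \<bar>b \<omega>\<bar> \<partial>M)"
  have k: "0 \<le> k" "k < 1" and C: "0 \<le> C" using abs_a_mean_less_1 by (auto simp: k_def C_def)
  have "(Q ^^ Suc n) (\<lambda>x y. \<bar>x\<bar>) x y \<le> k * (Q ^^ n) (\<lambda>x y. \<bar>x\<bar>) x y + C * (Q ^^ n) (\<lambda>x y. 1) x y"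
    using Qn_abs_step[OF assms] by (simp add: k_def C_def)
  also have "\<dots> \<le> k * (\<bar>x\<bar> + C / (1 - k)) + C * 1"
    using Suc k C Qn_one_le[OF assms] unfolding k_def[symmetric] C_def[symmetric]
    by (intro add_mono mult_left_mono) auto
  also have "\<dots> = k * \<bar>x\<bar> + C / (1 - k)" using k by (simp add: field_simps)
  also have "\<dots> \<le> \<bar>x\<bar> + C / (1 - k)" using k by (simp add: mult_left_le_one_le)
  finally show ?case by (simp add: k_def C_def)
qed

text \<open>The iterates of \<phi> are summable, so the surviving mass in a bounded region tends to
  0. Outside it Markov's inequality applies: the mean of |x| + y on survival is bounded in n,
  because those of w and |x| are.\<close>

lemma Qn_one_tendsto:
  assumes y: "0 < y"
  shows "(\<lambda>n. (Q ^^ n) (\<lambda>x y. 1) x y) \<longlonglongrightarrow> 0"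
proof -
  obtain U \<phi> where U: "lin_growth U" "\<And>x y. 0 < y \<Longrightarrow> 0 \<le> U x y"
    and \<phi>: "lin_growth \<phi>" "\<And>x y. 0 < y \<Longrightarrow> 0 \<le> \<phi> x y"
    and low: "\<And>T. \<exists>c>0. \<forall>x y. 0 < y \<longrightarrow> \<bar>x\<bar> + y \<le> T \<longrightarrow> c \<le> \<phi> x y"
    and drift: "\<And>x y. 0 < y \<Longrightarrow> Q U x y + exit_abs x y \<le> U x y - \<phi> x y"
    by (rule drift_function) (rule that)
  have "(\<Sum>k<n. (Q ^^ k) \<phi> x y) \<le> U x y" for n
  proof (rule potential_bound[OF U(1) \<phi>(1) U(2) _ y])
    show "Q U x y + \<phi> x y \<le> U x y" if "0 < y" for x y
      using drift[OF that, of x] exit_abs_nonneg[of x y] by linarith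
  qed
  then have "summable (\<lambda>k. (Q ^^ k) \<phi> x y)"
    using Qn_nonneg[OF \<phi> y] by (intro summableI_nonneg_bounded)
  then have \<phi>0: "(\<lambda>k. (Q ^^ k) \<phi> x y) \<longlonglongrightarrow> 0" by (rule summable_LIMSEQ_zero)
  obtain D where D: "0 \<le> D" "\<And>n. \<bar>(Q ^^ n) w x y - w x y\<bar> \<le> D"
    by (rule W_near_w[OF zero_less_one]) (use y in \<open>meson abs_ge_zero order_trans\<close>)
  define E where "E = \<bar>x\<bar> + (\<integral>\<omega>. \<bar>b \<omega>\<bar> \<partial>M) / (1 - (\<integral>\<omega>. \<bar>a \<omega>\<bar> \<partial>M))"
  define G where "G = \<bar>w x y\<bar> + D + (1 + \<bar>\<rho>\<bar>) * E"
  have E: "(Q ^^ n) (\<lambda>x y. \<bar>x\<bar>) x y \<le> E" for n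
    unfolding E_def by (rule Qn_abs_bound[OF y])
  have height: "(Q ^^ n) (\<lambda>x y. \<bar>x\<bar> + y) x y \<le> G" for n
  proof -
    have "(Q ^^ n) (\<lambda>x y. \<bar>x\<bar> + y) x y \<le> (Q ^^ n) (\<lambda>x y. w x y + (1 + \<bar>\<rho>\<bar>) * \<bar>x\<bar>) x y"
    proof (intro Qn_mono lin_growth_intros lin_growth_w y)
      fix x y :: real
      have "- (\<rho> * x) \<le> \<bar>\<rho>\<bar> * \<bar>x\<bar>" unfolding abs_mult[symmetric] by simp
      then show "\<bar>x\<bar> + y \<le> w x y + (1 + \<bar>\<rho>\<bar>) * \<bar>x\<bar>" by (simp add: w_def distrib_right)
    qed
    also have "\<dots> = (Q ^^ n) w x y + (1 + \<bar>\<rho>\<bar>) * (Q ^^ n) (\<lambda>x y. \<bar>x\<bar>) x y"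
      by (subst Qn_add) (auto intro!: lin_growth_intros lin_growth_w simp: Qn_mult)
    also have "\<dots> \<le> (\<bar>w x y\<bar> + D) + (1 + \<bar>\<rho>\<bar>) * E"
      using D(2)[of n] by (intro add_mono mult_left_mono E) auto
    finally show ?thesis by (simp add: G_def)
  qed
  have nonneg: "0 \<le> (Q ^^ n) (\<lambda>x y. 1) x y" for n
    by (intro Qn_nonneg y) auto
  show ?thesis
  proof (rule LIMSEQ_I)
    fix r :: real assume r: "0 < r"
    define T where "T = 2 * (\<bar>G\<bar> + 1) / r"
    have T: "0 < T" using r by (simp add: T_def)
    obtain c where c: "0 < c" "\<And>x y. 0 < y \<Longrightarrow> \<bar>x\<bar> + y \<le> T \<Longrightarrow> c \<le> \<phi> x y" using low[of T] by blast
    have "(\<lambda>k. 1 / c * (Q ^^ k) \<phi> x y) \<longlonglongrightarrow> 1 / c * 0" by (intro tendsto_mult tendsto_const \<phi>0)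
    then have "eventually (\<lambda>k. 1 / c * (Q ^^ k) \<phi> x y < r / 2) sequentially"
      using r by (intro order_tendstoD(2)) auto
    then obtain N where N: "\<And>k. N \<le> k \<Longrightarrow> 1 / c * (Q ^^ k) \<phi> x y < r / 2"
      unfolding eventually_sequentially by blast
    have "norm ((Q ^^ n) (\<lambda>x y. 1) x y - 0) < r" if "N \<le> n" for n
    proof -
      \<comment> \<open>Pointwise, 1 is at most \<phi>/c inside |x| + y \<le> T and at most (|x| +
        y)/T outside.\<close>
      have "(Q ^^ n) (\<lambda>x y. 1) x y \<le> (Q ^^ n) (\<lambda>x y. 1 / c * \<phi> x y + 1 / T * (\<bar>x\<bar> + y)) x y"
      proof (intro Qn_mono lin_growth_intros \<phi> y)
        fix x y :: real assume y: "0 < y"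
        show "1 \<le> 1 / c * \<phi> x y + 1 / T * (\<bar>x\<bar> + y)"
        proof (cases "\<bar>x\<bar> + y \<le> T")
          case True
          then have "1 \<le> 1 / c * \<phi> x y" using c(1) c(2)[OF y] by simp
          moreover have "0 \<le> 1 / T * (\<bar>x\<bar> + y)" using T y by simp
          ultimately show ?thesis by linarith
        next
          case False
          then have "1 \<le> 1 / T * (\<bar>x\<bar> + y)" using T by simp
          moreover have "0 \<le> 1 / c * \<phi> x y" using c \<phi>(2)[OF y] by simp
          ultimately show ?thesis by linarith
        qed
      qed
      also have "\<dots> = 1 / c * (Q ^^ n) \<phi> x y + 1 / T * (Q ^^ n) (\<lambda>x y. \<bar>x\<bar> + y) x y"
        by (subst Qn_add) (intro lin_growth_intros \<phi>, intro lin_growth_intros, simp only: Qn_mult)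
      also have "\<dots> < r / 2 + 1 / T * (\<bar>G\<bar> + 1)"
      proof (rule add_less_le_mono[OF N[OF that]])
        show "1 / T * (Q ^^ n) (\<lambda>x y. \<bar>x\<bar> + y) x y \<le> 1 / T * (\<bar>G\<bar> + 1)"
          using height[of n] T by (intro mult_left_mono) auto
      qed
      also have "1 / T * (\<bar>G\<bar> + 1) = r / 2" using r by (simp add: T_def field_simps)
      finally show ?thesis using nonneg[of n] by simp
    qed
    then show "\<exists>no. \<forall>n\<ge>no. norm ((Q ^^ n) (\<lambda>x y. 1) x y - 0) < r" by blast
  qed
qed

lemma Qn_abs_tendsto:
  assumes y: "0 < y"
  shows "(\<lambda>n. (Q ^^ n) (\<lambda>x y. \<bar>x\<bar>) x y) \<longlonglongrightarrow> 0"
proof (rule contraction_tendsto_zero)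
  show "(Q ^^ Suc n) (\<lambda>x y. \<bar>x\<bar>) x y
    \<le> (\<integral>\<omega>. \<bar>a \<omega>\<bar> \<partial>M) * (Q ^^ n) (\<lambda>x y. \<bar>x\<bar>) x y + (\<integral>\<omega>. \<bar>b \<omega>\<bar> \<partial>M) * (Q ^^ n) (\<lambda>x y. 1) x y" for n
    by (rule Qn_abs_step[OF y])
  show "0 \<le> (Q ^^ n) (\<lambda>x y. \<bar>x\<bar>) x y" for n
    by (intro Qn_nonneg y lin_growth_intros) auto
  have "(\<lambda>n. (\<integral>\<omega>. \<bar>b \<omega>\<bar> \<partial>M) * (Q ^^ n) (\<lambda>x y. 1) x y) \<longlonglongrightarrow> (\<integral>\<omega>. \<bar>b \<omega>\<bar> \<partial>M) * 0"
    by (intro tendsto_mult tendsto_const Qn_one_tendsto y)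
  then show "(\<lambda>n. (\<integral>\<omega>. \<bar>b \<omega>\<bar> \<partial>M) * (Q ^^ n) (\<lambda>x y. 1) x y) \<longlonglongrightarrow> 0" by simp
qed (use abs_a_mean_less_1 in auto)

text \<open>The functions y and w differ by \<rho> x, whose killed mean vanishes by
  \<open>Qn_abs_tendsto\<close>.\<close>

lemma Qn_snd_tendsto:
  assumes y: "0 < y"
  shows "(\<lambda>n. (Q ^^ n) (\<lambda>x y. y) x y) \<longlonglongrightarrow> W x y"
proof -
  have "(\<lambda>n. (Q ^^ n) (\<lambda>x y. y) x y - (Q ^^ n) w x y) \<longlonglongrightarrow> 0"
  proof (rule tendsto_rabs_zero_cancel, rule tendsto_sandwich[OF _ _ tendsto_const])
    have "(\<lambda>n. \<bar>\<rho>\<bar> * (Q ^^ n) (\<lambda>x y. \<bar>x\<bar>) x y) \<longlonglongrightarrow> \<bar>\<rho>\<bar> * 0"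
      by (intro tendsto_mult tendsto_const Qn_abs_tendsto y)
    then show "(\<lambda>n. \<bar>\<rho>\<bar> * (Q ^^ n) (\<lambda>x y. \<bar>x\<bar>) x y) \<longlonglongrightarrow> 0" by simp
    have "\<bar>(Q ^^ n) (\<lambda>x y. y) x y - (Q ^^ n) w x y\<bar> \<le> \<bar>\<rho>\<bar> * (Q ^^ n) (\<lambda>x y. \<bar>x\<bar>) x y" for n
    proof -
      have l: "lin_growth (\<lambda>x y. y - w x y)" "lin_growth (\<lambda>x y. \<bar>x\<bar>)"
        by (intro lin_growth_intros lin_growth_w)+
      have b: "y - w x y \<le> \<bar>\<rho>\<bar> * \<bar>x\<bar>" "(- \<bar>\<rho>\<bar>) * \<bar>x\<bar> \<le> y - w x y" for x y
        unfolding w_def mult_minus_left abs_mult[symmetric] by (auto simp: abs_le_iff)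
      have "(Q ^^ n) (\<lambda>x y. y - w x y) x y \<le> (Q ^^ n) (\<lambda>x y. \<bar>\<rho>\<bar> * \<bar>x\<bar>) x y"
        by (intro Qn_mono l lin_growth_mult b y)
      moreover have "(Q ^^ n) (\<lambda>x y. (- \<bar>\<rho>\<bar>) * \<bar>x\<bar>) x y \<le> (Q ^^ n) (\<lambda>x y. y - w x y) x y"
        by (intro Qn_mono l lin_growth_mult b y)
      ultimately show ?thesis
        unfolding Qn_mult Qn_diff[OF lin_growth_snd lin_growth_w] unfolding mult_minus_left by (intro abs_leI) linarith+
    qed
    then show "eventually (\<lambda>n. \<bar>(Q ^^ n) (\<lambda>x y. y) x y - (Q ^^ n) w x y\<bar> \<le> \<bar>\<rho>\<bar> * (Q ^^ n) (\<lambda>x y. \<bar>x\<bar>) x y) sequentially"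
      by simp
  qed simp
  from tendsto_add[OF this Qn_w_tendsto[OF y, of x]] show ?thesis by simp
qed

lemma W_nonneg:
  assumes "0 < y"
  shows "0 \<le> W x y"
  by (rule LIMSEQ_le_const[OF Qn_snd_tendsto[OF assms]]) (use assms in \<open>auto intro!: Qn_nonneg\<close>)

text \<open>For \<rho> \<ge> 0 the value of w at an exit is not positive, since X and y + X are not.
  The subtracted series is then at most 0.\<close>

lemma W_ge_w:
  assumes "0 < y" "0 \<le> \<rho>"
  shows "w x y \<le> W x y"
proof -
  have "(Q ^^ n) exit_w x y \<le> (Q ^^ n) (\<lambda>x y. 0) x y" for n
    using assms by (intro Qn_mono lin_growth_exit_w exit_w_nonpos) auto
  moreover have "(Q ^^ n) (\<lambda>x y. 0) x y = 0" for n
    using Qn_mult[of n 0 "\<lambda>x y. 0"] by simp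
  ultimately have "(\<Sum>k. (Q ^^ k) exit_w x y) \<le> 0"
    by (intro suminf_le_const summable_exit_w assms sum_nonpos) auto
  then show ?thesis by (simp add: W_def)
qed

text \<open>Both starts see the same increments. Where only the higher one survives, nonnegativity
  of the iterated height settles the comparison.\<close>

lemma W_mono:
  assumes "0 < y" "y \<le> y'"
  shows "W x y \<le> W x y'"
proof (rule LIMSEQ_le[OF Qn_snd_tendsto Qn_snd_tendsto])
  have "(Q ^^ n) (\<lambda>x y. y) x y \<le> (Q ^^ n) (\<lambda>x y. y) x y'" for n
    using assms
  proof (induction n arbitrary: x y y')
    case (Suc n)
    let ?F = "(Q ^^ n) (\<lambda>x y. y)"
    have l: "lin_growth (killed ?F)" by (intro lin_growth_killed lin_growth_Qn lin_growth_snd)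
    have "killed ?F X (y + X) \<le> killed ?F X (y' + X)" for X
    proof (cases "0 < y + X")
      case True
      then show ?thesis using Suc.IH[of "y + X" "y' + X" X] Suc.prems by (simp add: killed_def)
    next
      case False
      have "0 \<le> ?F X (y' + X)" if "0 < y' + X"
        using that by (intro Qn_nonneg) auto
      then show ?thesis using False by (auto simp: killed_def split: split_indicator)
    qed
    then have "Q ?F x y \<le> Q ?F x y'"
      unfolding Q_def[of ?F] trans_op_def by (intro integral_mono integrable_trans l)
    then show ?case by simp
  qed simp
  then show "\<exists>N. \<forall>n\<ge>N. (Q ^^ n) (\<lambda>x y. y) x y \<le> (Q ^^ n) (\<lambda>x y. y) x y'" by blast
qed (use assms in auto)

text \<open>Convergence and growth are known at positive heights only, so W enters the class after
  killing; measurability comes from the limit.\<close>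

lemma lin_growth_killed_W: "lin_growth (killed W)"
proof -
  obtain C where C: "0 \<le> C" "\<And>x y. 0 < y \<Longrightarrow> \<bar>W x y - w x y\<bar> \<le> 1 * y + C * (1 + \<bar>x\<bar>)"
    by (rule W_near_w[OF zero_less_one]) (rule that)
  have lim: "(\<lambda>n. killed ((Q ^^ n) w) x y) \<longlonglongrightarrow> killed W x y" for x y
    using Qn_w_tendsto[of y x] by (auto simp: killed_def split: split_indicator)
  have meas: "(\<lambda>p. killed W (fst p) (snd p)) \<in> borel_measurable (borel :: (real \<times> real) measure)"
  proof (rule borel_measurable_LIMSEQ_real[OF lim])
    show "(\<lambda>p. killed ((Q ^^ n) w) (fst p) (snd p)) \<in> borel_measurable borel" for n
      using lin_growth_killed[OF lin_growth_Qn[OF lin_growth_w]] by (simp add: lin_growth_def)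
  qed
  have dom: "lin_growth (\<lambda>x y. 1 * \<bar>w x y\<bar> + (1 * \<bar>y\<bar> + C * (1 + \<bar>x\<bar>)))"
    by (intro lin_growth_intros lin_growth_w)
  show ?thesis
  proof (rule lin_growth_dominated[OF dom meas])
    show "\<bar>killed W x y\<bar> \<le> 1 * \<bar>1 * \<bar>w x y\<bar> + (1 * \<bar>y\<bar> + C * (1 + \<bar>x\<bar>))\<bar>" for x y
    proof (cases "0 < y")
      case True
      then show ?thesis using C(2)[OF True, of x] by (simp add: killed_def)
    next
      case False
      then show ?thesis by (simp add: killed_def)
    qed
  qed simp
qed

text \<open>Both Q (Q^n w) and its limit are known: it is the shifted sequence, and dominated
  convergence moves the limit inside \<open>Q\<close>.\<close>

lemma Q_W:
  assumes y: "0 < y"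
  shows "Q W x y = W x y"
proof (rule LIMSEQ_unique)
  show "(\<lambda>n. (Q ^^ Suc n) w x y) \<longlonglongrightarrow> W x y"
    using LIMSEQ_Suc[OF Qn_w_tendsto[OF y]] .
  obtain C where C: "0 \<le> C" "\<And>x y n. 0 < y \<Longrightarrow> \<bar>(Q ^^ n) w x y - w x y\<bar> \<le> 1 * y + C * (1 + \<bar>x\<bar>)"
    by (rule W_near_w[OF zero_less_one]) (rule that)
  define D where "D x y = 1 * \<bar>w x y\<bar> + (1 * \<bar>y\<bar> + C * (1 + \<bar>x\<bar>))" for x y
  have dom: "lin_growth D"
    unfolding D_def[abs_def] by (intro lin_growth_intros lin_growth_w)
  have l: "lin_growth (killed ((Q ^^ n) w))" for n
    by (intro lin_growth_killed lin_growth_Qn lin_growth_w)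
  have "(\<lambda>n. trans_op (killed ((Q ^^ n) w)) x y) \<longlonglongrightarrow> trans_op (killed W) x y"
    unfolding trans_op_def
  proof (rule integral_dominated_convergence)
    show "integrable M (\<lambda>\<omega>. D (a \<omega> * x + b \<omega>) (y + (a \<omega> * x + b \<omega>)))"
      by (rule integrable_trans[OF dom])
    show "AE \<omega> in M. (\<lambda>n. killed ((Q ^^ n) w) (a \<omega> * x + b \<omega>) (y + (a \<omega> * x + b \<omega>)))
        \<longlonglongrightarrow> killed W (a \<omega> * x + b \<omega>) (y + (a \<omega> * x + b \<omega>))"
      using Qn_w_tendsto by (auto simp: killed_def split: split_indicator)
    have "\<bar>killed ((Q ^^ n) w) x y\<bar> \<le> D x y" for n x y
    proof (cases "0 < y")
      case True
      then show ?thesis using C(2)[OF True, of n x] by (simp add: killed_def D_def)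
    next
      case False
      have "0 \<le> C * (1 + \<bar>x\<bar>)" using C(1) by simp
      moreover have "killed ((Q ^^ n) w) x y = 0" using False by (simp add: killed_def)
      ultimately show ?thesis unfolding D_def by linarith
    qed
    then show "AE \<omega> in M. norm (killed ((Q ^^ n) w) (a \<omega> * x + b \<omega>) (y + (a \<omega> * x + b \<omega>)))
        \<le> D (a \<omega> * x + b \<omega>) (y + (a \<omega> * x + b \<omega>))" for n by simp
  qed (auto intro!: lin_growth_measurable[OF l] lin_growth_measurable[OF lin_growth_killed_W])
  then show "(\<lambda>n. (Q ^^ Suc n) w x y) \<longlonglongrightarrow> Q W x y"
    unfolding funpow.simps o_def Q_def .
qed

lemma Qn_W:
  assumes "0 < y"
  shows "(Q ^^ n) (killed W) x y = W x y"
proof (induction n)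
  case (Suc n)
  have "(Q ^^ Suc n) (killed W) x y = (Q ^^ n) (Q (killed W)) x y"
    unfolding funpow_Suc_right by simp
  also have "Q (killed W) = Q W" by (rule Q_cong) (simp add: killed_def)
  also have "(Q ^^ n) (Q W) x y = (Q ^^ n) (killed W) x y"
    using Q_W by (intro Qn_cong assms) (simp add: killed_def)
  finally show ?case using Suc by simp
qed (use assms in \<open>simp add: killed_def\<close>)

end

subsection \<open>The walk and its exit time\<close>

text \<open>The indicator of \<tau> > n as a real product: it multiplies integrands directly and
  visibly depends on the first n pairs only.\<close>

definition live :: "(nat \<Rightarrow> 'w \<Rightarrow> real) \<Rightarrow> (nat \<Rightarrow> 'w \<Rightarrow> real) \<Rightarrow> real \<Rightarrow> real \<Rightarrow> nat \<Rightarrow> 'w \<Rightarrow> real" where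
  "live A B x y n \<omega> = (\<Prod>k\<in>{1..n}. indicator {0<..} (y + walk A B x k \<omega>))"

lemma live_0 [simp]: "live A B x y 0 \<omega> = 1"
  by (simp add: live_def)

lemma live_Suc: "live A B x y (Suc n) \<omega> = live A B x y n \<omega> * indicator {0<..} (y + walk A B x (Suc n) \<omega>)"
  by (simp add: live_def prod.nat_ivl_Suc')

lemma live_eq_1: "(\<And>k. 1 \<le> k \<Longrightarrow> k \<le> n \<Longrightarrow> 0 < y + walk A B x k \<omega>) \<Longrightarrow> live A B x y n \<omega> = 1"
  unfolding live_def by (intro prod.neutral) auto

lemma live_eq_0: "1 \<le> k \<Longrightarrow> k \<le> n \<Longrightarrow> y + walk A B x k \<omega> \<le> 0 \<Longrightarrow> live A B x y n \<omega> = 0"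
  unfolding live_def by (rule prod_zero) (auto intro!: bexI[of _ k])

lemma live_cases: "live A B x y n \<omega> = 0 \<or> live A B x y n \<omega> = 1"
  by (induction n) (auto simp: live_Suc split: split_indicator)

lemma walk_Suc: "walk A B x (Suc n) \<omega> = walk A B x n \<omega> + chain A B x (Suc n) \<omega>"
  by (simp add: walk_def)

lemma walk_0 [simp]: "walk A B x 0 \<omega> = 0"
  by (simp add: walk_def)

lemma exit_time_eqI:
  assumes "1 \<le> n" "y + walk A B x n \<omega> \<le> 0" "\<And>k. 1 \<le> k \<Longrightarrow> k < n \<Longrightarrow> 0 < y + walk A B x k \<omega>"
  shows "exit_time A B x y \<omega> = enat n"
  unfolding exit_time_def
proof (rule antisym)
  show "(INF k\<in>{k. 1 \<le> k \<and> y + walk A B x k \<omega> \<le> 0}. enat k) \<le> enat n"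
    using assms by (intro INF_lower) auto
  show "enat n \<le> (INF k\<in>{k. 1 \<le> k \<and> y + walk A B x k \<omega> \<le> 0}. enat k)"
    using assms(3) by (intro INF_greatest) (auto simp: not_less[symmetric])
qed

lemma exit_time_infinity:
  assumes "\<And>k. 1 \<le> k \<Longrightarrow> 0 < y + walk A B x k \<omega>"
  shows "exit_time A B x y \<omega> = \<infinity>"
proof -
  have "{k. 1 \<le> k \<and> y + walk A B x k \<omega> \<le> 0} = {}" using assms by (auto simp: not_less[symmetric])
  then show ?thesis unfolding exit_time_def by (simp only: image_empty Inf_empty top_enat_def)
qed

text \<open>A finite exit time is at least 1, hence a successor; the positivity clause then runs
  exactly over the n earlier times.\<close>

lemma exit_time_cases:
  obtains (finite) n where "exit_time A B x y \<omega> = enat (Suc n)" "y + walk A B x (Suc n) \<omega> \<le> 0"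
      "\<And>k. 1 \<le> k \<Longrightarrow> k \<le> n \<Longrightarrow> 0 < y + walk A B x k \<omega>"
    | (infinite) "exit_time A B x y \<omega> = \<infinity>" "\<And>k. 1 \<le> k \<Longrightarrow> 0 < y + walk A B x k \<omega>"
proof (cases "\<exists>k. 1 \<le> k \<and> y + walk A B x k \<omega> \<le> 0")
  case True
  define l where "l = (LEAST k. 1 \<le> k \<and> y + walk A B x k \<omega> \<le> 0)"
  have l: "1 \<le> l" "y + walk A B x l \<omega> \<le> 0" using LeastI_ex[OF True] by (auto simp: l_def)
  have least: "0 < y + walk A B x k \<omega>" if "1 \<le> k" "k < l" for k
    using not_less_Least[of k "\<lambda>k. 1 \<le> k \<and> y + walk A B x k \<omega> \<le> 0"] that by (auto simp: l_def)
  from l(1) obtain n where n: "l = Suc n" by (cases l) auto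
  show ?thesis
    using l least exit_time_eqI[of l y A B x \<omega>] by (intro finite[of n]) (auto simp: n)
next
  case False
  then have pos: "0 < y + walk A B x k \<omega>" if "1 \<le> k" for k
    using that not_le by blast
  show ?thesis by (intro infinite exit_time_infinity pos)
qed

lemma live_exit_time: "live A B x y n \<omega> = (if enat n < exit_time A B x y \<omega> then 1 else 0)"
proof (rule exit_time_cases[of A B x y \<omega>], goal_cases)
  case (1 j)
  then show ?thesis
    using live_eq_1[of n y A B x \<omega>] live_eq_0[of "Suc j" n y A B x \<omega>] by (auto simp: not_le)
next
  case 2
  then show ?thesis using live_eq_1[of n y A B x \<omega>] by auto
qed

text \<open>The two sample spaces may differ, so that the same process can be evaluated on tuples of
  coordinates.\<close>

lemma chain_cong:
  assumes "\<And>i. 1 \<le> i \<Longrightarrow> i \<le> n \<Longrightarrow> A i \<omega> = A' i \<omega>'" "\<And>i. 1 \<le> i \<Longrightarrow> i \<le> n \<Longrightarrow> B i \<omega> = B' i \<omega>'"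
  shows "chain A B x n \<omega> = chain A' B' x n \<omega>'"
  using assms by (induction n) auto

lemma walk_cong:
  assumes "\<And>i. 1 \<le> i \<Longrightarrow> i \<le> n \<Longrightarrow> A i \<omega> = A' i \<omega>'" "\<And>i. 1 \<le> i \<Longrightarrow> i \<le> n \<Longrightarrow> B i \<omega> = B' i \<omega>'"
  shows "walk A B x n \<omega> = walk A' B' x n \<omega>'"
  unfolding walk_def using assms by (intro sum.cong chain_cong) auto

lemma live_cong:
  assumes "\<And>i. 1 \<le> i \<Longrightarrow> i \<le> n \<Longrightarrow> A i \<omega> = A' i \<omega>'" "\<And>i. 1 \<le> i \<Longrightarrow> i \<le> n \<Longrightarrow> B i \<omega> = B' i \<omega>'"
  shows "live A B x y n \<omega> = live A' B' x y n \<omega>'"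
  unfolding live_def using assms walk_cong[of _ A \<omega> A' \<omega>' B B'] by (intro prod.cong) auto

lemma chain_measurable:
  assumes "\<And>i. 1 \<le> i \<Longrightarrow> i \<le> n \<Longrightarrow> A i \<in> borel_measurable N" "\<And>i. 1 \<le> i \<Longrightarrow> i \<le> n \<Longrightarrow> B i \<in> borel_measurable N"
  shows "chain A B x n \<in> borel_measurable N"
  using assms
proof (induction n)
  case (Suc n)
  have [measurable]: "chain A B x n \<in> borel_measurable N" "A (Suc n) \<in> borel_measurable N" "B (Suc n) \<in> borel_measurable N"
    using Suc by auto
  have "chain A B x (Suc n) = (\<lambda>\<omega>. A (Suc n) \<omega> * chain A B x n \<omega> + B (Suc n) \<omega>)" by (simp add: fun_eq_iff)
  then show ?case by simp
next
  case 0
  have "chain A B x 0 = (\<lambda>\<omega>. x)" by (simp add: fun_eq_iff)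
  then show ?case by simp
qed

lemma walk_measurable:
  assumes "\<And>i. 1 \<le> i \<Longrightarrow> i \<le> n \<Longrightarrow> A i \<in> borel_measurable N" "\<And>i. 1 \<le> i \<Longrightarrow> i \<le> n \<Longrightarrow> B i \<in> borel_measurable N"
  shows "walk A B x n \<in> borel_measurable N"
proof -
  have "walk A B x n = (\<lambda>\<omega>. \<Sum>i=1..n. chain A B x i \<omega>)" by (simp add: fun_eq_iff walk_def)
  then show ?thesis using assms by (auto intro!: borel_measurable_sum chain_measurable)
qed

lemma live_measurable:
  assumes "\<And>i. 1 \<le> i \<Longrightarrow> i \<le> n \<Longrightarrow> A i \<in> borel_measurable N" "\<And>i. 1 \<le> i \<Longrightarrow> i \<le> n \<Longrightarrow> B i \<in> borel_measurable N"
  shows "live A B x y n \<in> borel_measurable N"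
proof -
  have "live A B x y n = (\<lambda>\<omega>. \<Prod>k\<in>{1..n}. indicator {0<..} (y + walk A B x k \<omega>))"
    by (simp add: fun_eq_iff live_def)
  moreover have "(\<lambda>\<omega>. indicator {0<..} (y + walk A B x k \<omega>) :: real) \<in> borel_measurable N" if "k \<in> {1..n}" for k
  proof -
    have [measurable]: "walk A B x k \<in> borel_measurable N" using assms that by (intro walk_measurable) auto
    show ?thesis by measurable
  qed
  ultimately show ?thesis by (simp add: borel_measurable_prod)
qed

section \<open>The Markov property for independent identically distributed pairs\<close>

locale affine_walk = affine_step M a b \<alpha>
  for M :: "'w measure" and a b :: "'w \<Rightarrow> real" and \<alpha> :: real +
  fixes A B :: "nat \<Rightarrow> 'w \<Rightarrow> real"
  assumes indep: "indep_vars (\<lambda>_. borel) (\<lambda>i \<omega>. (A i \<omega>, B i \<omega>)) {1..}"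
    and ident: "\<And>i. 1 \<le> i \<Longrightarrow>
      distr M borel (\<lambda>\<omega>. (A i \<omega>, B i \<omega>)) = distr M borel (\<lambda>\<omega>. (a \<omega>, b \<omega>))"
begin

lemma pair_measurable: "1 \<le> i \<Longrightarrow> (\<lambda>\<omega>. (A i \<omega>, B i \<omega>)) \<in> borel_measurable M"
  using indep unfolding indep_vars_def by auto

lemma A_measurable [measurable]: "1 \<le> i \<Longrightarrow> A i \<in> borel_measurable M"
  using measurable_compose[OF pair_measurable borel_measurable_fst_snd(1)] by simp

lemma B_measurable [measurable]: "1 \<le> i \<Longrightarrow> B i \<in> borel_measurable M"
  using measurable_compose[OF pair_measurable borel_measurable_fst_snd(2)] by simp

lemma process_measurable [measurable]:
  "chain A B x n \<in> borel_measurable M" "walk A B x n \<in> borel_measurable M" "live A B x y n \<in> borel_measurable M"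
  by (auto intro!: chain_measurable walk_measurable live_measurable)

lemma integrable_transfer:
  assumes i: "1 \<le> i" and f: "f \<in> borel_measurable (borel :: (real \<times> real) measure)"
  shows "integrable M (\<lambda>\<omega>. f (A i \<omega>, B i \<omega>)) \<longleftrightarrow> integrable M (\<lambda>\<omega>. f (a \<omega>, b \<omega>) :: real)"
  using integrable_distr_eq[OF pair_measurable[OF i] f] integrable_distr_eq[OF borel_measurable_Pair[OF a_meas b_meas] f]
  by (simp add: ident[OF i])

lemma integral_transfer:
  assumes i: "1 \<le> i" and f: "f \<in> borel_measurable (borel :: (real \<times> real) measure)"
  shows "(\<integral>\<omega>. f (A i \<omega>, B i \<omega>) \<partial>M) = (\<integral>\<omega>. f (a \<omega>, b \<omega>) \<partial>M :: real)"
  using integral_distr[OF pair_measurable[OF i] f] integral_distr[OF borel_measurable_Pair[OF a_meas b_meas] f]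
  by (simp add: ident[OF i])

lemma integrable_A [simp]: "1 \<le> i \<Longrightarrow> integrable M (A i)"
  using integrable_transfer[of i fst] by simp

lemma integrable_B [simp]: "1 \<le> i \<Longrightarrow> integrable M (B i)"
  using integrable_transfer[of i snd] by simp

definition hist :: "nat \<Rightarrow> 'w \<Rightarrow> nat \<Rightarrow> real \<times> real" where
  "hist n \<omega> = restrict (\<lambda>i. (A i \<omega>, B i \<omega>)) {1..n}"

abbreviation histM :: "nat \<Rightarrow> (nat \<Rightarrow> real \<times> real) measure" where
  "histM n \<equiv> PiM {1..n} (\<lambda>_. borel)"

text \<open>With \<open>snds\<close>, the coordinate processes on tuples: \<open>chain\<close>,
  \<open>walk\<close> and \<open>live\<close> run on them express the past as a function of
  \<open>hist n\<close>.\<close>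

abbreviation fsts :: "nat \<Rightarrow> (nat \<Rightarrow> real \<times> real) \<Rightarrow> real" where
  "fsts i s \<equiv> fst (s i)"

abbreviation snds :: "nat \<Rightarrow> (nat \<Rightarrow> real \<times> real) \<Rightarrow> real" where
  "snds i s \<equiv> snd (s i)"

text \<open>The next pair as a tuple with one index, the form in which independence of disjoint
  index blocks is available.\<close>

definition new :: "nat \<Rightarrow> 'w \<Rightarrow> nat \<Rightarrow> real \<times> real" where
  "new n \<omega> = restrict (\<lambda>i. (A i \<omega>, B i \<omega>)) {Suc n}"

abbreviation newM :: "nat \<Rightarrow> (nat \<Rightarrow> real \<times> real) measure" where
  "newM n \<equiv> PiM {Suc n} (\<lambda>_. borel)"

lemma new_simps [simp]: "new n \<omega> (Suc n) = (A (Suc n) \<omega>, B (Suc n) \<omega>)"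
  by (simp add: new_def)

lemma indep_hist: "indep_var (histM n) (hist n) (newM n) (new n)"
  unfolding hist_def[abs_def] new_def[abs_def] by (rule indep_var_restrict[OF indep]) auto

lemma new_measurable [measurable]:
  "fsts (Suc n) \<in> borel_measurable (newM n)" "snds (Suc n) \<in> borel_measurable (newM n)"
proof -
  have "(\<lambda>s. s (Suc n)) \<in> measurable (newM n) (borel :: (real \<times> real) measure)"
    by (intro measurable_component_singleton) auto
  then show "fsts (Suc n) \<in> borel_measurable (newM n)" "snds (Suc n) \<in> borel_measurable (newM n)"
    using measurable_compose borel_measurable_fst_snd by blast+
qed

lemma coords_measurable:
  assumes "1 \<le> i" "i \<le> n"
  shows "fsts i \<in> borel_measurable (histM n)" "snds i \<in> borel_measurable (histM n)"
proof -
  have "(\<lambda>s. s i) \<in> measurable (histM n) (borel :: (real \<times> real) measure)"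
    using assms by (intro measurable_component_singleton) auto
  then show "fsts i \<in> borel_measurable (histM n)" "snds i \<in> borel_measurable (histM n)"
    using measurable_compose borel_measurable_fst_snd by blast+
qed

lemma process_hist:
  "chain A B x n \<omega> = chain fsts snds x n (hist n \<omega>)"
  "walk A B x n \<omega> = walk fsts snds x n (hist n \<omega>)"
  "live A B x y n \<omega> = live fsts snds x y n (hist n \<omega>)"
  by (auto intro!: chain_cong walk_cong live_cong simp: hist_def)

lemma hist_process_measurable [measurable]:
  "chain fsts snds x n \<in> borel_measurable (histM n)"
  "walk fsts snds x n \<in> borel_measurable (histM n)"
  "live fsts snds x y n \<in> borel_measurable (histM n)"
  by (auto intro!: chain_measurable walk_measurable live_measurable coords_measurable)

lemma integrable_chain [simp]: "integrable M (chain A B x n)"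
proof (induction n)
  case 0
  have "chain A B x 0 = (\<lambda>\<omega>. x)" by (simp add: fun_eq_iff)
  then show ?case by simp
next
  case (Suc n)
  have "indep_var borel (chain fsts snds x n \<circ> hist n) borel (fsts (Suc n) \<circ> new n)"
    by (rule indep_var_compose[OF indep_hist]) measurable
  moreover have "chain fsts snds x n \<circ> hist n = chain A B x n"
    using process_hist(1) by (simp add: fun_eq_iff)
  moreover have "fsts (Suc n) \<circ> new n = A (Suc n)" by (simp add: fun_eq_iff)
  ultimately have "integrable M (\<lambda>\<omega>. chain A B x n \<omega> * A (Suc n) \<omega>)"
    using Suc by (intro indep_var_integrable) auto
  moreover have "chain A B x (Suc n) = (\<lambda>\<omega>. chain A B x n \<omega> * A (Suc n) \<omega> + B (Suc n) \<omega>)"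
    by (simp add: fun_eq_iff mult.commute)
  ultimately show ?case by simp
qed

lemma integrable_walk [simp]: "integrable M (walk A B x n)"
proof -
  have "walk A B x n = (\<lambda>\<omega>. \<Sum>i=1..n. chain A B x i \<omega>)" by (simp add: fun_eq_iff walk_def)
  then show ?thesis by simp
qed

lemma integrable_lin_growth:
  assumes G: "lin_growth G"
  shows "integrable M (\<lambda>\<omega>. live A B x y k \<omega> * G (chain A B x n \<omega>) (y + walk A B x n \<omega>))"
proof -
  obtain C where C: "\<And>x y. \<bar>G x y\<bar> \<le> C * (1 + \<bar>x\<bar> + \<bar>y\<bar>)"
    using G unfolding lin_growth_def by blast
  have [measurable]: "(\<lambda>\<omega>. G (chain A B x n \<omega>) (y + walk A B x n \<omega>)) \<in> borel_measurable M"
    by (intro lin_growth_measurable[OF G]) auto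
  show ?thesis
  proof (rule integrable_real_bound)
    show "integrable M (\<lambda>\<omega>. C * (1 + \<bar>chain A B x n \<omega>\<bar> + \<bar>y + walk A B x n \<omega>\<bar>))" by auto
    fix \<omega>
    have "\<bar>live A B x y k \<omega> * G (chain A B x n \<omega>) (y + walk A B x n \<omega>)\<bar> \<le> \<bar>G (chain A B x n \<omega>) (y + walk A B x n \<omega>)\<bar>"
      using live_cases[of A B x y k \<omega>] by auto
    also note C
    finally show "\<bar>live A B x y k \<omega> * G (chain A B x n \<omega>) (y + walk A B x n \<omega>)\<bar>
        \<le> C * (1 + \<bar>chain A B x n \<omega>\<bar> + \<bar>y + walk A B x n \<omega>\<bar>)" .
  qed measurable
qed

text \<open>The joint law of history and next pair is a product measure. \<open>live\<close> at time
  n depends on the history alone, so Fubini leaves an inner integral over the next pair, and this is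
  \<open>trans_op\<close>.\<close>

lemma markov_step:
  assumes G: "lin_growth G"
  shows "(\<integral>\<omega>. live A B x y n \<omega> * G (chain A B x (Suc n) \<omega>) (y + walk A B x (Suc n) \<omega>) \<partial>M)
       = (\<integral>\<omega>. live A B x y n \<omega> * trans_op G (chain A B x n \<omega>) (y + walk A B x n \<omega>) \<partial>M)"
proof -
  let ?H = "distr M (histM n) (hist n)"
  let ?P = "distr M (newM n) (new n)"
  have rv: "hist n \<in> measurable M (histM n)" "new n \<in> measurable M (newM n)"
    using indep_hist[of n] by (auto dest: indep_var_rv1 indep_var_rv2)
  have joint: "?H \<Otimes>\<^sub>M ?P = distr M (histM n \<Otimes>\<^sub>M newM n) (\<lambda>\<omega>. (hist n \<omega>, new n \<omega>))"
    using indep_hist[of n] unfolding indep_var_distribution_eq by blast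
  interpret H: prob_space ?H by (rule prob_space_distr[OF rv(1)])
  interpret P: prob_space ?P by (rule prob_space_distr[OF rv(2)])
  interpret HP: pair_sigma_finite ?H ?P ..
  define c where "c = chain fsts snds x n"
  define z where "z s = y + walk fsts snds x n s" for s
  define l where "l = live fsts snds x y n"
  have [measurable]: "c \<in> borel_measurable (histM n)" "z \<in> borel_measurable (histM n)" "l \<in> borel_measurable (histM n)"
    unfolding c_def z_def[abs_def] l_def by measurable
  define X where "X s t = fsts (Suc n) t * c s + snds (Suc n) t" for s t
  define f where "f p = l (fst p) * G (X (fst p) (snd p)) (z (fst p) + X (fst p) (snd p))" for p
  have f_meas: "f \<in> borel_measurable (histM n \<Otimes>\<^sub>M newM n)"
  proof -
    have [measurable]: "(\<lambda>p. X (fst p) (snd p)) \<in> borel_measurable (histM n \<Otimes>\<^sub>M newM n)"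
      unfolding X_def by measurable
    have "(\<lambda>p. G (X (fst p) (snd p)) (z (fst p) + X (fst p) (snd p))) \<in> borel_measurable (histM n \<Otimes>\<^sub>M newM n)"
      by (intro lin_growth_measurable[OF G]) measurable
    then show ?thesis unfolding f_def[abs_def] by measurable
  qed
  have pair_meas: "(\<lambda>\<omega>. (hist n \<omega>, new n \<omega>)) \<in> measurable M (histM n \<Otimes>\<^sub>M newM n)"
    by (intro measurable_Pair rv)
  have f_eq: "f (hist n \<omega>, new n \<omega>)
      = live A B x y n \<omega> * G (chain A B x (Suc n) \<omega>) (y + walk A B x (Suc n) \<omega>)" for \<omega>
    unfolding f_def X_def c_def z_def l_def walk_Suc chain.simps process_hist[where n = n] by (simp add: add.assoc)
  have f_int: "integrable (?H \<Otimes>\<^sub>M ?P) f"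
    unfolding joint integrable_distr_eq[OF pair_meas f_meas] f_eq by (rule integrable_lin_growth[OF G])
  \<comment> \<open>With the history s frozen, the next pair may be replaced by the generic one,
    because only its law enters.\<close>
  have inner: "(\<integral>t. f (s, t) \<partial>?P) = l s * trans_op G (c s) (z s)" for s
  proof -
    have m: "(\<lambda>p. G (fst p * c s + snd p) (z s + (fst p * c s + snd p))) \<in> borel_measurable (borel :: (real \<times> real) measure)"
      by (intro lin_growth_measurable[OF G]) measurable
    have "(\<lambda>t. G (X s t) (z s + X s t)) \<in> borel_measurable (newM n)"
      unfolding X_def by (intro lin_growth_measurable[OF G]) measurable
    then have "(\<integral>t. f (s, t) \<partial>?P) = (\<integral>\<omega>. f (s, new n \<omega>) \<partial>M)"
      by (intro integral_distr rv(2)) (simp add: f_def)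
    also have "\<dots> = l s * (\<integral>\<omega>. G (A (Suc n) \<omega> * c s + B (Suc n) \<omega>) (z s + (A (Suc n) \<omega> * c s + B (Suc n) \<omega>)) \<partial>M)"
      by (simp add: f_def X_def)
    also have "\<dots> = l s * trans_op G (c s) (z s)"
      using integral_transfer[OF _ m, of "Suc n"] by (simp add: trans_op_def)
    finally show ?thesis .
  qed
  have "(\<integral>\<omega>. live A B x y n \<omega> * G (chain A B x (Suc n) \<omega>) (y + walk A B x (Suc n) \<omega>) \<partial>M)
      = integral\<^sup>L (?H \<Otimes>\<^sub>M ?P) f"
    unfolding joint integral_distr[OF pair_meas f_meas] f_eq ..
  also have "\<dots> = (\<integral>s. l s * trans_op G (c s) (z s) \<partial>?H)"
    unfolding HP.integral_fst'[OF f_int, symmetric] inner ..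
  also have "\<dots> = (\<integral>\<omega>. l (hist n \<omega>) * trans_op G (c (hist n \<omega>)) (z (hist n \<omega>)) \<partial>M)"
  proof (rule integral_distr[OF rv(1)])
    have "(\<lambda>s. trans_op G (c s) (z s)) \<in> borel_measurable (histM n)"
      by (intro lin_growth_measurable[OF lin_growth_trans[OF G]]) measurable
    then show "(\<lambda>s. l s * trans_op G (c s) (z s)) \<in> borel_measurable (histM n)" by measurable
  qed
  also have "\<dots> = (\<integral>\<omega>. live A B x y n \<omega> * trans_op G (chain A B x n \<omega>) (y + walk A B x n \<omega>) \<partial>M)"
    unfolding c_def z_def l_def process_hist[where n = n] ..
  finally show ?thesis .
qed

text \<open>Peeling off the last step replaces G by \<open>Q G\<close>, so the induction runs over
  arbitrary G.\<close>

lemma Qn_eq_expectation: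
  assumes G: "lin_growth G"
  shows "(\<integral>\<omega>. live A B x y n \<omega> * G (chain A B x n \<omega>) (y + walk A B x n \<omega>) \<partial>M) = (Q ^^ n) G x y"
  using G
proof (induction n arbitrary: G)
  case 0
  then show ?case by (simp add: prob_space)
next
  case (Suc n)
  \<comment> \<open>The last survival indicator moves into \<open>killed G\<close>; what remains of
    \<open>live\<close> is determined by the first n pairs, as \<open>markov_step\<close>
    demands.\<close>
  have "live A B x y (Suc n) \<omega> * G (chain A B x (Suc n) \<omega>) (y + walk A B x (Suc n) \<omega>)
      = live A B x y n \<omega> * killed G (chain A B x (Suc n) \<omega>) (y + walk A B x (Suc n) \<omega>)" for \<omega>
    unfolding live_Suc killed_def by (simp only: mult_ac)
  then have "(\<integral>\<omega>. live A B x y (Suc n) \<omega> * G (chain A B x (Suc n) \<omega>) (y + walk A B x (Suc n) \<omega>) \<partial>M)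
      = (\<integral>\<omega>. live A B x y n \<omega> * trans_op (killed G) (chain A B x n \<omega>) (y + walk A B x n \<omega>) \<partial>M)"
    using markov_step[OF lin_growth_killed[OF Suc.prems]] by (simp only:)
  also have "\<dots> = (Q ^^ n) (Q G) x y"
    unfolding Q_def[of G] by (intro Suc.IH lin_growth_trans lin_growth_killed Suc.prems)
  finally show ?case unfolding funpow_Suc_right by simp
qed

lemma exit_expectation:
  assumes G: "lin_growth G"
  shows "(\<integral>\<omega>. live A B x y n \<omega> * exited G (chain A B x (Suc n) \<omega>) (y + walk A B x (Suc n) \<omega>) \<partial>M)
    = (Q ^^ n) (trans_op (exited G)) x y"
  using markov_step[OF lin_growth_exited[OF G]] Qn_eq_expectation[OF lin_growth_trans[OF lin_growth_exited[OF G]]]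
  by simp


subsection \<open>Positivity and growth\<close>

text \<open>A centred variable that is almost surely not positive vanishes almost surely, against
  the assumption on b.\<close>

lemma b_pos_not_null: "\<not> (AE \<omega> in M. b \<omega> \<le> 0)"
proof
  assume *: "AE \<omega> in M. b \<omega> \<le> 0"
  have "(\<integral>\<omega>. - b \<omega> \<partial>M) = 0 \<longleftrightarrow> (AE \<omega> in M. - b \<omega> = 0)"
    using * by (intro integral_nonneg_eq_0_iff_AE) auto
  then have "AE \<omega> in M. - b \<omega> = 0" using b_mean by simp
  then have "\<P>(\<omega> in M. b \<omega> \<noteq> 0) = 0" by (intro prob_eq_0_AE) auto
  with b_nonzero show False by simp
qed

text \<open>By harmonicity a nonnegative function has integral zero.\<close>

lemma W_zero_AE:
  assumes "0 < y" "W x y = 0"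
  shows "AE \<omega> in M. killed W (a \<omega> * x + b \<omega>) (y + (a \<omega> * x + b \<omega>)) = 0"
proof -
  have "0 \<le> killed W u v" for u v
    using W_nonneg[of v u] by (auto simp: killed_def split: split_indicator)
  moreover have "(\<integral>\<omega>. killed W (a \<omega> * x + b \<omega>) (y + (a \<omega> * x + b \<omega>)) \<partial>M) = 0"
    using Q_W[OF assms(1), of x] assms(2) by (simp add: Q_def trans_op_def)
  ultimately show ?thesis
    using integrable_trans[OF lin_growth_killed_W] by (subst (asm) integral_nonneg_eq_0_iff_AE) auto
qed

text \<open>A zero of \<open>W\<close> at \<open>(x, y)\<close> forces \<open>\<rho> x + y \<le> 0\<close> and propagates along the killed chain; then the
  heights contract geometrically, so the chain started near \<open>(0, 0)\<close> cannot escape the region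
  \<open>\<rho> x + y \<le> 0\<close>, although a positive value of \<open>b\<close> makes it do so.\<close>

lemma W_pos_of_nonneg_mean:
  assumes \<rho>: "0 \<le> \<rho>" and survive: "\<And>x y. 0 < y \<Longrightarrow> 0 < Q (\<lambda>x y. 1) x y" and y: "0 < y"
  shows "0 < W x y"
proof (rule ccontr)
  assume "\<not> 0 < W x y"
  then have W0: "W x y = 0" using W_nonneg[OF y, of x] by linarith
  \<comment> \<open>From \<rho> x' + (y + x') \<le> 0 one gets (1 + \<rho>) (y + x') \<le> \<rho> y,
    so the new height is at most k y.\<close>
  define k where "k = \<rho> / (1 + \<rho>)"
  have k: "0 \<le> k" "k < 1" using \<rho> by (auto simp: k_def)
  have next_zero: "\<exists>x' y'. 0 < y' \<and> W x' y' = 0 \<and> y' \<le> k * y \<and> \<bar>x'\<bar> \<le> y"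
    if y: "0 < y" and W0: "W x y = 0" for x y
  proof -
    \<comment> \<open>Survival has positive probability, so the almost sure vanishing is realised at
      some surviving outcome.\<close>
    have "\<exists>\<omega>. 0 < y + (a \<omega> * x + b \<omega>) \<and> W (a \<omega> * x + b \<omega>) (y + (a \<omega> * x + b \<omega>)) = 0"
    proof (rule ccontr)
      assume none: "\<not> ?thesis"
      have "AE \<omega> in M. killed (\<lambda>x y. 1) (a \<omega> * x + b \<omega>) (y + (a \<omega> * x + b \<omega>)) = 0"
        using W_zero_AE[OF y W0] by eventually_elim (use none in \<open>auto simp: killed_def split: split_indicator_asm\<close>)
      then have "Q (\<lambda>x y. 1) x y = 0"
        unfolding Q_def trans_op_def by (rule integral_eq_zero_AE)
      with survive[OF y, of x] show False by simp
    qed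
    then obtain x' where x': "0 < y + x'" "W x' (y + x') = 0" by blast
    have "\<rho> * x' + (y + x') \<le> 0" using W_ge_w[OF x'(1) \<rho>, of x'] x'(2) by (simp add: w_def)
    moreover have x'neg: "x' < 0"
    proof (rule ccontr)
      assume "\<not> x' < 0"
      then have "0 \<le> \<rho> * x'" using \<rho> by simp
      with x'(1) \<open>\<rho> * x' + (y + x') \<le> 0\<close> show False by linarith
    qed
    ultimately have "(y + x') * (1 + \<rho>) \<le> \<rho> * y" by (simp add: algebra_simps)
    then have "y + x' \<le> k * y" using \<rho> by (simp add: k_def field_simps)
    then show ?thesis using x' x'neg by (intro exI[of _ x'] exI[of _ "y + x'"]) auto
  qed
  have "\<exists>f :: nat \<Rightarrow> real \<times> real. f 0 = (x, y) \<and> (\<forall>n. (0 < snd (f n) \<and> W (fst (f n)) (snd (f n)) = 0) \<and>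
      snd (f (Suc n)) \<le> k * snd (f n) \<and> \<bar>fst (f (Suc n))\<bar> \<le> snd (f n))"
  proof -
    \<comment> \<open>The predicate depends on the index only to fix the start at (x, y).\<close>
    define P where "P n p \<longleftrightarrow> 0 < snd p \<and> W (fst p) (snd p) = 0 \<and> (n = 0 \<longrightarrow> p = (x, y))" for n :: nat and p
    have "\<exists>f. \<forall>n. P n (f n) \<and> snd (f (Suc n)) \<le> k * snd (f n) \<and> \<bar>fst (f (Suc n))\<bar> \<le> snd (f n)"
    proof (rule dependent_nat_choice)
      show "\<exists>p. P 0 p" using y W0 by (auto simp: P_def)
      fix p n assume "P n p"
      then show "\<exists>p'. P (Suc n) p' \<and> snd p' \<le> k * snd p \<and> \<bar>fst p'\<bar> \<le> snd p"
        using next_zero[of "snd p" "fst p"] by (auto simp: P_def)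
    qed
    then show ?thesis unfolding P_def by blast
  qed
  then obtain f :: "nat \<Rightarrow> real \<times> real" where
    f: "\<And>n. 0 < snd (f n)" "\<And>n. W (fst (f n)) (snd (f n)) = 0"
      "\<And>n. snd (f (Suc n)) \<le> k * snd (f n)" "\<And>n. \<bar>fst (f (Suc n))\<bar> \<le> snd (f n)"
    by blast
  have height: "(\<lambda>n. snd (f n)) \<longlonglongrightarrow> 0"
    by (rule contraction_tendsto_zero[where \<kappa> = k and z = "\<lambda>_. 0"]) (use f k in \<open>auto intro: less_imp_le\<close>)
  have "(\<lambda>n. fst (f (Suc n))) \<longlonglongrightarrow> 0"
    by (rule Lim_null_comparison[OF _ height]) (use f in auto)
  then have pos: "(\<lambda>n. fst (f n)) \<longlonglongrightarrow> 0" by (rule LIMSEQ_imp_Suc)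
  \<comment> \<open>Countably many points, hence one null set for all of them.\<close>
  have "AE \<omega> in M. \<forall>n. killed W (a \<omega> * fst (f n) + b \<omega>) (snd (f n) + (a \<omega> * fst (f n) + b \<omega>)) = 0"
    unfolding AE_all_countable using W_zero_AE f by blast
  then have "AE \<omega> in M. b \<omega> \<le> 0"
  proof eventually_elim
    case (elim \<omega>)
    show ?case
    proof (rule ccontr)
      assume "\<not> b \<omega> \<le> 0"
      then have b: "0 < b \<omega>" by simp
      \<comment> \<open>If b > 0 at this outcome, the step from a late point is upward; then w, and
        with it W, is positive at a point where W should vanish.\<close>
      have "(\<lambda>n. a \<omega> * fst (f n) + b \<omega>) \<longlonglongrightarrow> a \<omega> * 0 + b \<omega>"
        by (intro tendsto_intros pos)
      then have "eventually (\<lambda>n. 0 < a \<omega> * fst (f n) + b \<omega>) sequentially"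
        using b by (intro order_tendstoD(1)) auto
      then obtain n where n: "0 < a \<omega> * fst (f n) + b \<omega>" using eventually_happens'[OF sequentially_bot] by blast
      define X where "X = a \<omega> * fst (f n) + b \<omega>"
      have X: "0 < X" "0 < snd (f n) + X" using n f(1)[of n] by (auto simp: X_def intro: add_pos_pos)
      have "0 < w X (snd (f n) + X)" using X \<rho> by (simp add: w_def add_nonneg_pos)
      also have "\<dots> \<le> W X (snd (f n) + X)" using X \<rho> by (intro W_ge_w)
      also have "\<dots> = killed W X (snd (f n) + X)" using X by (simp add: killed_def)
      also have "\<dots> = 0" using elim by (simp add: X_def)
      finally show False by simp
    qed
  qed
  with b_pos_not_null show False by simp
qed

lemma W_near_y:
  assumes "0 < \<delta>"
  obtains C where "0 < C" "\<And>x y. 0 < y \<Longrightarrow> \<bar>W x y - y\<bar> \<le> \<delta> * y + C * (1 + \<bar>x\<bar>)"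
proof -
  obtain C where C: "0 \<le> C" "\<And>x y. 0 < y \<Longrightarrow> \<bar>W x y - w x y\<bar> \<le> \<delta> * y + C * (1 + \<bar>x\<bar>)"
    by (rule W_near_w[OF assms]) (rule that)
  show ?thesis
  proof (rule that[of "C + \<bar>\<rho>\<bar> + 1"])
    fix x y :: real assume y: "0 < y"
    have "\<bar>W x y - y\<bar> \<le> \<bar>W x y - w x y\<bar> + \<bar>\<rho> * x\<bar>" by (simp add: w_def)
    also have "\<dots> \<le> (\<delta> * y + C * (1 + \<bar>x\<bar>)) + \<bar>\<rho>\<bar> * \<bar>x\<bar>"
      using C(2)[OF y, of x] by (simp add: abs_mult)
    also have "\<dots> \<le> \<delta> * y + (C + \<bar>\<rho>\<bar> + 1) * (1 + \<bar>x\<bar>)" by (simp add: algebra_simps)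
    finally show "\<bar>W x y - y\<bar> \<le> \<delta> * y + (C + \<bar>\<rho>\<bar> + 1) * (1 + \<bar>x\<bar>)" .
  qed (use C in auto)
qed

text \<open>\<open>W_near_y\<close> has the linear error C (1 + |x|), and 1 + |x| \<le> 2 (1 +
  |x|^p) turns it into the stated form with 2 C.\<close>

lemma W_bounds:
  assumes \<delta>: "0 < \<delta>" and p: "2 < p"
  obtains C where "0 < C" "\<And>x y. 0 < y \<Longrightarrow> W x y \<ge> max 0 ((1 - \<delta>) * y - C * (1 + \<bar>x\<bar> powr p))"
    "\<And>x y. 0 < y \<Longrightarrow> W x y \<le> (1 + \<delta> * (1 + \<bar>x\<bar> powr (p - 1))) * y + C * (1 + \<bar>x\<bar> powr p)"
proof -
  obtain C where C: "0 < C" "\<And>x y. 0 < y \<Longrightarrow> \<bar>W x y - y\<bar> \<le> \<delta> * y + C * (1 + \<bar>x\<bar>)"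
    by (rule W_near_y[OF \<delta>]) (rule that)
  have le: "C * (1 + \<bar>x\<bar>) \<le> 2 * C * (1 + \<bar>x\<bar> powr p)" for x
  proof -
    define P where "P = \<bar>x\<bar> powr p"
    have "\<bar>x\<bar> \<le> 1 + P" unfolding P_def
    proof (cases "\<bar>x\<bar> \<le> 1")
      case False
      then have "\<bar>x\<bar> powr 1 \<le> \<bar>x\<bar> powr p" using p by (intro powr_mono) auto
      then show "\<bar>x\<bar> \<le> 1 + \<bar>x\<bar> powr p" by simp
    next
      case True
      then show "\<bar>x\<bar> \<le> 1 + \<bar>x\<bar> powr p" by (simp add: add_increasing2)
    qed
    moreover have "0 \<le> P" by (simp add: P_def)
    ultimately have "1 + \<bar>x\<bar> \<le> 2 * (1 + P)" by simp
    then have "C * (1 + \<bar>x\<bar>) \<le> C * (2 * (1 + P))" using C(1) by (intro mult_left_mono) auto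
    then show ?thesis by (simp add: P_def mult_ac)
  qed
  show ?thesis
  proof (rule that[of "2 * C"])
    fix x y :: real assume y: "0 < y"
    note * = C(2)[OF y, of x] le[of x]
    then have "(1 - \<delta>) * y - 2 * C * (1 + \<bar>x\<bar> powr p) \<le> W x y"
      unfolding left_diff_distrib by linarith
    then show "W x y \<ge> max 0 ((1 - \<delta>) * y - 2 * C * (1 + \<bar>x\<bar> powr p))"
      using W_nonneg[OF y, of x] by simp
    have "0 \<le> \<delta> * \<bar>x\<bar> powr (p - 1) * y" using \<delta> y by simp
    with * show "W x y \<le> (1 + \<delta> * (1 + \<bar>x\<bar> powr (p - 1))) * y + 2 * C * (1 + \<bar>x\<bar> powr p)"
      unfolding distrib_left distrib_right mult_1_left mult_1_right by linarith
  qed (use C in auto)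
qed

lemma W_asymp: "((\<lambda>y. W x y / y) \<longlongrightarrow> 1) at_top"
proof (rule tendstoI)
  fix e :: real assume e: "0 < e"
  then have "0 < e / 2" by simp
  then obtain C where C: "0 < C" "\<And>x y. 0 < y \<Longrightarrow> \<bar>W x y - y\<bar> \<le> e / 2 * y + C * (1 + \<bar>x\<bar>)"
    by (rule W_near_y) (rule that)
  have "eventually (\<lambda>y. max 0 (C * (1 + \<bar>x\<bar>) * 2 / e) < y) at_top" by (rule eventually_gt_at_top)
  then show "eventually (\<lambda>y. dist (W x y / y) 1 < e) at_top"
  proof eventually_elim
    case (elim y)
    then have y: "0 < y" and "C * (1 + \<bar>x\<bar>) * 2 / e < y" by auto
    then have "C * (1 + \<bar>x\<bar>) < e / 2 * y" using e by (simp add: field_simps)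
    with C(2)[OF y, of x] have "\<bar>W x y - y\<bar> < e * y" by linarith
    moreover have "W x y / y - 1 = (W x y - y) / y" using y by (simp add: field_simps)
    ultimately show ?case using y by (simp add: dist_real_def abs_divide pos_divide_less_eq)
  qed
qed

end

section \<open>Identification of V with the harmonic limit\<close>

context affine_walk
begin

text \<open>By iterated harmonicity W x y is the mean of W at time n on survival. A nonnegative
  integrand that is positive on a non-null event has positive mean.\<close>

lemma W_pos_of_event:
  assumes y: "0 < y" and E: "0 < \<P>(\<omega> in M. E \<omega>)"
    and event: "\<And>\<omega>. E \<omega> \<Longrightarrow> live A B x y n \<omega> = 1 \<and> 0 < killed W (chain A B x n \<omega>) (y + walk A B x n \<omega>)"
  shows "0 < W x y"
proof (rule ccontr)
  let ?f = "\<lambda>\<omega>. live A B x y n \<omega> * killed W (chain A B x n \<omega>) (y + walk A B x n \<omega>)"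
  assume "\<not> 0 < W x y"
  then have "W x y = 0" using W_nonneg[OF y, of x] by linarith
  then have "(\<integral>\<omega>. ?f \<omega> \<partial>M) = 0"
    using Qn_eq_expectation[OF lin_growth_killed_W, of x y n] Qn_W[OF y, of n x] by simp
  moreover have nonneg: "0 \<le> killed W u v" for u v
    using W_nonneg[of v u] by (auto simp: killed_def split: split_indicator)
  have "0 \<le> ?f \<omega>" for \<omega> using live_cases[of A B x y n \<omega>] nonneg by auto
  ultimately have "AE \<omega> in M. ?f \<omega> = 0"
    using integrable_lin_growth[OF lin_growth_killed_W] by (subst (asm) integral_nonneg_eq_0_iff_AE) auto
  then have "AE \<omega> in M. \<not> E \<omega>" by eventually_elim (use event in force)
  then have "\<P>(\<omega> in M. E \<omega>) = 0" by (rule prob_eq_0_AE)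
  with E show False by simp
qed

text \<open>The probability of never exiting is below every survival probability, and these tend to
  0.\<close>

lemma exit_time_finite:
  assumes y: "0 < y"
  shows "AE \<omega> in M. exit_time A B x y \<omega> < \<infinity>"
proof -
  let ?S = "{\<omega> \<in> space M. \<forall>n. live A B x y n \<omega> = 1}"
  have S: "?S \<in> sets M" by measurable
  have "prob ?S \<le> (Q ^^ n) (\<lambda>x y. 1) x y" for n
  proof -
    have "prob ?S = (\<integral>\<omega>. indicator ?S \<omega> \<partial>M)" using S by simp
    also have "\<dots> \<le> (\<integral>\<omega>. live A B x y n \<omega> * 1 \<partial>M)"
    proof (rule integral_mono)
      show "integrable M (indicator ?S :: _ \<Rightarrow> real)" using S by (simp add: emeasure_eq_measure)
      show "integrable M (\<lambda>\<omega>. live A B x y n \<omega> * 1)" by (rule integrable_lin_growth[OF lin_growth_const])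
      show "indicator ?S \<omega> \<le> live A B x y n \<omega> * 1" for \<omega>
        using live_cases[of A B x y n \<omega>] by (auto split: split_indicator)
    qed
    also have "\<dots> = (Q ^^ n) (\<lambda>x y. 1) x y" by (rule Qn_eq_expectation[OF lin_growth_const])
    finally show ?thesis .
  qed
  then have "prob ?S \<le> 0"
    by (intro LIMSEQ_le_const[OF Qn_one_tendsto[OF y]]) auto
  then have "prob ?S = 0" using measure_nonneg[of M ?S] by linarith
  then have "AE \<omega> in M. \<omega> \<notin> ?S" using prob_eq_0[OF S] by simp
  then show ?thesis
    using AE_space
  proof eventually_elim
    case (elim \<omega>)
    then obtain n where "live A B x y n \<omega> \<noteq> 1" by auto
    then have "exit_time A B x y \<omega> \<le> enat n" by (simp add: live_exit_time not_less split: if_splits)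
    then show ?case by (rule order.strict_trans1) simp
  qed
qed

text \<open>The part of M_\<tau> on the event \<tau> = k + 1: along the path M equals w minus its
  initial value.\<close>

definition exit_term :: "real \<Rightarrow> real \<Rightarrow> nat \<Rightarrow> 'w \<Rightarrow> real" where
  "exit_term x y k \<omega> = live A B x y k \<omega> *
     exited (\<lambda>u v. w u v - w x y) (chain A B x (Suc k) \<omega>) (y + walk A B x (Suc k) \<omega>)"

lemma exit_term_sums: "exit_term x y k \<omega> = (if exit_time A B x y \<omega> = enat (Suc k) then mart_exit M a A B x y \<omega> else 0)"
proof (rule exit_time_cases[of A B x y \<omega>], goal_cases)
  case (1 j)
  consider "k < j" | "k = j" | "j < k" by linarith
  then show ?case
  proof cases
    case 1
    then have "0 < y + walk A B x (Suc k) \<omega>" using \<open>\<And>k. 1 \<le> k \<Longrightarrow> k \<le> j \<Longrightarrow> 0 < y + walk A B x k \<omega>\<close>[of "Suc k"] by simp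
    then show ?thesis using 1 \<open>exit_time A B x y \<omega> = enat (Suc j)\<close> by (simp add: exit_term_def exited_def)
  next
    case 2
    have "live A B x y k \<omega> = 1" using \<open>exit_time A B x y \<omega> = enat (Suc j)\<close> 2 by (simp add: live_exit_time)
    moreover have "w (chain A B x (Suc j) \<omega>) (y + walk A B x (Suc j) \<omega>) - w x y = mart M a A B x (Suc j) \<omega>"
      unfolding mart_def w_def m_def[symmetric] \<rho>_def[symmetric] by (simp add: right_diff_distrib)
    ultimately show ?thesis
      using \<open>exit_time A B x y \<omega> = enat (Suc j)\<close> \<open>y + walk A B x (Suc j) \<omega> \<le> 0\<close> 2
      by (simp add: exit_term_def exited_def mart_exit_def del: chain.simps)
  next
    case 3
    have "live A B x y k \<omega> = 0" using \<open>exit_time A B x y \<omega> = enat (Suc j)\<close> 3 by (simp add: live_exit_time)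
    then show ?thesis using \<open>exit_time A B x y \<omega> = enat (Suc j)\<close> 3 by (simp add: exit_term_def)
  qed
next
  case 2
  have "0 < y + walk A B x (Suc k) \<omega>" by (rule 2) simp
  then show ?case using 2(1) by (simp add: exit_term_def exited_def)
qed

text \<open>At most one term is nonzero. The value 0 at an infinite exit time agrees with the series
  whose terms all vanish.\<close>

lemma mart_exit_suminf:
  "mart_exit M a A B x y \<omega> = (\<Sum>k. exit_term x y k \<omega>)" "summable (\<lambda>k. norm (exit_term x y k \<omega>))"
proof -
  have "(\<lambda>k. exit_term x y k \<omega>) sums mart_exit M a A B x y \<omega> \<and> summable (\<lambda>k. norm (exit_term x y k \<omega>))"
  proof (rule exit_time_cases[of A B x y \<omega>], goal_cases)
    case (1 j)
    then have *: "exit_term x y k \<omega> = (if k = j then mart_exit M a A B x y \<omega> else 0)" for k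
      by (simp add: exit_term_sums)
    have "summable (\<lambda>k. norm (exit_term x y k \<omega>))"
      by (rule summable_finite[of "{j}"]) (auto simp: *)
    then show ?case unfolding * using sums_single[of j "\<lambda>_. mart_exit M a A B x y \<omega>"] by simp
  next
    case 2
    then have "exit_term x y k \<omega> = 0" for k by (simp add: exit_term_sums)
    moreover have "mart_exit M a A B x y \<omega> = 0" using 2 by (simp add: mart_exit_def)
    ultimately show ?case by simp
  qed
  then show "mart_exit M a A B x y \<omega> = (\<Sum>k. exit_term x y k \<omega>)" "summable (\<lambda>k. norm (exit_term x y k \<omega>))"
    by (auto simp: sums_iff)
qed

text \<open>The k-th term is the probability of \<tau> = k + 1, a difference of consecutive survival
  probabilities, so the sum telescopes.\<close>

lemma Qn_exit_prob_sums:
  assumes y: "0 < y"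
  shows "(\<lambda>k. (Q ^^ k) (trans_op (exited (\<lambda>x y. 1))) x y) sums 1"
proof -
  have "(Q ^^ k) (trans_op (exited (\<lambda>x y. 1))) x y
      = (Q ^^ k) (\<lambda>x y. 1) x y - (Q ^^ Suc k) (\<lambda>x y. 1) x y" for k
  proof -
    have *: "trans_op (exited (\<lambda>x y. 1)) x y = 1 - Q (\<lambda>x y. 1) x y" for x y
      using Q_plus_exit[OF lin_growth_const[of 1], of x y] by (simp add: trans_op_def prob_space)
    have "(Q ^^ k) (trans_op (exited (\<lambda>x y. 1))) x y = (Q ^^ k) (\<lambda>x y. 1 - Q (\<lambda>x y. 1) x y) x y"
      by (intro Qn_cong y *)
    also have "\<dots> = (Q ^^ k) (\<lambda>x y. 1) x y - (Q ^^ k) (Q (\<lambda>x y. 1)) x y"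
      by (intro Qn_diff lin_growth_Q lin_growth_const)
    finally show ?thesis unfolding funpow_Suc_right by simp
  qed
  then show ?thesis using telescope_sums'[OF Qn_one_tendsto[OF y, of x]] by simp
qed

text \<open>Sum and integral are exchanged along the exit times. The majorant comes from |M_\<tau>|
  \<le> (1 + |\<rho>|) |X_\<tau>| + |w x y|. Since the exit probabilities add up to 1, the initial
  value w x y is subtracted exactly once.\<close>

lemma mart_exit_integral:
  assumes y: "0 < y"
  shows "integrable M (mart_exit M a A B x y)" "V M a A B x y = W x y"
proof -
  let ?p = "trans_op (exited (\<lambda>x y. 1))"
  define G where "G u v = w u v - w x y" for u v
  have G: "lin_growth G" unfolding G_def[abs_def] by (intro lin_growth_intros lin_growth_w)
  have p: "lin_growth ?p" by (intro lin_growth_trans lin_growth_intros)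
  have term_eq: "exit_term x y k = (\<lambda>\<omega>. live A B x y k \<omega> * exited G (chain A B x (Suc k) \<omega>) (y + walk A B x (Suc k) \<omega>))" for k
    by (simp add: fun_eq_iff exit_term_def G_def[abs_def])
  have term_int: "integrable M (exit_term x y k)" for k
    unfolding term_eq by (intro integrable_lin_growth lin_growth_exited G)
  have norm_eq: "norm (exit_term x y k \<omega>)
      = live A B x y k \<omega> * exited (\<lambda>u v. \<bar>G u v\<bar>) (chain A B x (Suc k) \<omega>) (y + walk A B x (Suc k) \<omega>)" for k \<omega>
    using live_cases[of A B x y k \<omega>] by (auto simp: term_eq exited_def abs_mult split: split_indicator)
  have "summable (\<lambda>k. \<integral>\<omega>. norm (exit_term x y k \<omega>) \<partial>M)"
  proof (rule summable_comparison_test')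
    show "summable (\<lambda>k. (1 + \<bar>\<rho>\<bar>) * (Q ^^ k) exit_abs x y + \<bar>w x y\<bar> * (Q ^^ k) ?p x y)"
      using exit_abs_potential(1)[OF y] Qn_exit_prob_sums[OF y]
      by (intro summable_add summable_mult) (auto simp: sums_iff)
    fix k
    have "(\<integral>\<omega>. norm (exit_term x y k \<omega>) \<partial>M) = (Q ^^ k) (trans_op (exited (\<lambda>u v. \<bar>G u v\<bar>))) x y"
      unfolding norm_eq by (intro exit_expectation lin_growth_abs G)
    also have "\<dots> \<le> (Q ^^ k) (\<lambda>u v. (1 + \<bar>\<rho>\<bar>) * exit_abs u v + \<bar>w x y\<bar> * ?p u v) x y"
    proof (intro Qn_mono lin_growth_intros lin_growth_trans G y)
      fix u v :: real assume v: "0 < v"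
      have "trans_op (exited (\<lambda>u v. \<bar>G u v\<bar>)) u v
          \<le> trans_op (\<lambda>u v. (1 + \<bar>\<rho>\<bar>) * exited (\<lambda>x y. \<bar>x\<bar>) u v + \<bar>w x y\<bar> * exited (\<lambda>x y. 1) u v) u v"
      proof (intro trans_mono lin_growth_intros G)
        fix \<omega>
        define X where "X = a \<omega> * u + b \<omega>"
        have "\<bar>G X (v + X)\<bar> \<le> (1 + \<bar>\<rho>\<bar>) * \<bar>X\<bar> + \<bar>w x y\<bar>" if "v + X \<le> 0"
        proof -
          have "\<bar>G X (v + X)\<bar> \<le> \<bar>\<rho> * X\<bar> + \<bar>v + X\<bar> + \<bar>w x y\<bar>" unfolding G_def w_def[of X] by simp
          also have "\<dots> \<le> \<bar>\<rho>\<bar> * \<bar>X\<bar> + \<bar>X\<bar> + \<bar>w x y\<bar>" using that v by (simp add: abs_mult)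
          finally show ?thesis by (simp add: algebra_simps)
        qed
        then show "exited (\<lambda>u v. \<bar>G u v\<bar>) (a \<omega> * u + b \<omega>) (v + (a \<omega> * u + b \<omega>))
            \<le> (1 + \<bar>\<rho>\<bar>) * exited (\<lambda>x y. \<bar>x\<bar>) (a \<omega> * u + b \<omega>) (v + (a \<omega> * u + b \<omega>))
              + \<bar>w x y\<bar> * exited (\<lambda>x y. 1) (a \<omega> * u + b \<omega>) (v + (a \<omega> * u + b \<omega>))"
          unfolding X_def[symmetric] by (auto simp: exited_def split: split_indicator)
      qed
      also have "\<dots> = (1 + \<bar>\<rho>\<bar>) * exit_abs u v + \<bar>w x y\<bar> * ?p u v"
        by (subst trans_add) (intro lin_growth_intros, intro lin_growth_intros, simp only: trans_mult)
      finally show "trans_op (exited (\<lambda>u v. \<bar>G u v\<bar>)) u v \<le> (1 + \<bar>\<rho>\<bar>) * exit_abs u v + \<bar>w x y\<bar> * ?p u v" .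
    qed
    also have "\<dots> = (1 + \<bar>\<rho>\<bar>) * (Q ^^ k) exit_abs x y + \<bar>w x y\<bar> * (Q ^^ k) ?p x y"
      by (subst Qn_add) (intro lin_growth_mult lin_growth_exit_abs, intro lin_growth_mult p, simp only: Qn_mult)
    finally show "norm (\<integral>\<omega>. norm (exit_term x y k \<omega>) \<partial>M)
        \<le> (1 + \<bar>\<rho>\<bar>) * (Q ^^ k) exit_abs x y + \<bar>w x y\<bar> * (Q ^^ k) ?p x y" by simp
  qed
  note series = term_int AE_I2[OF mart_exit_suminf(2)] this
  have eq: "mart_exit M a A B x y = (\<lambda>\<omega>. \<Sum>k. exit_term x y k \<omega>)"
    using mart_exit_suminf(1) by (simp add: fun_eq_iff)
  show "integrable M (mart_exit M a A B x y)"
    unfolding eq by (rule integrable_suminf[OF series])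
  have "(\<lambda>k. \<integral>\<omega>. exit_term x y k \<omega> \<partial>M) sums (\<integral>\<omega>. mart_exit M a A B x y \<omega> \<partial>M)"
    unfolding eq by (rule sums_integral[OF series])
  moreover have "(\<integral>\<omega>. exit_term x y k \<omega> \<partial>M) = (Q ^^ k) exit_w x y - w x y * (Q ^^ k) ?p x y" for k
  proof -
    have "(\<integral>\<omega>. exit_term x y k \<omega> \<partial>M) = (Q ^^ k) (trans_op (exited G)) x y"
      unfolding term_eq by (rule exit_expectation[OF G])
    also have "trans_op (exited G) = (\<lambda>u v. exit_w u v + (- w x y) * ?p u v)"
    proof (intro ext)
      fix u v
      have "trans_op (exited G) u v = trans_op (\<lambda>u v. exited w u v + (- w x y) * exited (\<lambda>x y. 1) u v) u v"
        unfolding trans_op_def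
        by (intro Bochner_Integration.integral_cong) (auto simp: G_def exited_def split: split_indicator)
      also have "\<dots> = exit_w u v + (- w x y) * ?p u v"
        unfolding exit_w_def
        by (subst trans_add) (intro lin_growth_intros lin_growth_w, intro lin_growth_intros, simp only: trans_mult)
      finally show "trans_op (exited G) u v = exit_w u v + (- w x y) * ?p u v" .
    qed
    also have "(Q ^^ k) (\<lambda>u v. exit_w u v + (- w x y) * ?p u v) x y = (Q ^^ k) exit_w x y + (- w x y) * (Q ^^ k) ?p x y"
      by (subst Qn_add) (intro lin_growth_exit_w, intro lin_growth_mult p, simp only: Qn_mult)
    finally show ?thesis by simp
  qed
  moreover have "(\<lambda>k. (Q ^^ k) exit_w x y - w x y * (Q ^^ k) ?p x y) sums ((\<Sum>k. (Q ^^ k) exit_w x y) - w x y * 1)"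
    by (intro sums_diff sums_mult Qn_exit_prob_sums y summable_sums summable_exit_w)
  ultimately have "(\<integral>\<omega>. mart_exit M a A B x y \<omega> \<partial>M) = (\<Sum>k. (Q ^^ k) exit_w x y) - w x y"
    by (simp add: sums_unique2)
  then show "V M a A B x y = W x y" by (simp add: V_def W_def)
qed

lemma Q_plus_V:
  assumes y: "0 < y"
  shows "Q_plus M A B (V M a A B) x y = V M a A B x y"
proof -
  have m: "(\<lambda>p. killed W (fst p * x + snd p) (y + (fst p * x + snd p))) \<in> borel_measurable (borel :: (real \<times> real) measure)"
    by (intro lin_growth_measurable[OF lin_growth_killed_W]) measurable
  \<comment> \<open>V and W are identified at positive heights; the indicator in
    \<open>Q_plus\<close> discards the others.\<close>
  have "V M a A B u v * indicator {0<..} v = killed W u v" for u v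
    using mart_exit_integral(2)[of v u] by (auto simp: killed_def split: split_indicator)
  then have "Q_plus M A B (V M a A B) x y
      = (\<integral>\<omega>. killed W (A 1 \<omega> * x + B 1 \<omega>) (y + (A 1 \<omega> * x + B 1 \<omega>)) \<partial>M)"
    by (simp add: Q_plus_def walk_def)
  also have "\<dots> = Q W x y"
    using integral_transfer[OF order_refl m] by (simp add: Q_def trans_op_def)
  finally show ?thesis using Q_W[OF y] mart_exit_integral(2)[OF y] by simp
qed

end

theorem theorem2p1:
  fixes M :: "'w measure"
    and a b :: "'w \<Rightarrow> real"
    and A B :: "nat \<Rightarrow> 'w \<Rightarrow> real"
    and \<alpha> :: real
  assumes "prob_space M"
    and "a \<in> borel_measurable M" and "b \<in> borel_measurable M"
    and "prob_space.indep_vars M (\<lambda>_. borel) (\<lambda>i \<omega>. (A i \<omega>, B i \<omega>)) {1..}"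
    and "\<And>i. 1 \<le> i \<Longrightarrow>
           distr M borel (\<lambda>\<omega>. (A i \<omega>, B i \<omega>)) = distr M borel (\<lambda>\<omega>. (a \<omega>, b \<omega>))"
    and "\<alpha> > 2"
    and "integrable M (\<lambda>\<omega>. \<bar>a \<omega>\<bar> powr \<alpha>)" and "(\<integral>\<omega>. \<bar>a \<omega>\<bar> powr \<alpha> \<partial>M) < 1"
    and "integrable M (\<lambda>\<omega>. \<bar>b \<omega>\<bar> powr \<alpha>)"
    and "\<P>(\<omega> in M. b \<omega> \<noteq> 0) > 0"
    and "integral\<^sup>L M b = 0"
    and "(integral\<^sup>L M a \<ge> 0 \<and> (\<forall>x. \<forall>y>0. \<P>(\<omega> in M. exit_time A B x y \<omega> > 1) > 0))
       \<or> (\<forall>x. \<forall>y>0. \<exists>p\<^sub>0. 2 < p\<^sub>0 \<and> p\<^sub>0 < \<alpha> \<and>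
             (\<forall>c>0. \<exists>n\<^sub>0\<ge>1.
                \<P>(\<omega> in M. (chain A B x n\<^sub>0 \<omega>, y + walk A B x n\<^sub>0 \<omega>) \<in> K p\<^sub>0 c
                          \<and> exit_time A B x y \<omega> > enat n\<^sub>0) > 0))"
  shows "(\<forall>x. \<forall>y>0. (AE \<omega> in M. exit_time A B x y \<omega> < \<infinity>)
                   \<and> integrable M (mart_exit M a A B x y))
       \<and> (\<forall>x. \<forall>y>0. V M a A B x y > 0 \<and> Q_plus M A B (V M a A B) x y = V M a A B x y)
       \<and> (\<forall>x. mono_on {0<..} (V M a A B x))
       \<and> (\<forall>\<delta>>0. \<forall>p. 2 < p \<and> p < \<alpha> \<longrightarrow>
            (\<exists>c>0. \<forall>x. \<forall>y>0.
               V M a A B x y \<ge> max 0 ((1 - \<delta>) * y - c * (1 + \<bar>x\<bar> powr p)) \<and>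
               V M a A B x y \<le> (1 + \<delta> * (1 + \<bar>x\<bar> powr (p - 1))) * y + c * (1 + \<bar>x\<bar> powr p)))
       \<and> (\<forall>x. ((\<lambda>y. V M a A B x y / y) \<longlongrightarrow> 1) at_top)"
proof -
  interpret affine_walk M a b \<alpha> A B
    using assms(1-11) by (intro affine_walk.intro affine_step.intro affine_step_axioms.intro affine_walk_axioms.intro)
  have V: "V M a A B x y = W x y" if "0 < y" for x y
    by (rule mart_exit_integral(2)[OF that])
  have pos: "0 < W x y" if y: "0 < y" for x y
    using assms(12)
  proof (elim disjE conjE)
    assume m0: "integral\<^sup>L M a \<ge> 0" and surv: "\<forall>x. \<forall>y>0. \<P>(\<omega> in M. exit_time A B x y \<omega> > 1) > 0"
    have "0 \<le> \<rho>" using m0 abs_m_less_1 unfolding \<rho>_def m_def by (intro divide_nonneg_nonneg) auto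
    \<comment> \<open>Q 1 is the probability of surviving the first step, written with the generic
      pair.\<close>
    moreover have "0 < Q (\<lambda>x y. 1) x y" if y: "0 < y" for x y
    proof (rule ccontr)
      assume "\<not> 0 < Q (\<lambda>x y. 1) x y"
      moreover have "0 \<le> (Q ^^ 1) (\<lambda>x y. 1) x y" using y by (intro Qn_nonneg) auto
      ultimately have "(Q ^^ 1) (\<lambda>x y. 1) x y = 0" by simp
      then have "(\<integral>\<omega>. live A B x y 1 \<omega> * 1 \<partial>M) = 0"
        using Qn_eq_expectation[OF lin_growth_const, of x y 1 1] by simp
      then have "AE \<omega> in M. live A B x y 1 \<omega> * 1 = 0"
        using live_cases[of A B x y 1] integrable_lin_growth[OF lin_growth_const, of x y 1 1]
        by (subst (asm) integral_nonneg_eq_0_iff_AE) (auto intro!: AE_I2, metis order_refl zero_le_one)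
      then have "AE \<omega> in M. \<not> exit_time A B x y \<omega> > 1"
        by eventually_elim (auto simp: live_exit_time one_enat_def split: if_splits)
      then have "\<P>(\<omega> in M. exit_time A B x y \<omega> > 1) = 0" by (rule prob_eq_0_AE)
      with surv y show False by (metis less_irrefl)
    qed
    ultimately show ?thesis using W_pos_of_nonneg_mean y by blast
  next
    assume "\<forall>x. \<forall>y>0. \<exists>p\<^sub>0. 2 < p\<^sub>0 \<and> p\<^sub>0 < \<alpha> \<and> (\<forall>c>0. \<exists>n\<^sub>0\<ge>1.
                \<P>(\<omega> in M. (chain A B x n\<^sub>0 \<omega>, y + walk A B x n\<^sub>0 \<omega>) \<in> K p\<^sub>0 c
                          \<and> exit_time A B x y \<omega> > enat n\<^sub>0) > 0)"
    then obtain p where p: "2 < p" and reach: "\<And>c. 0 < c \<Longrightarrow> \<exists>n\<ge>1.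
        \<P>(\<omega> in M. (chain A B x n \<omega>, y + walk A B x n \<omega>) \<in> K p c \<and> exit_time A B x y \<omega> > enat n) > 0"
      using y by blast
    \<comment> \<open>The lower bound with \<delta> = 1/2 is positive on \<open>K p (4 * C)\<close>:
      there v/2 \<ge> 2 C (1 + |u|^p), twice the error term.\<close>
    obtain C where C: "0 < C"
      and lower: "\<And>x y. 0 < y \<Longrightarrow> W x y \<ge> max 0 ((1 - 1 / 2) * y - C * (1 + \<bar>x\<bar> powr p))"
      by (rule W_bounds[of "1 / 2" p]) (use p in auto)
    from reach[of "4 * C"] C obtain n where
      n: "\<P>(\<omega> in M. (chain A B x n \<omega>, y + walk A B x n \<omega>) \<in> K p (4 * C) \<and> exit_time A B x y \<omega> > enat n) > 0"
      by auto
    show ?thesis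
    proof (rule W_pos_of_event[OF y n])
      fix \<omega>
      define u where "u = chain A B x n \<omega>"
      define v where "v = y + walk A B x n \<omega>"
      assume "(chain A B x n \<omega>, y + walk A B x n \<omega>) \<in> K p (4 * C) \<and> exit_time A B x y \<omega> > enat n"
      then have *: "0 < v" "4 * C * (1 + \<bar>u\<bar> powr p) \<le> v" "exit_time A B x y \<omega> > enat n"
        by (auto simp: K_def u_def v_def)
      have "0 < C * (1 + \<bar>u\<bar> powr p)" using C by (intro mult_pos_pos) (auto intro: add_pos_nonneg)
      then have "0 < (1 - 1 / 2) * v - C * (1 + \<bar>u\<bar> powr p)" using *(2) by simp
      then have "0 < W u v" using lower[OF *(1), of u] by simp
      then show "live A B x y n \<omega> = 1 \<and> 0 < killed W (chain A B x n \<omega>) (y + walk A B x n \<omega>)"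
        using * by (simp add: live_exit_time killed_def u_def[symmetric] v_def[symmetric])
    qed
  qed
  show ?thesis
  proof (intro conjI allI impI)
    fix x y :: real assume y: "0 < y"
    show "AE \<omega> in M. exit_time A B x y \<omega> < \<infinity>" by (rule exit_time_finite[OF y])
    show "integrable M (mart_exit M a A B x y)" by (rule mart_exit_integral(1)[OF y])
    show "0 < V M a A B x y" using pos[OF y] V[OF y] by simp
    show "Q_plus M A B (V M a A B) x y = V M a A B x y" by (rule Q_plus_V[OF y])
  next
    show "mono_on {0<..} (V M a A B x)" for x
      using W_mono V by (auto intro!: mono_onI)
  next
    fix \<delta> p :: real assume "0 < \<delta>" "2 < p \<and> p < \<alpha>"
    then have d: "0 < \<delta>" "2 < p" by auto
    obtain C where "0 < C" "\<And>x y. 0 < y \<Longrightarrow> W x y \<ge> max 0 ((1 - \<delta>) * y - C * (1 + \<bar>x\<bar> powr p))"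
      "\<And>x y. 0 < y \<Longrightarrow> W x y \<le> (1 + \<delta> * (1 + \<bar>x\<bar> powr (p - 1))) * y + C * (1 + \<bar>x\<bar> powr p)"
      by (rule W_bounds[OF d]) (rule that)
    then show "\<exists>c>0. \<forall>x. \<forall>y>0.
               V M a A B x y \<ge> max 0 ((1 - \<delta>) * y - c * (1 + \<bar>x\<bar> powr p)) \<and>
               V M a A B x y \<le> (1 + \<delta> * (1 + \<bar>x\<bar> powr (p - 1))) * y + c * (1 + \<bar>x\<bar> powr p)"
      using V by (intro exI[of _ C]) simp
  next
    fix x
    have "eventually (\<lambda>y. W x y / y = V M a A B x y / y) at_top"
      using eventually_gt_at_top[of 0] by eventually_elim (simp add: V)
    then show "((\<lambda>y. V M a A B x y / y) \<longlongrightarrow> 1) at_top"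
      using W_asymp by (rule Lim_transform_eventually[rotated])
  qed
qed

end
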